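(* Let $n\in\mathbb{N}_{\ge 3}$ and let $\mathcal{W}$ be a connected finite reflection groupoid of rank two with $2n$ objects. The set of connected finite reflection groupoids of rank two with the same objects and the same object change diagram as $\mathcal{W}$ is a variety isomorphic to the spectrum of the cluster algebra of type $A_{n-3}$, where the edges of the $n$-gon $q_1,\ldots,q_n$ are specialized to $1$.
   Context: $K$-Cartan schemes. Let $K$ be a ring, $I$ a set with $|I|=2$, $A$ a non-empty set, $\rho_i:A\to A$ a map for each $i\in I$, and $C^a=(c^a_{jk})_{j,k\in I}\in K^{I\times I}$ a matrix for each $a\in A$. The quadruple $\mathcal{C}=(I,A,(\rho_i)_{i\in I},(C^a)_{a\in A})$ is a $K$-Cartan scheme (of rank two) if $c^a_{ii}=2$, $\rho_i^2=\mathrm{id}$, and $c^a_{ij}=c^{\rho_i(a)}_{ij}$ for all $a\in A$, $i,j\in I$. With $(\alpha_i)_{i\in I}$ the standard basis of $K^I$, define $\sigma_i^a\in\mathrm{Aut}(K^I)$ by $\sigma_i^a(\alpha_j)=\alpha_j-c^a_{ij}\alpha_i$, regarded as a morphism from $a$ to $\rho_i(a)$; $\mathcal{W}(\mathcal{C})$ is the category with object set $A$ and morphisms generated by these maps. The object change diagram of $\mathcal{C}$ is the undirected graph with vertex set $A$ having, for each $i\in I$ and $a\in A$ with $\rho_i(a)\neq a$, exactly one edge labelled $i$ between $a$ and $\rho_i(a)$, and no other edges. For $m\in\mathbb{N}$, $a\in A$ and $i,j\in I$ let $\mathrm{Prod}(m;a,i,j)=\cdots\sigma_i\sigma_j\sigma_i^a$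 with $m$ factors (each factor taken at the object reached so far). Let $\tau=\begin{pmatrix}0&1\\1&0\end{pmatrix}$. $\mathcal{W}(\mathcal{C})$ is called a finite reflection groupoid (of rank two) if the object change diagram of $\mathcal{C}$ is a cycle and $\mathrm{Prod}(n;a,i,j)=-\tau^n$ for all $a\in A$ and $i,j\in I$ with $i\neq j$, where $n=|A|/2$. Variety structure: the entries of the defining matrices $C^a$ are viewed as indeterminates, the finiteness condition $\mathrm{Prod}(n;a,i,j)=-\tau^n$ is translated into polynomial equations in them, and the resulting variety is considered. The cluster algebra of type $A_{n-3}$. Take a convex $n$-gon and choose a triangulation by non-intersecting diagonals; label these diagonals by $x_1,\dots,x_{n-3}$ and the edges of the $n$-gon by $q_1,\dots,q_n$. The labels of the remaining diagonals are obtained by flipping diagonals: if two adjacent triangles have sides labelled $(x,a,b)$ and $(x,c,d)$, where $x$ is the common diagonal and $a,b,c,d$ are the sides of the resulting quadrilateral in cyclic order, the label $y$ of the other diagonal of the quadrilateral satisfies $xy=ac+bd$. The cluster algebra of type $A_{n-3}$ is the subalgebra of the rational function field in $x_1,\ldots,x_{n-3},q_1,\ldots,q_n$ generated by all the labels in the $n$-gon; in the version used here, the variables $q_1,\dots,q_n$ are specialized to $1$. *)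

theory Defs
  imports
    "HOL-Analysis.Finite_Cartesian_Product"
    "HOL-Analysis.Abstract_Topology"
    "HOL-Library.Poly_Mapping"
    "HOL-Library.FuncSet"
    "HOL-Computational_Algebra.Fraction_Field"
    "HOL-Algebra.QuotRing"
    "HOL-Algebra.Generated_Rings"
    "HOL-Algebra.Algebraic_Closure_Type"
begin

section \<open>Cartan schemes and reflection groupoids of rank two\<close>

text \<open>
  The index set \<open>I\<close> and the (automatically non-empty) object set \<open>A\<close> of a Cartan scheme are the
  types \<open>'i\<close> and \<open>'a\<close>.  The remaining data are the maps \<open>\<rho> i\<close> and the matrices \<open>C a\<close>, whose
  entry in row \<open>j\<close> and column \<open>k\<close> is \<open>C a $ j $ k\<close>.
\<close>

definition cartan_scheme ::
    "('i::finite \<Rightarrow> 'a \<Rightarrow> 'a) \<Rightarrow> ('a \<Rightarrow> 'k::comm_ring_1 ^ 'i ^ 'i) \<Rightarrow> bool" where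
  "cartan_scheme \<rho> C \<longleftrightarrow>
     CARD('i) = 2 \<and>
     (\<forall>a i. C a $ i $ i = 2) \<and>
     (\<forall>a i. \<rho> i (\<rho> i a) = a) \<and>
     (\<forall>a i j. C a $ i $ j = C (\<rho> i a) $ i $ j)"

text \<open>Matrix of \<open>\<alpha>\<^sub>j \<mapsto> \<alpha>\<^sub>j - c\<^sub>i\<^sub>j \<alpha>\<^sub>i\<close> (column \<open>l\<close> is the image of \<open>\<alpha>\<^sub>l\<close>),
  a morphism from \<open>a\<close> to \<open>\<rho> i a\<close>.\<close>

definition sigma :: "('a \<Rightarrow> 'k::comm_ring_1 ^ 'i ^ 'i) \<Rightarrow> 'a \<Rightarrow> 'i::finite \<Rightarrow> 'k ^ 'i ^ 'i" where
  "sigma C a i = (\<chi> k l. (if k = l then 1 else 0) - (if k = i then C a $ i $ l else 0))"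

text \<open>The category \<open>\<W>(\<C>)\<close>, given by its morphisms \<open>(source, matrix, target)\<close>.\<close>

inductive_set weyl_groupoid ::
    "('i::finite \<Rightarrow> 'a \<Rightarrow> 'a) \<Rightarrow> ('a \<Rightarrow> 'k::comm_ring_1 ^ 'i ^ 'i) \<Rightarrow> ('a \<times> ('k ^ 'i ^ 'i) \<times> 'a) set"
  for \<rho> C where
    ident: "(a, mat 1, a) \<in> weyl_groupoid \<rho> C"
  | comp: "(a, M, b) \<in> weyl_groupoid \<rho> C \<Longrightarrow> (a, sigma C b i ** M, \<rho> i b) \<in> weyl_groupoid \<rho> C"

definition connected_groupoid ::
    "('i::finite \<Rightarrow> 'a \<Rightarrow> 'a) \<Rightarrow> ('a \<Rightarrow> 'k::comm_ring_1 ^ 'i ^ 'i) \<Rightarrow> bool" where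
  "connected_groupoid \<rho> C \<longleftrightarrow> (\<forall>a b. \<exists>M. (a, M, b) \<in> weyl_groupoid \<rho> C)"

text \<open>A multigraph with labelled edges: the vertex set, and the set of pairs (label, end points).\<close>

definition object_change_diagram :: "('i \<Rightarrow> 'a \<Rightarrow> 'a) \<Rightarrow> 'a set \<times> ('i \<times> 'a set) set" where
  "object_change_diagram \<rho> = (UNIV, {(i, {a, \<rho> i a}) | i a. \<rho> i a \<noteq> a})"

definition is_cycle :: "'a set \<times> ('i \<times> 'a set) set \<Rightarrow> bool" where
  "is_cycle G \<longleftrightarrow> (\<exists>m v e. 2 \<le> m \<and> bij_betw v {..<m} (fst G) \<and> bij_betw e {..<m} (snd G) \<and>
     (\<forall>k<m. snd (e k) = {v k, v (Suc k mod m)}))"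

text \<open>\<open>Prod(m; a, i, j) = \<dots>\<sigma>\<^sub>i\<sigma>\<^sub>j\<sigma>\<^sub>i\<^sup>a\<close> with \<open>m\<close> factors.\<close>

primrec refl_prod ::
    "nat \<Rightarrow> ('i::finite \<Rightarrow> 'a \<Rightarrow> 'a) \<Rightarrow> ('a \<Rightarrow> 'k::comm_ring_1 ^ 'i ^ 'i) \<Rightarrow> 'a \<Rightarrow> 'i \<Rightarrow> 'i \<Rightarrow> 'k ^ 'i ^ 'i"
  where
    "refl_prod 0 \<rho> C a i j = mat 1"
  | "refl_prod (Suc m) \<rho> C a i j = refl_prod m \<rho> C (\<rho> i a) j i ** sigma C a i"

definition tau :: "'k::comm_ring_1 ^ 'i ^ 'i::finite" where
  "tau = (\<chi> k l. if k = l then 0 else 1)"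

definition tau_power :: "nat \<Rightarrow> 'k::comm_ring_1 ^ 'i ^ 'i::finite" where
  "tau_power m = (((**) tau) ^^ m) (mat 1)"

definition finite_reflection_groupoid ::
    "('i::finite \<Rightarrow> 'a \<Rightarrow> 'a) \<Rightarrow> ('a \<Rightarrow> 'k::comm_ring_1 ^ 'i ^ 'i) \<Rightarrow> bool" where
  "finite_reflection_groupoid \<rho> C \<longleftrightarrow>
     cartan_scheme \<rho> C \<and>
     is_cycle (object_change_diagram \<rho>) \<and>
     (\<forall>a i j. i \<noteq> j \<longrightarrow> refl_prod (CARD('a) div 2) \<rho> C a i j = - tau_power (CARD('a) div 2))"


section \<open>Polynomials and the equations of the variety\<close>

type_synonym ('v, 'k) mpoly = "('v \<Rightarrow>\<^sub>0 nat) \<Rightarrow>\<^sub>0 'k"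

definition mpoly_const :: "'k::comm_ring_1 \<Rightarrow> ('v, 'k) mpoly" where
  "mpoly_const c = Poly_Mapping.single 0 c"

definition mpoly_var :: "'v \<Rightarrow> ('v, 'k::comm_ring_1) mpoly" where
  "mpoly_var v = Poly_Mapping.single (Poly_Mapping.single v 1) 1"

definition mpoly_eval :: "('v \<Rightarrow> 'k::comm_ring_1) \<Rightarrow> ('v, 'k) mpoly \<Rightarrow> 'k" where
  "mpoly_eval x p =
     (\<Sum>m\<in>Poly_Mapping.keys p. Poly_Mapping.lookup p m *
        (\<Prod>v\<in>Poly_Mapping.keys m. x v ^ Poly_Mapping.lookup m v))"

text \<open>The matrices all of whose entries are independent indeterminates; the indeterminate
  \<open>(a, j, k)\<close> stands for the entry in row \<open>j\<close> and column \<open>k\<close> of the matrix at \<open>a\<close>.\<close>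

definition generic_matrices :: "'a \<Rightarrow> ('a \<times> 'i \<times> 'i, 'k::comm_ring_1) mpoly ^ 'i ^ 'i::finite" where
  "generic_matrices a = (\<chi> j k. mpoly_var (a, j, k))"

text \<open>The conditions on the matrices in the definitions of Cartan schemes and of finite
  reflection groupoids, as polynomials in these indeterminates.\<close>

definition groupoid_equations ::
    "('i::finite \<Rightarrow> 'a \<Rightarrow> 'a) \<Rightarrow> ('a \<times> 'i \<times> 'i, 'k::comm_ring_1) mpoly set" where
  "groupoid_equations \<rho> =
     {generic_matrices a $ i $ i - 2 | a i. True} \<union>
     {generic_matrices a $ i $ j - generic_matrices (\<rho> i a) $ i $ j | a i j. True} \<union>
     {(refl_prod (CARD('a) div 2) \<rho> generic_matrices a i j + tau_power (CARD('a) div 2)) $ k $ l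
       | a i j k l. i \<noteq> j}"

definition zero_locus ::
    "('a \<times> 'i \<times> 'i, 'k::comm_ring_1) mpoly set \<Rightarrow> ('a \<Rightarrow> 'k ^ 'i ^ 'i::finite) set" where
  "zero_locus F = {C. \<forall>f\<in>F. mpoly_eval (\<lambda>(a, j, k). C a $ j $ k) f = 0}"

definition equation_ideal ::
    "('a \<times> 'i \<times> 'i, 'k::comm_ring_1) mpoly set \<Rightarrow> ('a \<times> 'i \<times> 'i, 'k) mpoly set" where
  "equation_ideal F = genideal ring_of_type_algebra F"

definition coordinate_ring ::
    "('a \<times> 'i \<times> 'i, 'k::comm_ring_1) mpoly set \<Rightarrow> ('a \<times> 'i \<times> 'i, 'k) mpoly set ring" where
  "coordinate_ring F = ring_of_type_algebra Quot equation_ideal F"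

definition coordinate_ring_const ::
    "('a \<times> 'i \<times> 'i, 'k::comm_ring_1) mpoly set \<Rightarrow> 'k \<Rightarrow> ('a \<times> 'i \<times> 'i, 'k) mpoly set" where
  "coordinate_ring_const F c = equation_ideal F +>\<^bsub>ring_of_type_algebra\<^esub> mpoly_const c"


section \<open>The cluster algebra of a polygon\<close>

text \<open>The vertices of the convex \<open>n\<close>-gon are \<open>0, \<dots>, n - 1\<close> in cyclic order; edges and diagonals
  are two-element sets of vertices.\<close>

definition polygon_edge :: "nat \<Rightarrow> nat \<Rightarrow> nat set" where
  "polygon_edge n k = {k, Suc k mod n}"

definition polygon_edges :: "nat \<Rightarrow> nat set set" where
  "polygon_edges n = polygon_edge n ` {..<n}"

definition diagonals :: "nat \<Rightarrow> nat set set" where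
  "diagonals n = {{i, j} | i j. i < j \<and> j < n} - polygon_edges n"

definition crossing :: "nat set \<Rightarrow> nat set \<Rightarrow> bool" where
  "crossing d e \<longleftrightarrow> (\<exists>i j k l. i < j \<and> j < k \<and> k < l \<and>
     (d = {i, k} \<and> e = {j, l} \<or> d = {j, l} \<and> e = {i, k}))"

definition noncrossing :: "nat set set \<Rightarrow> bool" where
  "noncrossing T \<longleftrightarrow> (\<forall>d\<in>T. \<forall>e\<in>T. \<not> crossing d e)"

definition triangulation :: "nat \<Rightarrow> nat set set \<Rightarrow> bool" where
  "triangulation n T \<longleftrightarrow> T \<subseteq> diagonals n \<and> noncrossing T \<and>
     (\<forall>T'. T \<subseteq> T' \<and> T' \<subseteq> diagonals n \<and> noncrossing T' \<longrightarrow> T' = T)"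

text \<open>\<open>labelled n d x q T L\<close>: starting from the triangulation with diagonals \<open>d 0, \<dots>, d (n - 4)\<close>
  labelled \<open>x 0, \<dots>, x (n - 4)\<close> and edges labelled \<open>q 0, \<dots>, q (n - 1)\<close>, a sequence of flips leads to
  the triangulation \<open>T\<close> labelled by \<open>L\<close>.  Only the values of \<open>L\<close> on the edges and on \<open>T\<close> matter.  In
  a flip, \<open>i, j, k, l\<close> are the vertices of the quadrilateral in cyclic order.\<close>

inductive labelled ::
    "nat \<Rightarrow> (nat \<Rightarrow> nat set) \<Rightarrow> (nat \<Rightarrow> 'f::field) \<Rightarrow> (nat \<Rightarrow> 'f) \<Rightarrow> nat set set \<Rightarrow> (nat set \<Rightarrow> 'f) \<Rightarrow> bool"
  for n d x q where
    initial:
      "\<lbrakk>\<And>k. k < n - 3 \<Longrightarrow> L (d k) = x k; \<And>k. k < n \<Longrightarrow> L (polygon_edge n k) = q k\<rbrakk>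
       \<Longrightarrow> labelled n d x q (d ` {..<n - 3}) L"
  | flip:
      "\<lbrakk>labelled n d x q T L;
        i < j \<and> j < k \<and> k < l \<and> l < n \<or> j < k \<and> k < l \<and> l < i \<and> i < n;
        {i, k} \<in> T;
        {{i, j}, {j, k}, {k, l}, {l, i}} \<subseteq> T \<union> polygon_edges n;
        L {i, k} * y = L {i, j} * L {k, l} + L {j, k} * L {l, i}\<rbrakk>
       \<Longrightarrow> labelled n d x q (insert {j, l} (T - {{i, k}})) (L({j, l} := y))"

definition labels ::
    "nat \<Rightarrow> (nat \<Rightarrow> nat set) \<Rightarrow> (nat \<Rightarrow> 'f::field) \<Rightarrow> (nat \<Rightarrow> 'f) \<Rightarrow> 'f set" where
  "labels n d x q = {L e | T L e. labelled n d x q T L \<and> e \<in> T \<union> polygon_edges n}"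

text \<open>Rational functions in countably many indeterminates: \<open>cluster_var k\<close> and \<open>edge_var k\<close>.  For
  the \<open>n\<close>-gon only the first \<open>n - 3\<close> resp. \<open>n\<close> of them occur in the subalgebra below.\<close>

type_synonym 'k ratfun = "(nat, 'k) mpoly fract"

definition ratfun_const :: "'k::idom \<Rightarrow> 'k ratfun" where
  "ratfun_const c = Fract (mpoly_const c) 1"

definition cluster_var :: "nat \<Rightarrow> 'k::idom ratfun" where
  "cluster_var k = Fract (mpoly_var (2 * k)) 1"

definition edge_var :: "nat \<Rightarrow> 'k::idom ratfun" where
  "edge_var k = Fract (mpoly_var (2 * k + 1)) 1"

definition cluster_algebra :: "nat \<Rightarrow> (nat \<Rightarrow> nat set) \<Rightarrow> 'k::idom ratfun ring" where
  "cluster_algebra n d = ring_of_type_algebra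
     \<lparr>carrier := generate_ring ring_of_type_algebra
        (range ratfun_const \<union> labels n d cluster_var edge_var)\<rparr>"

text \<open>Specialization of the \<open>q\<^sub>k\<close> to \<open>1\<close>: the quotient by the ideal generated by all \<open>q\<^sub>k - 1\<close>.\<close>

definition specialization_ideal :: "nat \<Rightarrow> (nat \<Rightarrow> nat set) \<Rightarrow> 'k::idom ratfun set" where
  "specialization_ideal n d = genideal (cluster_algebra n d) {edge_var k - 1 | k. k < n}"

definition specialized_cluster_algebra ::
    "nat \<Rightarrow> (nat \<Rightarrow> nat set) \<Rightarrow> 'k::idom ratfun set ring" where
  "specialized_cluster_algebra n d = cluster_algebra n d Quot specialization_ideal n d"

definition specialized_cluster_algebra_const ::
    "nat \<Rightarrow> (nat \<Rightarrow> nat set) \<Rightarrow> 'k::idom \<Rightarrow> 'k ratfun set" where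
  "specialized_cluster_algebra_const n d c =
     specialization_ideal n d +>\<^bsub>cluster_algebra n d\<^esub> ratfun_const c"


section \<open>Spectra of commutative rings\<close>

definition spec :: "('r, 'm) ring_scheme \<Rightarrow> 'r set set" where
  "spec R = {P. primeideal P R}"

definition zariski :: "('r, 'm) ring_scheme \<Rightarrow> 'r set topology" where
  "zariski R = topology (\<lambda>U. \<exists>E\<subseteq>carrier R. U = {P \<in> spec R. \<not> E \<subseteq> P})"

lemma openin_zariski:
  "openin (zariski R) U \<longleftrightarrow> (\<exists>E\<subseteq>carrier R. U = {P \<in> spec R. \<not> E \<subseteq> P})"
proof -
  have "istopology (\<lambda>U. \<exists>E\<subseteq>carrier R. U = {P \<in> spec R. \<not> E \<subseteq> P})"
    unfolding istopology_def
  proof (intro conjI allI impI)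
    fix S T
    assume "\<exists>E\<subseteq>carrier R. S = {P \<in> spec R. \<not> E \<subseteq> P}" "\<exists>E\<subseteq>carrier R. T = {P \<in> spec R. \<not> E \<subseteq> P}"
    then obtain E F where E: "E \<subseteq> carrier R" "S = {P \<in> spec R. \<not> E \<subseteq> P}"
      and F: "F \<subseteq> carrier R" "T = {P \<in> spec R. \<not> F \<subseteq> P}" by blast
    let ?G = "{a \<otimes>\<^bsub>R\<^esub> b | a b. a \<in> E \<and> b \<in> F}"
    have iff: "(\<not> ?G \<subseteq> P) \<longleftrightarrow> \<not> E \<subseteq> P \<and> \<not> F \<subseteq> P" if P: "P \<in> spec R" for P
    proof -
      interpret primeideal P R using P by (simp add: spec_def)
      show ?thesis
      proof
        assume "\<not> ?G \<subseteq> P"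
        then obtain a b where "a \<in> E" "b \<in> F" "a \<otimes>\<^bsub>R\<^esub> b \<notin> P" by blast
        then show "\<not> E \<subseteq> P \<and> \<not> F \<subseteq> P" using E(1) F(1) I_l_closed I_r_closed by blast
      next
        assume "\<not> E \<subseteq> P \<and> \<not> F \<subseteq> P"
        then obtain a b where ab: "a \<in> E" "b \<in> F" "a \<notin> P" "b \<notin> P" by blast
        then have "a \<otimes>\<^bsub>R\<^esub> b \<notin> P" using E(1) F(1) I_prime by blast
        then show "\<not> ?G \<subseteq> P" using ab by blast
      qed
    qed
    have "S \<inter> T = {P \<in> spec R. \<not> ?G \<subseteq> P}"
      unfolding E(2) F(2) Int_def mem_Collect_eq
      by (rule Collect_cong) (metis (no_types, lifting) iff)
    then show "\<exists>E\<subseteq>carrier R. S \<inter> T = {P \<in> spec R. \<not> E \<subseteq> P}"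
    proof (cases "spec R = {}")
      case True
      then have "S \<inter> T = {P \<in> spec R. \<not> {} \<subseteq> P}"
        by (simp add: E(2))
      then show ?thesis by blast
    next
      case False
      then obtain P where "primeideal P R" by (auto simp: spec_def)
      then interpret primeideal P R .
      have "?G \<subseteq> carrier R" using E(1) F(1) by auto
      then show ?thesis using \<open>S \<inter> T = {P \<in> spec R. \<not> ?G \<subseteq> P}\<close> by (intro exI conjI)
    qed
  next
    fix \<K> :: "'a set set set"
    assume K: "\<forall>K\<in>\<K>. \<exists>E\<subseteq>carrier R. K = {P \<in> spec R. \<not> E \<subseteq> P}"
    define F where "F = \<Union>{E. E \<subseteq> carrier R \<and> {P \<in> spec R. \<not> E \<subseteq> P} \<in> \<K>}"
    have "F \<subseteq> carrier R" unfolding F_def by blast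
    moreover have "P \<in> \<Union>\<K> \<longleftrightarrow> P \<in> spec R \<and> \<not> F \<subseteq> P" for P
    proof
      assume "P \<in> \<Union>\<K>"
      then obtain K where "K \<in> \<K>" "P \<in> K" by blast
      moreover obtain E where "E \<subseteq> carrier R" "K = {P \<in> spec R. \<not> E \<subseteq> P}"
        using K \<open>K \<in> \<K>\<close> by meson
      ultimately show "P \<in> spec R \<and> \<not> F \<subseteq> P" unfolding F_def by blast
    next
      assume P: "P \<in> spec R \<and> \<not> F \<subseteq> P"
      then obtain E where "{P \<in> spec R. \<not> E \<subseteq> P} \<in> \<K>" "\<not> E \<subseteq> P"
        unfolding F_def by blast
      then show "P \<in> \<Union>\<K>" using P by blast
    qed
    then have "\<Union>\<K> = {P \<in> spec R. \<not> F \<subseteq> P}" by blast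
    ultimately show "\<exists>E\<subseteq>carrier R. \<Union>\<K> = {P \<in> spec R. \<not> E \<subseteq> P}" by (intro exI conjI)
  qed
  then show ?thesis by (simp add: zariski_def)
qed

text \<open>The fraction \<open>a / f\<close> in the localization of \<open>R\<close> at \<open>P\<close>, as an equivalence class of pairs.\<close>

definition local_frac :: "('r, 'm) ring_scheme \<Rightarrow> 'r set \<Rightarrow> 'r \<Rightarrow> 'r \<Rightarrow> ('r \<times> 'r) set" where
  "local_frac R P a f = {(b, g). b \<in> carrier R \<and> g \<in> carrier R - P \<and>
     (\<exists>t\<in>carrier R - P. t \<otimes>\<^bsub>R\<^esub> (a \<otimes>\<^bsub>R\<^esub> g \<ominus>\<^bsub>R\<^esub> b \<otimes>\<^bsub>R\<^esub> f) = \<zero>\<^bsub>R\<^esub>)}"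

definition localization :: "('r, 'm) ring_scheme \<Rightarrow> 'r set \<Rightarrow> ('r \<times> 'r) set ring" where
  "localization R P =
     \<lparr>carrier = {local_frac R P a f | a f. a \<in> carrier R \<and> f \<in> carrier R - P},
      monoid.mult = (\<lambda>u v. \<Union>(a, f)\<in>u. \<Union>(b, g)\<in>v. local_frac R P (a \<otimes>\<^bsub>R\<^esub> b) (f \<otimes>\<^bsub>R\<^esub> g)),
      monoid.one = local_frac R P \<one>\<^bsub>R\<^esub> \<one>\<^bsub>R\<^esub>,
      ring.zero = local_frac R P \<zero>\<^bsub>R\<^esub> \<one>\<^bsub>R\<^esub>,
      ring.add = (\<lambda>u v. \<Union>(a, f)\<in>u. \<Union>(b, g)\<in>v.
        local_frac R P (a \<otimes>\<^bsub>R\<^esub> g \<oplus>\<^bsub>R\<^esub> b \<otimes>\<^bsub>R\<^esub> f) (f \<otimes>\<^bsub>R\<^esub> g))\<rparr>"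

definition sections :: "('r, 'm) ring_scheme \<Rightarrow> 'r set set \<Rightarrow> ('r set \<Rightarrow> ('r \<times> 'r) set) set" where
  "sections R U = {s \<in> (\<Pi>\<^sub>E P\<in>U. carrier (localization R P)).
     \<forall>P\<in>U. \<exists>V a f. P \<in> V \<and> V \<subseteq> U \<and> openin (zariski R) V \<and> a \<in> carrier R \<and> f \<in> carrier R \<and>
       (\<forall>Q\<in>V. f \<notin> Q \<and> s Q = local_frac R Q a f)}"

definition structure_sheaf ::
    "('r, 'm) ring_scheme \<Rightarrow> 'r set set \<Rightarrow> ('r set \<Rightarrow> ('r \<times> 'r) set) ring" where
  "structure_sheaf R U =
     \<lparr>carrier = sections R U,
      monoid.mult = (\<lambda>s t. \<lambda>P\<in>U. s P \<otimes>\<^bsub>localization R P\<^esub> t P),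
      monoid.one = (\<lambda>P\<in>U. \<one>\<^bsub>localization R P\<^esub>),
      ring.zero = (\<lambda>P\<in>U. \<zero>\<^bsub>localization R P\<^esub>),
      ring.add = (\<lambda>s t. \<lambda>P\<in>U. s P \<oplus>\<^bsub>localization R P\<^esub> t P)\<rparr>"

definition global_section ::
    "('r, 'm) ring_scheme \<Rightarrow> 'r set set \<Rightarrow> 'r \<Rightarrow> 'r set \<Rightarrow> ('r \<times> 'r) set" where
  "global_section R U a = (\<lambda>P\<in>U. local_frac R P a \<one>\<^bsub>R\<^esub>)"

text \<open>
  Isomorphism of \<open>Spec R\<close> and \<open>Spec S\<close> as schemes over \<open>K\<close>, where \<open>\<kappa>\<^sub>R\<close> and \<open>\<kappa>\<^sub>S\<close> are the structure
  maps from \<open>K\<close>: a homeomorphism \<open>h\<close> and a compatible family of isomorphisms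
  \<open>\<phi> V : \<O>(V) \<rightarrow> \<O>(h\<^sup>-\<^sup>1 V)\<close> that respect constants.  An isomorphism of ringed spaces is
  local on stalks automatically.
\<close>

definition spec_isomorphic_over ::
    "('k \<Rightarrow> 'r) \<Rightarrow> ('r, 'm) ring_scheme \<Rightarrow> ('k \<Rightarrow> 's) \<Rightarrow> ('s, 'n) ring_scheme \<Rightarrow> bool" where
  "spec_isomorphic_over \<kappa>\<^sub>R R \<kappa>\<^sub>S S \<longleftrightarrow>
     (\<exists>h \<phi>. homeomorphic_map (zariski R) (zariski S) h \<and>
       (\<forall>V. openin (zariski S) V \<longrightarrow>
          (let preim = (\<lambda>W. {P \<in> spec R. h P \<in> W}) in
             \<phi> V \<in> ring_iso (structure_sheaf S V) (structure_sheaf R (preim V)) \<and>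
             (\<forall>W s. openin (zariski S) W \<and> W \<subseteq> V \<and> s \<in> sections S V \<longrightarrow>
                \<phi> W (restrict s W) = restrict (\<phi> V s) (preim W)) \<and>
             (\<forall>c. \<phi> V (global_section S V (\<kappa>\<^sub>S c)) = global_section R (preim V) (\<kappa>\<^sub>R c)))))"

end

theory Submission
  imports Defs
begin

text \<open>
  Read the cycle of objects as a bi-infinite path and put \<open>e\<^sub>t = - c\<close> for the off-diagonal
  entry \<open>c\<close> attached to its \<open>t\<close>-th edge.  The condition on the products of \<open>n\<close> reflections then says
  that all solutions of \<open>y\<^sub>t\<^sub>+\<^sub>2 = e\<^sub>t y\<^sub>t\<^sub>+\<^sub>1 - y\<^sub>t\<close> are antiperiodic with antiperiod \<open>n\<close>, so that two
  fundamental solutions form an antiperiodic sequence of plane vectors with \<open>det (w\<^sub>t, w\<^sub>t\<^sub>+\<^sub>1) = 1\<close>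
  and \<open>det (w\<^sub>t, w\<^sub>t\<^sub>+\<^sub>2) = e\<^sub>t\<close>.

  On the other side, the labels of a polygon are the determinants \<open>det (w\<^sub>i, w\<^sub>j)\<close> of vectors in the
  plane over the rational function field: such vectors are read off a fan triangulation, and a flip
  is a Pluecker relation.  Hence \<open>c \<mapsto> - det (w\<^sub>t, w\<^sub>t\<^sub>+\<^sub>2)\<close> induces a surjection onto the specialized
  cluster algebra.  For injectivity, the continuants of free variables \<open>e\<^sub>0, e\<^sub>1, \<dots>\<close> satisfy the
  Pluecker relations too and do not vanish; sending labels to continuants therefore
  extends to the cluster algebra, and composing with \<open>e\<^sub>t \<mapsto> - c\<close> yields an inverse.
\<close>

section \<open>Triangulations and flips\<close>

text \<open>The obstacle is injectivity. Labels arise by repeated division in a field, and no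
  presentation of the algebra they generate is at hand, so a map out of it cannot simply be
  prescribed on generators. Nor can one divide in the coordinate ring, which need not be a domain:
  for n = 4 it comes down to x y = 2. The labels therefore take their values first in a polynomial
  ring over a domain, where flips can be divided out, and only then in the coordinate ring.

  The price is that free variables describe a path that does not close up. The edges between k and k
  + 1 get the value 1, but the edge between 0 and n - 1 gets a continuant that becomes 1 only modulo
  the groupoid equations.

  Nonvanishing of continuants serves twice: it permits these divisions, and it shows that the labels
  themselves are nonzero, so that every flip can be carried out. As the initial triangulation is
  arbitrary while vectors are read off a fan, the flip relation is followed backwards as well as
  forwards.\<close>

text \<open>Maximality of a triangulation is replaced by a local condition that can be checked
  through a flip: each triangle is recorded at its longest side {i, j}, with its apex k between i
  and j.\<close>

definition inner_triangles :: "nat \<Rightarrow> nat set set \<Rightarrow> bool" where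
  "inner_triangles n T \<longleftrightarrow> T \<subseteq> diagonals n \<and> noncrossing T \<and>
     (\<forall>i j. Suc i < j \<longrightarrow> {i, j} \<in> T \<union> polygon_edges n \<longrightarrow>
        (\<exists>k>i. k < j \<and> {i, k} \<in> T \<union> polygon_edges n \<and> {k, j} \<in> T \<union> polygon_edges n))"

lemma edge_iff:
  assumes "i < j" "3 \<le> n"
  shows "{i, j} \<in> polygon_edges n \<longleftrightarrow> j < n \<and> (j = Suc i \<or> i = 0 \<and> j = n - 1)"
proof
  assume "{i, j} \<in> polygon_edges n"
  then obtain k where k: "k < n" "{i, j} = {k, Suc k mod n}"
    by (auto simp: polygon_edges_def polygon_edge_def)
  then show "j < n \<and> (j = Suc i \<or> i = 0 \<and> j = n - 1)"
    using assms by (cases "Suc k = n") (auto simp: doubleton_eq_iff)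
next
  assume *: "j < n \<and> (j = Suc i \<or> i = 0 \<and> j = n - 1)"
  show "{i, j} \<in> polygon_edges n"
  proof (cases "j = Suc i")
    case True
    then have "{i, j} = polygon_edge n i" using * by (simp add: polygon_edge_def)
    then show ?thesis using * True by (auto simp: polygon_edges_def)
  next
    case False
    then have "{i, j} = polygon_edge n (n - 1)"
      using * assms by (auto simp: polygon_edge_def)
    then show ?thesis using * by (auto simp: polygon_edges_def)
  qed
qed

lemma diagonal_iff:
  assumes "i < j" "3 \<le> n"
  shows "{i, j} \<in> diagonals n \<longleftrightarrow> j < n \<and> Suc i < j \<and> \<not> (i = 0 \<and> j = n - 1)"
proof -
  have "{i, j} \<in> {{i, j} | i j. i < j \<and> j < n} \<longleftrightarrow> j < n"
    using assms by (auto simp: doubleton_eq_iff)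
  then show ?thesis using edge_iff[OF assms] assms by (auto simp: diagonals_def)
qed

lemma diagonalE:
  assumes "e \<in> diagonals n"
  obtains i j where "e = {i, j}" "i < j" "j < n"
  using assms by (auto simp: diagonals_def)

lemma segmentE:
  assumes "e \<in> T \<union> polygon_edges n" "T \<subseteq> diagonals n" "3 \<le> n"
  obtains i j where "e = {i, j}" "i < j" "j < n"
proof (cases "e \<in> T")
  case True
  then show ?thesis using assms(2) diagonalE that by blast
next
  case False
  then obtain k where "k < n" "e = {k, Suc k mod n}"
    using assms by (auto simp: polygon_edges_def polygon_edge_def)
  then show ?thesis using that[of k "Suc k"] that[of 0 k] assms(3)
    by (cases "Suc k = n") (auto simp: insert_commute)
qed

lemma segment_less:
  assumes "{i, j} \<in> T \<union> polygon_edges n" "T \<subseteq> diagonals n" "3 \<le> n"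
  shows "i < n \<and> j < n \<and> i \<noteq> j"
  by (rule segmentE[OF assms]) (auto simp: doubleton_eq_iff)

lemma crossing_iff:
  assumes "a < b" "c < d"
  shows "crossing {a, b} {c, d} \<longleftrightarrow> a < c \<and> c < b \<and> b < d \<or> c < a \<and> a < d \<and> d < b"
proof
  assume "crossing {a, b} {c, d}"
  then obtain i j k l where "i < j" "j < k" "k < l"
    and "{a, b} = {i, k} \<and> {c, d} = {j, l} \<or> {a, b} = {j, l} \<and> {c, d} = {i, k}"
    unfolding crossing_def by blast
  then show "a < c \<and> c < b \<and> b < d \<or> c < a \<and> a < d \<and> d < b"
    using assms unfolding doubleton_eq_iff by linarith
next
  assume "a < c \<and> c < b \<and> b < d \<or> c < a \<and> a < d \<and> d < b"
  then show "crossing {a, b} {c, d}" unfolding crossing_def by blast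
qed

text \<open>An edge of the polygon crosses nothing, since a < c < b < d rules out neighbouring
  vertices as well as the pair 0, n - 1. So the hypothesis on T extends to edges.\<close>

lemma segments_noncrossing:
  assumes "noncrossing T" "T \<subseteq> diagonals n" "3 \<le> n"
    "{a, b} \<in> T \<union> polygon_edges n" "{c, d} \<in> T \<union> polygon_edges n"
  shows "\<not> (a < c \<and> c < b \<and> b < d)"
proof
  assume *: "a < c \<and> c < b \<and> b < d"
  have lt: "b < n" "d < n" using segment_less assms by blast+
  have "{a, b} \<in> T" "{c, d} \<in> T"
    using * lt assms edge_iff[of a b n] edge_iff[of c d n] by auto
  then have "\<not> crossing {a, b} {c, d}" using assms(1) by (auto simp: noncrossing_def)
  then show False using * crossing_iff[of a b c d] by auto
qed

lemma noncrossing_insert: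
  assumes "noncrossing T" "T \<subseteq> diagonals n" "a < b"
    "\<And>c d. {c, d} \<in> T \<Longrightarrow> c < d \<Longrightarrow> \<not> (a < c \<and> c < b \<and> b < d) \<and> \<not> (c < a \<and> a < d \<and> d < b)"
  shows "noncrossing (insert {a, b} T)"
proof -
  have "\<not> crossing {a, b} e \<and> \<not> crossing e {a, b}" if eT: "e \<in> T" for e
  proof -
    have "e \<in> diagonals n" using eT assms(2) by blast
    then obtain c d where e: "e = {c, d}" "c < d" by (rule diagonalE)
    show ?thesis using assms(4)[of c d] eT crossing_iff assms(3) e by auto
  qed
  moreover have "\<not> crossing {a, b} {a, b}" using crossing_iff[OF assms(3) assms(3)] by auto
  ultimately show ?thesis using assms(1) by (auto simp: noncrossing_def)
qed

text \<open>The apex is the largest k < j joined to i. A diagonal crossing {k, j} would cross {i, j}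
  or {i, k}, or join i to a vertex beyond k; hence {k, j} can be added and lies in T by
  maximality.\<close>

lemma triangulation_inner_triangles:
  assumes "triangulation n T" "3 \<le> n"
  shows "inner_triangles n T"
proof -
  have T: "T \<subseteq> diagonals n" "noncrossing T"
    and mx: "\<And>T'. T \<subseteq> T' \<Longrightarrow> T' \<subseteq> diagonals n \<Longrightarrow> noncrossing T' \<Longrightarrow> T' = T"
    using assms by (auto simp: triangulation_def)
  have "\<exists>k>i. k < j \<and> {i, k} \<in> T \<union> polygon_edges n \<and> {k, j} \<in> T \<union> polygon_edges n"
    if ij: "Suc i < j" "{i, j} \<in> T \<union> polygon_edges n" for i j
  proof -
    have jn: "j < n" using segment_less ij T assms(2) by blast
    define N where "N = {k. i < k \<and> k < j \<and> {i, k} \<in> T \<union> polygon_edges n}"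
    define k where "k = Max N"
    have N: "finite N" "Suc i \<in> N"
      using ij jn assms(2) edge_iff[of i "Suc i" n] by (auto simp: N_def)
    have kN: "k \<in> N" unfolding k_def using N by (intro Max_in) auto
    have kmax: "m \<le> k" if "m \<in> N" for m unfolding k_def using that N by simp
    have k: "i < k" "k < j" "{i, k} \<in> T \<union> polygon_edges n" using kN by (auto simp: N_def)
    have "{k, j} \<in> T \<union> polygon_edges n"
    proof (cases "j = Suc k")
      case True
      then show ?thesis using edge_iff[of k j n] jn assms(2) by auto
    next
      case False
      have "noncrossing (insert {k, j} T)"
      proof (rule noncrossing_insert[OF T(2,1) k(2)])
        fix c d assume cd: "{c, d} \<in> T" "c < d"
        note nc = segments_noncrossing[OF T(2,1) assms(2)]
        have a: "\<not> (k < c \<and> c < j \<and> j < d)" using nc[OF ij(2), of c d] cd k by auto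
        have "\<not> (c < k \<and> k < d \<and> d < j)"
        proof
          assume *: "c < k \<and> k < d \<and> d < j"
          consider "c < i" | "c = i" | "i < c" by linarith
          then show False
          proof cases
            case 1
            then show False using nc[of c d i j] cd ij * k by auto
          next
            case 2
            then show False using kmax[of d] cd * k by (auto simp: N_def)
          next
            case 3
            then show False using nc[OF k(3), of c d] cd * by auto
          qed
        qed
        with a show "\<not> (k < c \<and> c < j \<and> j < d) \<and> \<not> (c < k \<and> k < d \<and> d < j)" by blast
      qed
      moreover have "insert {k, j} T \<subseteq> diagonals n"
        using T diagonal_iff[of k j n] k jn False assms(2) by auto
      ultimately have "insert {k, j} T = T" using mx by blast
      then show ?thesis by blast
    qed
    then show ?thesis using k by blast
  qed
  then show ?thesis using T by (auto simp: inner_triangles_def)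
qed

section \<open>Flips in a quadrilateral p < q < r < s\<close>

text \<open>The equation between sets of pairs says that one diagonal of the quadrilateral is
  exchanged for the other, in either direction. A segment that crosses the new diagonal but none of
  the four sides has to be the old diagonal.\<close>

lemma flip_noncrossing:
  assumes "T \<subseteq> diagonals n" "noncrossing T" "3 \<le> n" "p < q" "q < r" "r < s"
    "{{p, q}, {q, r}, {r, s}, {p, s}} \<subseteq> T \<union> polygon_edges n"
    "{{x, y}, {z, w}} = {{p, r}, {q, s}}" "{x, y} \<in> T" "z < w"
  shows "noncrossing (insert {z, w} (T - {{x, y}}))"
proof -
  note nc = segments_noncrossing[OF assms(2,1,3)]
  have zw: "z = p \<and> w = r \<and> {x, y} = {q, s} \<or> z = q \<and> w = s \<and> {x, y} = {p, r}"
    using assms(4-6,8,10) by (auto simp: doubleton_eq_iff)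
  have S: "{p, q} \<in> T \<union> polygon_edges n" "{q, r} \<in> T \<union> polygon_edges n"
    "{r, s} \<in> T \<union> polygon_edges n" "{p, s} \<in> T \<union> polygon_edges n"
    using assms(7) by auto
  show ?thesis
  proof (rule noncrossing_insert)
    show "noncrossing (T - {{x, y}})" using assms(2) by (auto simp: noncrossing_def)
    show "T - {{x, y}} \<subseteq> diagonals n" using assms(1) by auto
    show "z < w" by fact
    fix c d assume cd: "{c, d} \<in> T - {{x, y}}" "c < d"
    then have cdT: "{c, d} \<in> T \<union> polygon_edges n" by auto
    have n1: "\<not> (a < c \<and> c < b \<and> b < d)" "\<not> (c < a \<and> a < d \<and> d < b)"
      if "{a, b} \<in> T \<union> polygon_edges n" for a b
      using nc[OF that cdT] nc[OF cdT that] by auto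
    note m = n1[OF S(1)] n1[OF S(2)] n1[OF S(3)] n1[OF S(4)]
    from zw show "\<not> (z < c \<and> c < w \<and> w < d) \<and> \<not> (c < z \<and> z < d \<and> d < w)"
    proof (elim disjE conjE)
      assume h: "z = p" "w = r" "{x, y} = {q, s}"
      have "c \<noteq> q \<or> d \<noteq> s" using cd h by auto
      then have "\<not> (p < c \<and> c < r \<and> r < d)" using m assms(4-6) by (cases c q rule: linorder_cases) auto
      moreover have "\<not> (c < p \<and> p < d \<and> d < r)" using m assms(4-6) by (cases d q rule: linorder_cases) auto
      ultimately show ?thesis using h by blast
    next
      assume h: "z = q" "w = s" "{x, y} = {p, r}"
      have "c \<noteq> p \<or> d \<noteq> r" using cd h by auto
      then have "\<not> (c < q \<and> q < d \<and> d < s)" using m assms(4-6) by (cases d r rule: linorder_cases) auto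
      moreover have "\<not> (q < c \<and> c < s \<and> s < d)" using m assms(4-6) by (cases c r rule: linorder_cases) auto
      ultimately show ?thesis using h by blast
    qed
  qed
qed

text \<open>An apex survives unless one of its two legs is the removed diagonal. Then the segment is
  the long side {p, s}, whose apex changes from r to q or from q to r; all other positions would
  cross {p, s} or another side.\<close>

lemma flip_inner_triangles:
  assumes "inner_triangles n T" "3 \<le> n" "p < q" "q < r" "r < s"
    "{{p, q}, {q, r}, {r, s}, {p, s}} \<subseteq> T \<union> polygon_edges n"
    "{{x, y}, {z, w}} = {{p, r}, {q, s}}" "{x, y} \<in> T" "z < w"
  shows "inner_triangles n (insert {z, w} (T - {{x, y}}))"
proof -
  have T: "T \<subseteq> diagonals n" "noncrossing T"
    and tri: "\<And>i j. Suc i < j \<Longrightarrow> {i, j} \<in> T \<union> polygon_edges n \<Longrightarrow>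
        \<exists>k>i. k < j \<and> {i, k} \<in> T \<union> polygon_edges n \<and> {k, j} \<in> T \<union> polygon_edges n"
    using assms(1) by (auto simp: inner_triangles_def)
  note nc = segments_noncrossing[OF T(2,1) assms(2)]
  have zw: "z = p \<and> w = r \<and> {x, y} = {q, s} \<or> z = q \<and> w = s \<and> {x, y} = {p, r}"
    using assms(3-5,7,9) by (auto simp: doubleton_eq_iff)
  have S: "{p, q} \<in> T \<union> polygon_edges n" "{q, r} \<in> T \<union> polygon_edges n"
    "{r, s} \<in> T \<union> polygon_edges n" "{p, s} \<in> T \<union> polygon_edges n"
    using assms(6) by auto
  let ?T = "insert {z, w} (T - {{x, y}})"
  have sn: "s < n" using segment_less[OF S(4) T(1) assms(2)] by simp
  have sides: "{p, q} \<in> ?T \<union> polygon_edges n" "{q, r} \<in> ?T \<union> polygon_edges n"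
    "{r, s} \<in> ?T \<union> polygon_edges n" "{p, s} \<in> ?T \<union> polygon_edges n"
    using S assms(3-5) zw by (auto simp: doubleton_eq_iff)
  have "{z, w} \<in> diagonals n"
    using zw assms(2-5) sn diagonal_iff[of z w n] by auto
  then have D: "?T \<subseteq> diagonals n" using T by auto
  have "\<exists>k>i. k < j \<and> {i, k} \<in> ?T \<union> polygon_edges n \<and> {k, j} \<in> ?T \<union> polygon_edges n"
    if ij: "Suc i < j" "{i, j} \<in> ?T \<union> polygon_edges n" for i j
  proof (cases "{i, j} = {z, w}")
    case True
    then have "i = z" "j = w" using ij assms(9) by (auto simp: doubleton_eq_iff)
    then have "(q > i \<and> q < j \<and> {i, q} \<in> ?T \<union> polygon_edges n \<and> {q, j} \<in> ?T \<union> polygon_edges n) \<or>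
        (r > i \<and> r < j \<and> {i, r} \<in> ?T \<union> polygon_edges n \<and> {r, j} \<in> ?T \<union> polygon_edges n)"
      using zw sides assms(3-5) by (elim disjE conjE) simp_all
    then show ?thesis by (elim disjE) (rule exI, assumption)+
  next
    case False
    then have ijT: "{i, j} \<in> T \<union> polygon_edges n" using ij by auto
    then obtain k where k: "i < k" "k < j" "{i, k} \<in> T \<union> polygon_edges n" "{k, j} \<in> T \<union> polygon_edges n"
      using tri ij by blast
    have keep: "e \<in> ?T \<union> polygon_edges n" if "e \<in> T \<union> polygon_edges n" "e \<noteq> {x, y}" for e
      using that by auto
    consider (a) "{i, k} = {x, y}" | (b) "{k, j} = {x, y}" | (c) "{i, k} \<noteq> {x, y}" "{k, j} \<noteq> {x, y}" by blast
    then show ?thesis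
    proof cases
      case a
      from zw show ?thesis
      proof (elim disjE conjE)
        assume h: "z = p" "w = r" "{x, y} = {q, s}"
        then have "i = q" "k = s" using a k(1) assms(3-5) by (auto simp: doubleton_eq_iff)
        then show ?thesis using nc[OF S(4) ijT] k assms(3-5) by auto
      next
        assume h: "z = q" "w = s" "{x, y} = {p, r}"
        then have ik: "i = p" "k = r" using a k(1) assms(3-5) by (auto simp: doubleton_eq_iff)
        then have "j = s" using nc[OF ijT S(3)] nc[OF S(4) k(4)] k assms(3-5) by auto
        then show ?thesis using ik h(1,2) sides assms(3-5) by (intro exI[of _ q]) simp
      qed
    next
      case b
      from zw show ?thesis
      proof (elim disjE conjE)
        assume h: "z = p" "w = r" "{x, y} = {q, s}"
        then have kj: "k = q" "j = s" using b k(2) assms(3-5) by (auto simp: doubleton_eq_iff)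
        then have "i = p" using nc[OF k(3) S(4)] nc[OF S(1) ijT] k assms(3-5) by auto
        then show ?thesis using kj h(1,2) sides assms(3-5) by (intro exI[of _ r]) simp
      next
        assume h: "z = q" "w = s" "{x, y} = {p, r}"
        then have "k = p" "j = r" using b k(2) assms(3-5) by (auto simp: doubleton_eq_iff)
        then show ?thesis using nc[OF ijT S(4)] k assms(3-5) by auto
      qed
    next
      case c
      then show ?thesis using k keep by blast
    qed
  qed
  then show ?thesis
    using D flip_noncrossing[OF T assms(2-9)] by (simp add: inner_triangles_def)
qed

section \<open>Reaching every segment by flips\<close>

text \<open>Let m be the first vertex not joined to 0, a = m - 1, and b the next vertex that is
  joined. The triangle below {0, b} has apex a, so {a, b} is present and has a triangle with apex c
  on the side away from 0. Flipping {a, b} joins c to 0.\<close>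

lemma fan_flip:
  assumes T: "inner_triangles n T" and n: "3 \<le> n"
    and nofan: "\<not> (\<forall>j. 0 < j \<and> j < n \<longrightarrow> {0, j} \<in> T \<union> polygon_edges n)"
  obtains a c b where "0 < a" "a < c" "c < b" "b < n" "{a, b} \<in> T" "{0, c} \<notin> T \<union> polygon_edges n"
    "{{0, a}, {a, c}, {c, b}, {0, b}} \<subseteq> T \<union> polygon_edges n"
proof -
  have T': "T \<subseteq> diagonals n" "noncrossing T"
    and tri: "\<And>i j. Suc i < j \<Longrightarrow> {i, j} \<in> T \<union> polygon_edges n \<Longrightarrow>
        \<exists>k>i. k < j \<and> {i, k} \<in> T \<union> polygon_edges n \<and> {k, j} \<in> T \<union> polygon_edges n"
    using T by (auto simp: inner_triangles_def)
  note nc = segments_noncrossing[OF T'(2,1) n]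
  let ?P = "\<lambda>j. 0 < j \<and> j < n \<and> {0, j} \<notin> T \<union> polygon_edges n"
  let ?Q = "\<lambda>j. (LEAST j. ?P j) < j \<and> j < n \<and> {0, j} \<in> T \<union> polygon_edges n"
  define m where "m = (LEAST j. ?P j)"
  have m: "?P m" unfolding m_def by (rule LeastI_ex) (use nofan in blast)
  have mmin: "{0, j} \<in> T \<union> polygon_edges n" if "0 < j" "j < m" for j
    using not_less_Least[of j ?P] that m unfolding m_def[symmetric] by auto
  have "m \<noteq> 1" "m \<noteq> n - 1" using m n edge_iff[of 0 m n] by auto
  then have m1: "1 < m" "m < n - 1" using m by linarith+
  define b where "b = (LEAST j. m < j \<and> j < n \<and> {0, j} \<in> T \<union> polygon_edges n)"
  have b: "m < b \<and> b < n \<and> {0, b} \<in> T \<union> polygon_edges n" unfolding b_def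
    by (rule LeastI[of _ "n - 1"]) (use m1 n edge_iff[of 0 "n - 1" n] in auto)
  have bmin: "{0, j} \<notin> T \<union> polygon_edges n" if "m \<le> j" "j < b" for j
    using not_less_Least[of j "\<lambda>j. m < j \<and> j < n \<and> {0, j} \<in> T \<union> polygon_edges n"] that m b
    unfolding b_def[symmetric] by (cases "j = m") auto
  define a where "a = m - 1"
  have a: "0 < a" "a < m" "{0, a} \<in> T \<union> polygon_edges n"
    using m1 mmin[of a] by (auto simp: a_def)
  obtain k where k: "0 < k" "k < b" "{0, k} \<in> T \<union> polygon_edges n" "{k, b} \<in> T \<union> polygon_edges n"
    using tri[of 0 b] b m1 by auto
  have "k < m" using bmin[of k] k(2,3) not_le_imp_less by blast
  \<comment> \<open>For k < a the segments {k, b} and {0, a} would cross.\<close>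
  then have "k = a" using nc[OF a(3) k(4)] k b by (auto simp: a_def)
  then have ab: "{a, b} \<in> T \<union> polygon_edges n" using k by simp
  then obtain c where c: "a < c" "c < b" "{a, c} \<in> T \<union> polygon_edges n" "{c, b} \<in> T \<union> polygon_edges n"
    using tri[of a b] a b m1 by auto
  have abT: "{a, b} \<in> T" using ab edge_iff[of a b n] a b c n by auto
  have "m \<le> c" using c by (simp add: a_def)
  then show ?thesis using that[of a c b] a b c abT k bmin[of c] by auto
qed


lemma labelled_inner_triangles:
  assumes "labelled n d x q T L" "inner_triangles n (d ` {..<n - 3})" "3 \<le> n"
  shows "inner_triangles n T"
  using assms(1)
proof induction
  case (initial L)
  then show ?case using assms(2) by simp
next
  case (flip T L i j k l y)
  from flip.hyps(2) show ?case
  proof (elim disjE conjE)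
    assume "i < j" "j < k" "k < l" "l < n"
    then show ?thesis using flip.hyps(3,4)
      by (intro flip_inner_triangles[OF flip.IH assms(3), of i j k l]) (auto simp: insert_commute)
  next
    assume "j < k" "k < l" "l < i" "i < n"
    then show ?thesis using flip.hyps(3,4)
      by (intro flip_inner_triangles[OF flip.IH assms(3), of j k l i]) (auto simp: insert_commute)
  qed
qed

context
  fixes n d and x q :: "nat \<Rightarrow> 'f::field"
  assumes n: "3 \<le> n" and init: "inner_triangles n (d ` {..<n - 3})"
    and nonzero: "\<And>T L e. labelled n d x q T L \<Longrightarrow> e \<in> T \<union> polygon_edges n \<Longrightarrow> L e \<noteq> 0"
begin

text \<open>The flip relation determines the new label only if the old one can be divided out. That
  labels are nonzero is a hypothesis of this context; \<open>labels_determinants\<close> derives it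
  from continuants.\<close>

lemma labelled_flip:
  assumes "labelled n d x q T L"
    "i < j \<and> j < k \<and> k < l \<and> l < n \<or> j < k \<and> k < l \<and> l < i \<and> i < n" "{i, k} \<in> T"
    "{{i, j}, {j, k}, {k, l}, {l, i}} \<subseteq> T \<union> polygon_edges n"
  shows "\<exists>L'. labelled n d x q (insert {j, l} (T - {{i, k}})) L'"
proof -
  have "L {i, k} \<noteq> 0" using nonzero assms(1,3) by blast
  then have "L {i, k} * ((L {i, j} * L {k, l} + L {j, k} * L {l, i}) / L {i, k}) =
      L {i, j} * L {k, l} + L {j, k} * L {l, i}" by simp
  then show ?thesis using labelled.flip[OF assms] by blast
qed

text \<open>The number of vertices not joined to 0 decreases: the flip found by
  \<open>fan_flip\<close> joins c to 0 and removes {a, b} with 0 < a, so that no segment at 0 is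
  lost.\<close>

lemma labelled_fan:
  assumes "labelled n d x q T L"
  shows "\<exists>T L. labelled n d x q T L \<and> (\<forall>j. 0 < j \<and> j < n \<longrightarrow> {0, j} \<in> T \<union> polygon_edges n)"
  using assms
proof (induction "card {j. 0 < j \<and> j < n \<and> {0, j} \<notin> T \<union> polygon_edges n}" arbitrary: T L
    rule: less_induct)
  case less
  have tri: "inner_triangles n T" by (rule labelled_inner_triangles[OF less.prems init n])
  show ?case
  proof (cases "\<forall>j. 0 < j \<and> j < n \<longrightarrow> {0, j} \<in> T \<union> polygon_edges n")
    case False
    then obtain a c b where abc: "0 < a" "a < c" "c < b" "b < n" "{a, b} \<in> T" "{0, c} \<notin> T \<union> polygon_edges n"
      "{{0, a}, {a, c}, {c, b}, {0, b}} \<subseteq> T \<union> polygon_edges n"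
      using fan_flip[OF tri n] by metis
    let ?T = "insert {0, c} (T - {{b, a}})"
    obtain L' where L': "labelled n d x q ?T L'"
      using labelled_flip[OF less.prems, of b 0 a c] abc by (auto simp: insert_commute)
    let ?M = "\<lambda>T. {j. 0 < j \<and> j < n \<and> {0, j} \<notin> T \<union> polygon_edges n}"
    have "?M ?T \<subset> ?M T"
    proof
      show "?M ?T \<subseteq> ?M T" using abc by (auto simp: doubleton_eq_iff)
      have "c \<in> ?M T" "c \<notin> ?M ?T" using abc by simp_all
      then show "?M ?T \<noteq> ?M T" by metis
    qed
    then have "card (?M ?T) < card (?M T)" by (intro psubset_card_mono) simp_all
    from less.hyps[OF this L'] show ?thesis .
  qed (use less.prems in blast)
qed

text \<open>In the fan at 0, the diagonals {0, i + 1}, {0, i + 2}, ... are flipped in turn. In the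
  quadrilateral 0, i, k, k + 1 the diagonal {0, k} turns into {i, k + 1}, which moves the far end of
  the segment at i up by one.\<close>

lemma labelled_segment:
  assumes "labelled n d x q T\<^sub>0 L\<^sub>0" "i < j" "j < n"
  shows "\<exists>T L. labelled n d x q T L \<and> {i, j} \<in> T \<union> polygon_edges n"
proof (cases "i = 0")
  case True
  then show ?thesis using labelled_fan[OF assms(1)] assms by blast
next
  case False
  have "\<exists>T L. labelled n d x q T L \<and> {i, i + 1 + t} \<in> T \<union> polygon_edges n \<and>
      {0, i} \<in> T \<union> polygon_edges n \<and>
      (\<forall>k. i + 1 + t \<le> k \<and> k < n \<longrightarrow> {0, k} \<in> T \<union> polygon_edges n)" if "i + 1 + t < n" for t
    using that
  proof (induction t)
    case 0
    have "{i, i + 1} \<in> polygon_edges n" using edge_iff[of i "i + 1" n] 0 n by auto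
    moreover obtain T L where "labelled n d x q T L"
      "\<And>j. 0 < j \<Longrightarrow> j < n \<Longrightarrow> {0, j} \<in> T \<union> polygon_edges n"
      using labelled_fan[OF assms(1)] by blast
    ultimately show ?case using 0 False by (intro exI[of _ T] exI[of _ L]) simp
  next
    case (Suc t)
    let ?k = "i + 1 + t" and ?l = "i + 2 + t"
    obtain T L where L: "labelled n d x q T L" "{i, ?k} \<in> T \<union> polygon_edges n"
      "{0, i} \<in> T \<union> polygon_edges n"
      and fan: "\<And>k. ?k \<le> k \<Longrightarrow> k < n \<Longrightarrow> {0, k} \<in> T \<union> polygon_edges n"
      using Suc.IH Suc.prems by (metis Suc_lessD add_Suc_right)
    have 1: "{0, ?k} \<in> T" using fan[of ?k] Suc.prems False n edge_iff[of 0 ?k n] by auto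
    have 2: "{?k, ?l} \<in> polygon_edges n" using edge_iff[of ?k ?l n] Suc.prems n by auto
    obtain L' where L': "labelled n d x q (insert {i, ?l} (T - {{0, ?k}})) L'"
      using labelled_flip[OF L(1), of 0 i ?k ?l] False Suc.prems L(2,3) 1 2 fan[of ?l]
      by (auto simp: insert_commute)
    have "{0, i} \<in> insert {i, ?l} (T - {{0, ?k}}) \<union> polygon_edges n"
      using L(3) by (auto simp: doubleton_eq_iff)
    moreover have "{0, k} \<in> insert {i, ?l} (T - {{0, ?k}}) \<union> polygon_edges n"
      if "?l \<le> k" "k < n" for k
      using fan[of k] that by (auto simp: doubleton_eq_iff)
    ultimately show ?case using L' by (intro exI[of _ "insert {i, ?l} (T - {{0, ?k}})"] exI[of _ L']) simp
  qed
  from this[of "j - i - 1"] show ?thesis using assms by auto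
qed

end

section \<open>Isomorphic rings have isomorphic spectra\<close>

lemma spec_subset: "P \<in> spec R \<Longrightarrow> P \<subseteq> carrier R"
  unfolding spec_def by (auto dest!: primeideal.axioms(1) ideal.axioms(1) additive_subgroup.a_subset)

lemma topspace_zariski: "topspace (zariski R) = spec R"
proof -
  have "openin (zariski R) (spec R)"
    unfolding openin_zariski
  proof (intro exI conjI)
    have "\<not> carrier R \<subseteq> P" if "P \<in> spec R" for P
      using that spec_subset[OF that] primeideal.I_notcarr[of P R] by (auto simp: spec_def)
    then show "spec R = {P \<in> spec R. \<not> carrier R \<subseteq> P}" by blast
  qed simp
  moreover have "U \<subseteq> spec R" if "openin (zariski R) U" for U
    using that unfolding openin_zariski by blast
  ultimately show ?thesis by (meson openin_subset openin_topspace subset_antisym)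
qed

text \<open>The inverse is part of the data, so that \<open>inverse\<close> exchanges the two rings
  and every transport lemma is available in both directions.\<close>

locale cring_iso = R: cring R + S: cring S for R (structure) and S (structure) +
  fixes f g
  assumes f_hom: "f \<in> ring_hom R S" and g_hom: "g \<in> ring_hom S R"
    and gf: "a \<in> carrier R \<Longrightarrow> g (f a) = a" and fg: "b \<in> carrier S \<Longrightarrow> f (g b) = b"
begin

lemma inverse: "cring_iso S R g f"
  by unfold_locales (use f_hom g_hom gf fg in auto)

sublocale hom: ring_hom_cring R S f
  by unfold_locales (rule f_hom)

lemma g_closed: "b \<in> carrier S \<Longrightarrow> g b \<in> carrier R"
  using g_hom by (auto simp: ring_hom_def)

lemma f_inj: "inj_on f (carrier R)"
  by (metis gf inj_onI)

lemma f_surj: "f ` carrier R = carrier S"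
proof
  show "carrier S \<subseteq> f ` carrier R" using fg g_closed by (metis image_eqI subsetI)
qed auto

lemma mem_image_iff: "a \<in> carrier R \<Longrightarrow> P \<subseteq> carrier R \<Longrightarrow> f a \<in> f ` P \<longleftrightarrow> a \<in> P"
  using f_inj by (meson inj_on_image_mem_iff)

lemma image_g_image: "A \<subseteq> carrier S \<Longrightarrow> f ` g ` A = A"
  unfolding image_image using fg by (simp add: subset_iff cong: image_cong_simp)

lemma image_spec:
  assumes "P \<in> spec R"
  shows "f ` P \<in> spec S"
proof -
  interpret P: primeideal P R using assms by (simp add: spec_def)
  have sub: "P \<subseteq> carrier R" using P.a_subset by blast
  have "ideal (f ` P) S"
  proof (rule idealI)
    show "ring S" by (rule S.ring_axioms)
    show "subgroup (f ` P) (add_monoid S)"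
    proof (rule subgroup.intro)
      show "f ` P \<subseteq> carrier (add_monoid S)" using sub by auto
      show "\<one>\<^bsub>add_monoid S\<^esub> \<in> f ` P"
        using hom.hom_zero P.zero_closed by (metis image_eqI monoid.simps(2))
      fix x y assume "x \<in> f ` P" "y \<in> f ` P"
      then obtain a b where ab: "x = f a" "y = f b" "a \<in> P" "b \<in> P" by blast
      then have "f a \<oplus>\<^bsub>S\<^esub> f b = f (a \<oplus> b)" using sub by (auto simp: subset_iff)
      moreover have "a \<oplus> b \<in> P" using ab P.a_closed by blast
      ultimately show "x \<otimes>\<^bsub>add_monoid S\<^esub> y \<in> f ` P" using ab by (metis image_eqI monoid.simps(1))
    next
      fix x assume "x \<in> f ` P"
      then obtain a where a: "x = f a" "a \<in> P" by blast
      then have "inv\<^bsub>add_monoid S\<^esub> x = \<ominus>\<^bsub>S\<^esub> f a" by (simp add: a_inv_def)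
      also have "\<dots> = f (\<ominus> a)" using a sub hom.hom_a_inv by auto
      finally show "inv\<^bsub>add_monoid S\<^esub> x \<in> f ` P" using P.a_inv_closed[OF a(2)] by simp
    qed
    fix x y assume x: "x \<in> f ` P" and y: "y \<in> carrier S"
    then obtain a b where ab: "x = f a" "y = f b" "a \<in> P" "b \<in> carrier R" using f_surj by blast
    then have "b \<otimes> a \<in> P" "a \<otimes> b \<in> P" using P.I_l_closed P.I_r_closed by auto
    then show "y \<otimes>\<^bsub>S\<^esub> x \<in> f ` P" "x \<otimes>\<^bsub>S\<^esub> y \<in> f ` P"
      using ab sub by (metis hom.hom_mult image_eqI subsetD)+
  qed
  then interpret fP: ideal "f ` P" S .
  have "primeideal (f ` P) S"
  proof (rule primeidealI)
    show "ideal (f ` P) S" "cring S" by (rule fP.ideal_axioms, rule S.cring_axioms)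
    show "carrier S \<noteq> f ` P"
      using P.I_notcarr sub f_surj f_inj inj_on_image_eq_iff by (metis order_refl)
    fix x y assume "x \<in> carrier S" "y \<in> carrier S" and xy: "x \<otimes>\<^bsub>S\<^esub> y \<in> f ` P"
    then obtain a b where ab: "x = f a" "y = f b" "a \<in> carrier R" "b \<in> carrier R" using f_surj by blast
    then have "a \<otimes> b \<in> P" using xy sub mem_image_iff[of "a \<otimes> b" P] by simp
    then show "x \<in> f ` P \<or> y \<in> f ` P" using ab P.I_prime by blast
  qed
  then show ?thesis by (simp add: spec_def)
qed

text \<open>The primes not containing E correspond to the primes not containing f(E). Continuity
  later is openness for the inverse.\<close>

lemma open_image:
  assumes "openin (zariski R) U"
  shows "openin (zariski S) ((`) f ` U)"
proof -
  interpret inv: cring_iso S R g f by (rule inverse)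
  obtain E where E: "E \<subseteq> carrier R" "U = {P \<in> spec R. \<not> E \<subseteq> P}"
    using assms unfolding openin_zariski by blast
  have sub: "f ` E \<subseteq> f ` P \<longleftrightarrow> E \<subseteq> P" if "P \<in> spec R" for P
    by (metis E(1) image_mono image_subset_iff mem_image_iff spec_subset[OF that] subset_iff)
  have "(`) f ` U = {Q \<in> spec S. \<not> f ` E \<subseteq> Q}"
  proof (intro equalityI subsetI)
    fix Q assume "Q \<in> (`) f ` U"
    then show "Q \<in> {Q \<in> spec S. \<not> f ` E \<subseteq> Q}" using E sub image_spec by auto
  next
    fix Q assume "Q \<in> {Q \<in> spec S. \<not> f ` E \<subseteq> Q}"
    moreover then have "f ` g ` Q = Q" "g ` Q \<in> spec R"
      using image_g_image spec_subset inv.image_spec by auto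
    ultimately have "g ` Q \<in> U" using E sub[of "g ` Q"] by auto
    then show "Q \<in> (`) f ` U" using \<open>f ` g ` Q = Q\<close> by (metis image_eqI)
  qed
  moreover have "f ` E \<subseteq> carrier S" using E by auto
  ultimately show ?thesis unfolding openin_zariski by blast
qed

lemma image_open_eq:
  assumes "V \<subseteq> spec R"
  shows "(`) f ` V = {Q \<in> spec S. g ` Q \<in> V}"
proof -
  interpret inv: cring_iso S R g f by (rule inverse)
  show ?thesis
  proof (intro equalityI subsetI)
    fix Q assume "Q \<in> (`) f ` V"
    then obtain P where P: "Q = f ` P" "P \<in> V" by blast
    then have "P \<in> spec R" using assms by blast
    then show "Q \<in> {Q \<in> spec S. g ` Q \<in> V}"
      using P inv.image_g_image[OF spec_subset] image_spec by auto
  next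
    fix Q assume "Q \<in> {Q \<in> spec S. g ` Q \<in> V}"
    then have "f ` g ` Q = Q" "g ` Q \<in> V" using image_g_image spec_subset by auto
    then show "Q \<in> (`) f ` V" by (metis image_eqI)
  qed
qed

lemma homeomorphic: "homeomorphic_map (zariski R) (zariski S) ((`) f)"
proof -
  interpret inv: cring_iso S R g f by (rule inverse)
  have op: "open_map (zariski R) (zariski S) ((`) f)"
    by (simp add: open_map_def open_image)
  have cont: "continuous_map (zariski R) (zariski S) ((`) f)"
    unfolding continuous_map topspace_zariski
  proof (intro conjI allI impI)
    fix U assume U: "openin (zariski S) U"
    then have "U \<subseteq> spec S" using openin_subset topspace_zariski by metis
    then show "openin (zariski R) {P \<in> spec R. f ` P \<in> U}"
      using inv.open_image[OF U] inv.image_open_eq by simp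
  qed (use image_spec in blast)
  have surj: "(`) f ` spec R = spec S"
    using image_open_eq[of "spec R"] inv.image_spec by auto
  have inj: "inj_on ((`) f) (spec R)"
    by (rule inj_onI) (metis f_inj inj_on_image_eq_iff spec_subset)
  show ?thesis
    by (rule bijective_open_imp_homeomorphic_map[OF cont op])
       (simp_all add: topspace_zariski surj inj)
qed

section \<open>Transport of localizations and sections\<close>

text \<open>Fractions are classes, that is, sets of pairs, so they are transported as images of
  sets. The condition t (a k - b h) = 0 passes through f in both directions because f is a bijective
  homomorphism.\<close>

lemma image_local_frac:
  assumes "P \<subseteq> carrier R" "a \<in> carrier R" "h \<in> carrier R"
  shows "map_prod f f ` local_frac R P a h = local_frac S (f ` P) (f a) (f h)"
proof -
  have eq: "f t \<otimes>\<^bsub>S\<^esub> (f a \<otimes>\<^bsub>S\<^esub> f k \<ominus>\<^bsub>S\<^esub> f b \<otimes>\<^bsub>S\<^esub> f h) = \<zero>\<^bsub>S\<^esub> \<longleftrightarrow> t \<otimes> (a \<otimes> k \<ominus> b \<otimes> h) = \<zero>"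
    if "t \<in> carrier R" "b \<in> carrier R" "k \<in> carrier R" for t b k
  proof -
    have "f t \<otimes>\<^bsub>S\<^esub> (f a \<otimes>\<^bsub>S\<^esub> f k \<ominus>\<^bsub>S\<^esub> f b \<otimes>\<^bsub>S\<^esub> f h) = f (t \<otimes> (a \<otimes> k \<ominus> b \<otimes> h))"
      using that assms by (simp add: a_minus_def)
    moreover have "f x = \<zero>\<^bsub>S\<^esub> \<longleftrightarrow> x = \<zero>" if "x \<in> carrier R" for x
      using that gf by (metis R.zero_closed hom.hom_zero)
    moreover have "t \<otimes> (a \<otimes> k \<ominus> b \<otimes> h) \<in> carrier R" using that assms by simp
    ultimately show ?thesis by metis
  qed
  show ?thesis
  proof (intro equalityI subsetI)
    fix x assume "x \<in> map_prod f f ` local_frac R P a h"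
    then obtain b k t where x: "x = (f b, f k)" "b \<in> carrier R" "k \<in> carrier R - P" "t \<in> carrier R - P"
      "t \<otimes> (a \<otimes> k \<ominus> b \<otimes> h) = \<zero>"
      by (auto simp: local_frac_def)
    then have "f k \<in> carrier S - f ` P" "f t \<in> carrier S - f ` P" using mem_image_iff assms by auto
    then show "x \<in> local_frac S (f ` P) (f a) (f h)"
      unfolding local_frac_def using x eq[of t b k] by auto
  next
    fix x assume "x \<in> local_frac S (f ` P) (f a) (f h)"
    then obtain b' k' t' where x: "x = (b', k')" "b' \<in> carrier S" "k' \<in> carrier S" "k' \<notin> f ` P" "t' \<in> carrier S"
      "t' \<notin> f ` P" "t' \<otimes>\<^bsub>S\<^esub> (f a \<otimes>\<^bsub>S\<^esub> k' \<ominus>\<^bsub>S\<^esub> b' \<otimes>\<^bsub>S\<^esub> f h) = \<zero>\<^bsub>S\<^esub>"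
      by (auto simp: local_frac_def)
    then obtain b k t where r: "b' = f b" "k' = f k" "t' = f t" "b \<in> carrier R" "k \<in> carrier R" "t \<in> carrier R"
      by (metis fg g_closed)
    then have "(b, k) \<in> local_frac R P a h"
      unfolding local_frac_def using x eq[of t b k] by auto
    then show "x \<in> map_prod f f ` local_frac R P a h" using x r by force
  qed
qed

lemma local_frac_subset: "local_frac R P a h \<subseteq> carrier R \<times> carrier R"
  by (auto simp: local_frac_def)

lemma localization_subset: "u \<in> carrier (localization R P) \<Longrightarrow> u \<subseteq> carrier R \<times> carrier R"
  using local_frac_subset by (auto simp: localization_def)

lemma map_prod_cancel: "u \<subseteq> carrier S \<times> carrier S \<Longrightarrow> map_prod f f ` map_prod g g ` u = u"
proof -
  assume u: "u \<subseteq> carrier S \<times> carrier S"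
  have "map_prod f f (map_prod g g x) = x" if "x \<in> u" for x
    using that u fg by (cases x) auto
  then show ?thesis unfolding image_image by simp
qed

lemma image_localization:
  assumes "P \<in> spec R" "u \<in> carrier (localization R P)"
  shows "map_prod f f ` u \<in> carrier (localization S (f ` P))"
proof -
  obtain a h where "u = local_frac R P a h" "a \<in> carrier R" "h \<in> carrier R" "h \<notin> P"
    using assms(2) by (auto simp: localization_def)
  moreover then have "map_prod f f ` u = local_frac S (f ` P) (f a) (f h)" "f h \<in> carrier S - f ` P"
    using image_local_frac mem_image_iff spec_subset[OF assms(1)] by auto
  ultimately show ?thesis unfolding localization_def by auto
qed

text \<open>Sum and product are unions over representatives, and images commute with unions; so it
  is enough to compare single fractions.\<close>

lemma image_localization_ops:
  assumes P: "P \<in> spec R" and u: "u \<in> carrier (localization R P)" and v: "v \<in> carrier (localization R P)"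
  shows "map_prod f f ` (u \<otimes>\<^bsub>localization R P\<^esub> v) =
      map_prod f f ` u \<otimes>\<^bsub>localization S (f ` P)\<^esub> map_prod f f ` v"
    and "map_prod f f ` (u \<oplus>\<^bsub>localization R P\<^esub> v) =
      map_prod f f ` u \<oplus>\<^bsub>localization S (f ` P)\<^esub> map_prod f f ` v"
proof -
  have uv: "u \<subseteq> carrier R \<times> carrier R" "v \<subseteq> carrier R \<times> carrier R"
    using localization_subset u v by auto
  have "map_prod f f ` (\<Union>(a, h)\<in>u. \<Union>(b, k)\<in>v. local_frac R P (a \<otimes> b) (h \<otimes> k)) =
    (\<Union>(a, h)\<in>u. \<Union>(b, k)\<in>v. local_frac S (f ` P) (f a \<otimes>\<^bsub>S\<^esub> f b) (f h \<otimes>\<^bsub>S\<^esub> f k))"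
    unfolding image_UN
  proof (rule SUP_cong[OF refl], clarify)
    fix a h assume ah: "(a, h) \<in> u"
    show "map_prod f f ` (\<Union>(b, k)\<in>v. local_frac R P (a \<otimes> b) (h \<otimes> k)) =
      (\<Union>(b, k)\<in>v. local_frac S (f ` P) (f a \<otimes>\<^bsub>S\<^esub> f b) (f h \<otimes>\<^bsub>S\<^esub> f k))"
      unfolding image_UN
      by (rule SUP_cong[OF refl], clarify)
        (use ah uv in \<open>auto simp: image_local_frac[OF spec_subset[OF P]] subset_iff\<close>)
  qed
  then show "map_prod f f ` (u \<otimes>\<^bsub>localization R P\<^esub> v) =
      map_prod f f ` u \<otimes>\<^bsub>localization S (f ` P)\<^esub> map_prod f f ` v"
    by (simp add: localization_def case_prod_beta)
  have "map_prod f f ` (\<Union>(a, h)\<in>u. \<Union>(b, k)\<in>v. local_frac R P (a \<otimes> k \<oplus> b \<otimes> h) (h \<otimes> k)) =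
    (\<Union>(a, h)\<in>u. \<Union>(b, k)\<in>v. local_frac S (f ` P) (f a \<otimes>\<^bsub>S\<^esub> f k \<oplus>\<^bsub>S\<^esub> f b \<otimes>\<^bsub>S\<^esub> f h) (f h \<otimes>\<^bsub>S\<^esub> f k))"
    unfolding image_UN
  proof (rule SUP_cong[OF refl], clarify)
    fix a h assume ah: "(a, h) \<in> u"
    show "map_prod f f ` (\<Union>(b, k)\<in>v. local_frac R P (a \<otimes> k \<oplus> b \<otimes> h) (h \<otimes> k)) =
      (\<Union>(b, k)\<in>v. local_frac S (f ` P) (f a \<otimes>\<^bsub>S\<^esub> f k \<oplus>\<^bsub>S\<^esub> f b \<otimes>\<^bsub>S\<^esub> f h) (f h \<otimes>\<^bsub>S\<^esub> f k))"
      unfolding image_UN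
      by (rule SUP_cong[OF refl], clarify)
        (use ah uv in \<open>auto simp: image_local_frac[OF spec_subset[OF P]] subset_iff\<close>)
  qed
  then show "map_prod f f ` (u \<oplus>\<^bsub>localization R P\<^esub> v) =
      map_prod f f ` u \<oplus>\<^bsub>localization S (f ` P)\<^esub> map_prod f f ` v"
    by (simp add: localization_def case_prod_beta)
qed

text \<open>The value at a prime Q of S is transported from the prime g(Q) of R. The domain is
  written as a preimage under g because \<open>spec_isomorphic_over\<close> asks for sections over
  preimages.\<close>

definition push_section where
  "push_section V s = (\<lambda>Q\<in>{Q \<in> spec S. g ` Q \<in> V}. map_prod f f ` s (g ` Q))"

lemma push_section_closed:
  assumes V: "V \<subseteq> spec R" and s: "s \<in> sections R V"
  shows "push_section V s \<in> sections S {Q \<in> spec S. g ` Q \<in> V}"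
proof -
  let ?V = "{Q \<in> spec S. g ` Q \<in> V}"
  have fgQ: "f ` g ` Q = Q" if "Q \<in> spec S" for Q by (rule image_g_image[OF spec_subset[OF that]])
  have "push_section V s Q \<in> carrier (localization S Q)" if "Q \<in> ?V" for Q
  proof -
    have "s (g ` Q) \<in> carrier (localization R (g ` Q))" using s that by (auto simp: sections_def)
    from image_localization[OF _ this] show ?thesis using that V fgQ by (auto simp: push_section_def)
  qed
  moreover have "\<exists>W a h. Q \<in> W \<and> W \<subseteq> ?V \<and> openin (zariski S) W \<and> a \<in> carrier S \<and> h \<in> carrier S \<and>
       (\<forall>Q\<in>W. h \<notin> Q \<and> push_section V s Q = local_frac S Q a h)" if Q: "Q \<in> ?V" for Q
  proof -
    have "\<exists>W a h. g ` Q \<in> W \<and> W \<subseteq> V \<and> openin (zariski R) W \<and> a \<in> carrier R \<and> h \<in> carrier R \<and>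
        (\<forall>P\<in>W. h \<notin> P \<and> s P = local_frac R P a h)"
      using s Q by (simp add: sections_def)
    then obtain W a h where W: "g ` Q \<in> W" "W \<subseteq> V" "openin (zariski R) W" "a \<in> carrier R" "h \<in> carrier R"
      and Wh: "\<forall>P\<in>W. h \<notin> P \<and> s P = local_frac R P a h"
      by (elim exE conjE)
    have eq: "(`) f ` W = {Q \<in> spec S. g ` Q \<in> W}" using image_open_eq W V by blast
    have "f h \<notin> Q \<and> push_section V s Q = local_frac S Q (f a) (f h)" if Q: "Q \<in> (`) f ` W" for Q
    proof -
      have gQ: "Q \<in> spec S" "g ` Q \<in> W" using Q unfolding eq by auto
      then have sub: "g ` Q \<subseteq> carrier R" using W V spec_subset by blast
      have "f h \<notin> Q" using bspec[OF Wh gQ(2)] mem_image_iff[OF W(5) sub] fgQ[OF gQ(1)] by simp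
      moreover have "push_section V s Q = map_prod f f ` local_frac R (g ` Q) a h"
        using gQ W(2) Wh by (auto simp: push_section_def)
      ultimately show ?thesis using image_local_frac[OF sub W(4,5)] fgQ[OF gQ(1)] by simp
    qed
    moreover have "(`) f ` W \<subseteq> ?V" "Q \<in> (`) f ` W" using W Q unfolding eq by auto
    ultimately show ?thesis using open_image[OF W(3)] W(4,5)
      by (intro exI[of _ "(`) f ` W"] exI[of _ "f a"] exI[of _ "f h"]) simp
  qed
  ultimately show ?thesis unfolding sections_def by (simp add: PiE_def push_section_def)
qed

lemma push_section_iso:
  assumes V: "V \<subseteq> spec R"
  shows "push_section V \<in> ring_iso (structure_sheaf R V) (structure_sheaf S {Q \<in> spec S. g ` Q \<in> V})"
proof -
  interpret inv: cring_iso S R g f by (rule inverse)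
  let ?V = "{Q \<in> spec S. g ` Q \<in> V}"
  have fgQ: "f ` g ` Q = Q" if "Q \<in> spec S" for Q by (rule image_g_image[OF spec_subset[OF that]])
  have loc: "s P \<in> carrier (localization R P)" if "s \<in> sections R V" "P \<in> V" for s P
    using that by (auto simp: sections_def)
  have VV: "{P \<in> spec R. f ` P \<in> ?V} = V"
    using V image_spec inv.image_g_image[OF spec_subset] by (auto 4 3)
  have inv_push: "push_section V (inv.push_section ?V t) = t" if t: "t \<in> sections S ?V" for t
  proof
    fix Q
    show "push_section V (inv.push_section ?V t) Q = t Q"
    proof (cases "Q \<in> ?V")
      case True
      then have "t Q \<in> carrier (localization S Q)" using t by (auto simp: sections_def)
      then show ?thesis using True V fgQ inv.localization_subset map_prod_cancel
        by (auto simp: push_section_def inv.push_section_def)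
    next
      case False
      then show ?thesis using t by (auto simp: push_section_def sections_def PiE_def extensional_def)
    qed
  qed
  have push_inv: "inv.push_section ?V (push_section V s) = s" if s: "s \<in> sections R V" for s
  proof
    fix P
    show "inv.push_section ?V (push_section V s) P = s P"
    proof (cases "P \<in> V")
      case True
      then have "s P \<in> carrier (localization R P)" "P \<in> spec R" using s V by (auto simp: sections_def)
      moreover then have "g ` f ` P = P" "f ` P \<in> spec S" using inv.image_g_image[OF spec_subset] image_spec by auto
      ultimately show ?thesis using True localization_subset inv.map_prod_cancel
        by (simp add: push_section_def inv.push_section_def)
    next
      case False
      then show ?thesis using s VV by (auto simp: inv.push_section_def sections_def PiE_def extensional_def)
    qed
  qed
  have "bij_betw (push_section V) (sections R V) (sections S ?V)"
  proof (rule bij_betwI)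
    show "push_section V \<in> sections R V \<rightarrow> sections S ?V" using push_section_closed[OF V] by blast
    show "inv.push_section ?V \<in> sections S ?V \<rightarrow> sections R V"
      using inv.push_section_closed[of ?V] VV by auto
  qed (use inv_push push_inv in auto)
  moreover have "push_section V \<in> ring_hom (structure_sheaf R V) (structure_sheaf S ?V)"
  proof (rule ring_hom_memI)
    fix s assume "s \<in> carrier (structure_sheaf R V)"
    then show "push_section V s \<in> carrier (structure_sheaf S ?V)"
      using push_section_closed[OF V] by (simp add: structure_sheaf_def)
  next
    fix s t assume st: "s \<in> carrier (structure_sheaf R V)" "t \<in> carrier (structure_sheaf R V)"
    then have l: "s P \<in> carrier (localization R P)" "t P \<in> carrier (localization R P)" if "P \<in> V" for P
      using loc that by (auto simp: structure_sheaf_def)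
    have m: "push_section V (s \<otimes>\<^bsub>structure_sheaf R V\<^esub> t) Q =
        (push_section V s \<otimes>\<^bsub>structure_sheaf S ?V\<^esub> push_section V t) Q" for Q
    proof (cases "Q \<in> ?V")
      case True
      then have "g ` Q \<in> spec R" "f ` g ` Q = Q" using V fgQ by auto
      then show ?thesis
        using True image_localization_ops[OF _ l(1) l(2), of "g ` Q"]
        by (simp add: structure_sheaf_def push_section_def)
    qed (auto simp: structure_sheaf_def push_section_def)
    have a: "push_section V (s \<oplus>\<^bsub>structure_sheaf R V\<^esub> t) Q =
        (push_section V s \<oplus>\<^bsub>structure_sheaf S ?V\<^esub> push_section V t) Q" for Q
    proof (cases "Q \<in> ?V")
      case True
      then have "g ` Q \<in> spec R" "f ` g ` Q = Q" using V fgQ by auto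
      then show ?thesis
        using True image_localization_ops[OF _ l(1) l(2), of "g ` Q"]
        by (simp add: structure_sheaf_def push_section_def)
    qed (auto simp: structure_sheaf_def push_section_def)
    show "push_section V (s \<otimes>\<^bsub>structure_sheaf R V\<^esub> t) =
        push_section V s \<otimes>\<^bsub>structure_sheaf S ?V\<^esub> push_section V t"
      "push_section V (s \<oplus>\<^bsub>structure_sheaf R V\<^esub> t) =
        push_section V s \<oplus>\<^bsub>structure_sheaf S ?V\<^esub> push_section V t" using m a by (blast intro: ext)+
  next
    have "map_prod f f ` local_frac R (g ` Q) \<one> \<one> = local_frac S Q \<one>\<^bsub>S\<^esub> \<one>\<^bsub>S\<^esub>" if "Q \<in> ?V" for Q
      using that V image_local_frac[OF spec_subset, of "g ` Q" \<one> \<one>] fgQ by auto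
    then show "push_section V \<one>\<^bsub>structure_sheaf R V\<^esub> = \<one>\<^bsub>structure_sheaf S ?V\<^esub>"
      by (auto simp: structure_sheaf_def push_section_def localization_def fun_eq_iff restrict_def)
  qed
  ultimately show ?thesis by (simp add: ring_iso_def structure_sheaf_def)
qed

lemma spec_isomorphic:
  assumes "\<And>c. \<kappa>\<^sub>R c \<in> carrier R" "\<And>c. f (\<kappa>\<^sub>R c) = \<kappa>\<^sub>S c"
  shows "spec_isomorphic_over \<kappa>\<^sub>S S \<kappa>\<^sub>R R"
proof -
  interpret inv: cring_iso S R g f by (rule inverse)
  have fgQ: "f ` g ` Q = Q" if "Q \<in> spec S" for Q by (rule image_g_image[OF spec_subset[OF that]])
  show ?thesis
    unfolding spec_isomorphic_over_def Let_def
  proof (intro exI[of _ "(`) g"] exI[of _ push_section] conjI allI impI)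
    show "homeomorphic_map (zariski S) (zariski R) ((`) g)" by (rule inv.homeomorphic)
  next
    fix V assume "openin (zariski R) V"
    then have V: "V \<subseteq> spec R" using openin_subset topspace_zariski by metis
    then show "push_section V \<in> ring_iso (structure_sheaf R V) (structure_sheaf S {P \<in> spec S. g ` P \<in> V})"
      by (rule push_section_iso)
    {
      fix c
      have "map_prod f f ` local_frac R (g ` Q) (\<kappa>\<^sub>R c) \<one> = local_frac S Q (\<kappa>\<^sub>S c) \<one>\<^bsub>S\<^esub>"
        if "Q \<in> spec S" "g ` Q \<in> V" for Q
        using that V image_local_frac[OF spec_subset, of "g ` Q" "\<kappa>\<^sub>R c" \<one>] fgQ assms by auto
      then show "push_section V (global_section R V (\<kappa>\<^sub>R c)) =
          global_section S {P \<in> spec S. g ` P \<in> V} (\<kappa>\<^sub>S c)"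
        by (auto simp: global_section_def push_section_def fun_eq_iff restrict_def)
    }
    fix W s assume "openin (zariski R) W \<and> W \<subseteq> V \<and> s \<in> sections R V"
    then show "push_section W (restrict s W) = restrict (push_section V s) {P \<in> spec S. g ` P \<in> W}"
      by (auto simp: push_section_def restrict_def fun_eq_iff)
  qed
qed

end

section \<open>Polynomials\<close>

locale unital_hom =
  fixes h :: "'a::comm_ring_1 \<Rightarrow> 'b::comm_ring_1"
  assumes hom_add: "h (a + b) = h a + h b"
    and hom_mult: "h (a * b) = h a * h b"
    and hom_one: "h 1 = 1"
begin

lemma hom_zero: "h 0 = 0"
  using hom_add[of 0 0] by simp

lemma hom_uminus: "h (- a) = - h a"
  using hom_add[of a "- a"] by (simp add: hom_zero eq_neg_iff_add_eq_0 add.commute)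

lemma hom_diff: "h (a - b) = h a - h b"
  using hom_add[of a "- b"] by (simp add: hom_uminus)

lemma hom_sum: "h (sum f A) = (\<Sum>x\<in>A. h (f x))"
  by (induction A rule: infinite_finite_induct) (simp_all add: hom_zero hom_add)

lemma hom_two: "h 2 = 2"
  using hom_add[of 1 1] by (simp add: hom_one)

lemmas homs = hom_add hom_mult hom_one hom_zero hom_uminus hom_diff hom_two

end

text \<open>The universal property of a polynomial ring: coefficients pass through \<kappa>,
  variables are sent to x. Evaluation at points and all substitutions below are instances.\<close>

definition mpoly_hom ::
    "('k::comm_ring_1 \<Rightarrow> 'r::comm_ring_1) \<Rightarrow> ('v \<Rightarrow> 'r) \<Rightarrow> ('v, 'k) mpoly \<Rightarrow> 'r" where
  "mpoly_hom \<kappa> x p = (\<Sum>m\<in>Poly_Mapping.keys p. \<kappa> (Poly_Mapping.lookup p m) *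
     (\<Prod>v\<in>Poly_Mapping.keys m. x v ^ Poly_Mapping.lookup m v))"

lemma mpoly_eval_hom: "mpoly_eval x = mpoly_hom (\<lambda>c. c) x"
  by (simp add: fun_eq_iff mpoly_eval_def mpoly_hom_def)

lemma poly_mapping_induct [case_names zero add]:
  fixes P :: "('v \<Rightarrow>\<^sub>0 'k::comm_monoid_add) \<Rightarrow> bool"
  assumes "P 0" "\<And>p m c. P p \<Longrightarrow> P (p + Poly_Mapping.single m c)"
  shows "P p"
proof (induction p rule: update_induct)
  case const
  then show ?case by (rule assms(1))
next
  case (update p a b)
  then have "Poly_Mapping.update a b p = p + Poly_Mapping.single a b"
    by (intro poly_mapping_eqI) (auto simp: lookup_update lookup_add lookup_single in_keys_iff when_def)
  then show ?case using assms(2) update by simp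
qed

lemma mpoly_induct [case_names const var add mult]:
  fixes P :: "('v, 'k::comm_ring_1) mpoly \<Rightarrow> bool"
  assumes const: "\<And>c. P (mpoly_const c)" and var: "\<And>v. P (mpoly_var v)"
    and add: "\<And>p q. P p \<Longrightarrow> P q \<Longrightarrow> P (p + q)" and mult: "\<And>p q. P p \<Longrightarrow> P q \<Longrightarrow> P (p * q)"
  shows "P p"
proof -
  have power: "P (Poly_Mapping.single (Poly_Mapping.single v k) 1)" for v k
  proof (induction k)
    case 0
    then show ?case using const[of 1] by (simp add: mpoly_const_def)
  next
    case (Suc k)
    have "Poly_Mapping.single (Poly_Mapping.single v (Suc k)) (1::'k) =
        Poly_Mapping.single (Poly_Mapping.single v k) 1 * mpoly_var v"
      by (simp add: mpoly_var_def mult_single flip: single_add)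
    then show ?case using mult[OF Suc var] by simp
  qed
  have monom: "P (Poly_Mapping.single m 1)" for m
  proof (induction m rule: poly_mapping_induct)
    case zero
    then show ?case using const[of 1] by (simp add: mpoly_const_def)
  next
    case (add p m c)
    have "Poly_Mapping.single (p + Poly_Mapping.single m c) (1::'k) =
        Poly_Mapping.single p 1 * Poly_Mapping.single (Poly_Mapping.single m c) 1"
      by (simp add: mult_single)
    then show ?case using mult[OF add power] by simp
  qed
  show ?thesis
  proof (induction p rule: poly_mapping_induct)
    case zero
    then show ?case using const[of 0] by (simp add: mpoly_const_def)
  next
    case (add p m c)
    have "Poly_Mapping.single m c = mpoly_const c * Poly_Mapping.single m 1"
      by (simp add: mpoly_const_def mult_single)
    then show ?case using assms(3)[OF add mult[OF const monom]] by simp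
  qed
qed

lemma unital_hom_mpoly_const: "unital_hom mpoly_const"
  by unfold_locales (simp_all add: mpoly_const_def single_add mult_single)

context
  fixes \<kappa> :: "'k::comm_ring_1 \<Rightarrow> 'r::comm_ring_1" and x :: "'v \<Rightarrow> 'r"
  assumes \<kappa>: "unital_hom \<kappa>"
begin

interpretation \<kappa>: unital_hom \<kappa> by (rule \<kappa>)

lemma mpoly_hom_superset:
  assumes "finite A" "Poly_Mapping.keys p \<subseteq> A"
  shows "mpoly_hom \<kappa> x p = (\<Sum>m\<in>A. \<kappa> (Poly_Mapping.lookup p m) *
     (\<Prod>v\<in>Poly_Mapping.keys m. x v ^ Poly_Mapping.lookup m v))"
  unfolding mpoly_hom_def
  by (rule sum.mono_neutral_left) (use assms in \<open>auto simp: in_keys_iff \<kappa>.hom_zero\<close>)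

lemma mpoly_hom_add: "mpoly_hom \<kappa> x (p + q) = mpoly_hom \<kappa> x p + mpoly_hom \<kappa> x q"
proof -
  let ?A = "Poly_Mapping.keys p \<union> Poly_Mapping.keys q"
  show ?thesis
    using mpoly_hom_superset[of ?A p] mpoly_hom_superset[of ?A q]
      mpoly_hom_superset[of ?A "p + q"] Poly_Mapping.keys_add[of p q]
    by (simp add: lookup_add \<kappa>.hom_add distrib_right sum.distrib)
qed

lemma monomial_superset:
  assumes "finite A" "Poly_Mapping.keys m \<subseteq> A"
  shows "(\<Prod>v\<in>Poly_Mapping.keys m. x v ^ Poly_Mapping.lookup m v) = (\<Prod>v\<in>A. x v ^ Poly_Mapping.lookup m v)"
  by (rule prod.mono_neutral_left) (use assms in \<open>auto simp: in_keys_iff\<close>)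

lemma monomial_add:
  "(\<Prod>v\<in>Poly_Mapping.keys (m + m'). x v ^ Poly_Mapping.lookup (m + m') v) =
   (\<Prod>v\<in>Poly_Mapping.keys m. x v ^ Poly_Mapping.lookup m v) *
   (\<Prod>v\<in>Poly_Mapping.keys m'. x v ^ Poly_Mapping.lookup m' v)"
proof -
  let ?A = "Poly_Mapping.keys m \<union> Poly_Mapping.keys m'"
  show ?thesis
    using monomial_superset[of ?A m] monomial_superset[of ?A m']
      monomial_superset[of ?A "m + m'"] Poly_Mapping.keys_add[of m m']
    by (simp add: lookup_add power_add prod.distrib)
qed

lemma mpoly_hom_single:
  "mpoly_hom \<kappa> x (Poly_Mapping.single m c) = \<kappa> c * (\<Prod>v\<in>Poly_Mapping.keys m. x v ^ Poly_Mapping.lookup m v)"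
  using mpoly_hom_superset[of "{m}" "Poly_Mapping.single m c"] by simp

lemma mpoly_hom_zero: "mpoly_hom \<kappa> x 0 = 0"
  by (simp add: mpoly_hom_def)

lemma mpoly_hom_mult: "mpoly_hom \<kappa> x (p * q) = mpoly_hom \<kappa> x p * mpoly_hom \<kappa> x q"
proof (induction p rule: poly_mapping_induct)
  case zero
  then show ?case by (simp add: mpoly_hom_zero)
next
  case (add p m c)
  have "mpoly_hom \<kappa> x (Poly_Mapping.single m c * q) =
      mpoly_hom \<kappa> x (Poly_Mapping.single m c) * mpoly_hom \<kappa> x q"
    by (induction q rule: poly_mapping_induct)
      (simp_all add: mpoly_hom_zero mpoly_hom_add distrib_left mult_single mpoly_hom_single
        monomial_add \<kappa>.hom_mult mult_ac)
  then show ?case using add by (simp add: distrib_right mpoly_hom_add)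
qed

lemma mpoly_hom_const: "mpoly_hom \<kappa> x (mpoly_const c) = \<kappa> c"
  by (simp add: mpoly_const_def mpoly_hom_single)

lemma mpoly_hom_var: "mpoly_hom \<kappa> x (mpoly_var v) = x v"
  by (simp add: mpoly_var_def mpoly_hom_single \<kappa>.hom_one)

lemma unital_hom_mpoly_hom: "unital_hom (mpoly_hom \<kappa> x)"
proof
  show "mpoly_hom \<kappa> x 1 = 1"
    by (metis \<kappa>.hom_one mpoly_hom_const unital_hom.hom_one[OF unital_hom_mpoly_const])
qed (rule mpoly_hom_add, rule mpoly_hom_mult)

end

section \<open>Linear recurrences and continuants\<close>

fun lin_rec :: "(nat \<Rightarrow> 'r::comm_ring_1) \<Rightarrow> 'r \<Rightarrow> 'r \<Rightarrow> nat \<Rightarrow> 'r" where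
  "lin_rec e a b 0 = a"
| "lin_rec e a b (Suc 0) = b"
| "lin_rec e a b (Suc (Suc s)) = e s * lin_rec e a b (Suc s) - lin_rec e a b s"

lemma (in unital_hom) hom_lin_rec:
  "h (lin_rec e a b s) = lin_rec (\<lambda>s. h (e s)) (h a) (h b) s"
  by (induction e a b s rule: lin_rec.induct) (simp_all add: homs)

definition det2 :: "('i \<Rightarrow> 'r::comm_ring_1) \<Rightarrow> ('i \<Rightarrow> 'r) \<Rightarrow> 'i \<Rightarrow> 'i \<Rightarrow> 'r" where
  "det2 u v i j = u i * v j - v i * u j"

lemma det2_self: "det2 u v i i = 0"
  by (simp add: det2_def)

lemma det2_swap: "det2 u v j i = - det2 u v i j"
  by (simp add: det2_def)

lemma det2_plucker:
  "det2 u v i k * det2 u v j l = det2 u v i j * det2 u v k l + det2 u v j k * det2 u v i l"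
  by (simp add: det2_def algebra_simps)

text \<open>For i < j this is Euler's continuant, in the version with minus signs, of e_i, ..., e_(j
  - 2). As a determinant of fundamental solutions it makes sense for all i and j, is antisymmetric
  and inherits the Pluecker relation.\<close>

definition continuant :: "(nat \<Rightarrow> 'r::comm_ring_1) \<Rightarrow> nat \<Rightarrow> nat \<Rightarrow> 'r" where
  "continuant e = det2 (lin_rec e 1 0) (lin_rec e 0 1)"

lemma continuant_self: "continuant e i i = 0"
  by (simp add: continuant_def det2_self)

lemma continuant_swap: "continuant e j i = - continuant e i j"
  unfolding continuant_def by (rule det2_swap)

lemma continuant_rec: "continuant e i (Suc (Suc j)) = e j * continuant e i (Suc j) - continuant e i j"
  by (simp add: continuant_def det2_def algebra_simps)

text \<open>A discrete Wronskian: one step of the recurrence leaves it unchanged, and it equals 1 at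
  the start.\<close>

lemma continuant_Suc: "continuant e i (Suc i) = 1"
proof (induction i)
  case (Suc i)
  then show ?case
    using continuant_rec[of e "Suc i" i] continuant_self[of e "Suc i"] continuant_swap[of e "Suc i" i]
    by simp
qed (simp add: continuant_def det2_def)

lemma continuant_Suc_Suc: "continuant e i (Suc (Suc i)) = e i"
  by (simp add: continuant_rec continuant_Suc continuant_self)

lemma (in unital_hom) hom_continuant: "h (continuant e i j) = continuant (\<lambda>s. h (e s)) i j"
  by (simp add: continuant_def det2_def homs hom_lin_rec)

text \<open>A point at which the continuant does not vanish, in any characteristic: after 0, 1 the
  coefficient 1 produces 1, and from then on 2 * 1 - 1 = 1. With the coefficient 2 everywhere the
  value would be j - i, which may be 0 in the ring.\<close>

lemma continuant_one_two:
  assumes "i < j"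
  shows "continuant (\<lambda>s. if s = i then 1 else 2 :: 'r::comm_ring_1) i j = 1"
proof -
  let ?e = "\<lambda>s. if s = i then 1 else 2 :: 'r"
  have "continuant ?e i (Suc (i + t)) = 1 \<and> continuant ?e i (Suc (Suc (i + t))) = 1" for t
  proof (induction t)
    case 0
    then show ?case by (simp add: continuant_Suc continuant_Suc_Suc)
  next
    case (Suc t)
    then show ?case using continuant_rec[of ?e i "Suc (i + t)"] by simp
  qed
  from this[of "j - i - 1"] show ?thesis using assms by simp
qed

section \<open>Products of reflections\<close>

lemma (in unital_hom) hom_refl_prod:
  "refl_prod m \<rho> (\<lambda>a. \<chi> j k. h (C a $ j $ k)) a i i' $ k $ l = h (refl_prod m \<rho> C a i i' $ k $ l)"
proof (induction m arbitrary: a i i' k l)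
  case 0
  then show ?case by (simp add: mat_def homs)
next
  case (Suc m)
  have "sigma (\<lambda>a. \<chi> j k. h (C a $ j $ k)) a i $ p $ q = h (sigma C a i $ p $ q)" for p q
    by (simp add: sigma_def homs)
  then show ?case
    by (simp add: matrix_matrix_mult_def hom_sum hom_mult Suc)
qed

lemma (in unital_hom) hom_tau_power:
  fixes k l :: "'i::finite"
  shows "h (tau_power m $ k $ l) = tau_power m $ k $ l"
proof (induction m arbitrary: k l)
  case 0
  then show ?case by (simp add: tau_power_def mat_def homs)
next
  case (Suc m)
  have "h (tau $ p $ q) = tau $ p $ q" for p q :: 'i by (simp add: tau_def homs)
  then show ?case using Suc by (simp add: tau_power_def matrix_matrix_mult_def hom_sum hom_mult)
qed

lemma tau_power_Suc: "tau_power (Suc m) = tau ** tau_power m"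
  by (simp add: tau_power_def)

text \<open>A window of two consecutive values of a solution, the earlier one placed at the index of
  the next reflection.\<close>

definition rank2_vec :: "'i::finite \<Rightarrow> 'r \<Rightarrow> 'r \<Rightarrow> 'r ^ 'i" where
  "rank2_vec i y y' = (\<chi> k. if k = i then y else y')"

lemma UNIV_card2:
  assumes "CARD('i::finite) = 2" "i \<noteq> (j::'i)"
  shows "UNIV = {i, j}"
  using assms by (intro card_seteq[symmetric]) auto

lemma card2_cases:
  assumes "CARD('i::finite) = 2" "i \<noteq> (j::'i)" "k \<noteq> j"
  shows "k = i"
  using UNIV_card2[OF assms(1,2)] assms(3) by blast

lemma sum_card2:
  assumes "CARD('i::finite) = 2" "i \<noteq> (j::'i)"
  shows "(\<Sum>k\<in>UNIV. f k) = f i + f j"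
  unfolding UNIV_card2[OF assms] using assms(2) by simp

text \<open>In these coordinates a reflection is one step of the recurrence: the later value stays
  where it is and becomes the earlier one, and the coordinate i receives the next value.\<close>

lemma sigma_rank2_vec:
  fixes C :: "'a \<Rightarrow> 'r::comm_ring_1 ^ 'i::finite ^ 'i"
  assumes "CARD('i) = 2" "i \<noteq> j" "C a $ i $ i = 2"
  shows "sigma C a i *v rank2_vec i y y' = rank2_vec j y' (- C a $ i $ j * y' - y)"
proof -
  have "(sigma C a i *v rank2_vec i y y') $ k = rank2_vec j y' (- C a $ i $ j * y' - y) $ k" for k
    using card2_cases[OF assms(1), of j i k] assms(2,3)
    by (cases "k = i")
      (auto simp: matrix_vector_mult_def rank2_vec_def sigma_def sum_card2[OF assms(1,2)] algebra_simps)
  then show ?thesis by (simp add: vec_eq_iff)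
qed

lemma refl_prod_rank2_vec:
  fixes C :: "'a \<Rightarrow> 'r::comm_ring_1 ^ 'i::finite ^ 'i"
  assumes card: "CARD('i) = 2"
    and diag: "\<And>a i. C a $ i $ i = 2"
    and b: "\<And>s. b (Suc s) = \<rho> (c s) (b s)" and c: "\<And>s. c (Suc s) \<noteq> c s"
    and Y: "\<And>s. Y (Suc (Suc s)) = - C (b s) $ c s $ c (Suc s) * Y (Suc s) - Y s"
  shows "refl_prod m \<rho> C (b t) (c t) (c (Suc t)) *v rank2_vec (c t) (Y t) (Y (Suc t)) =
    rank2_vec (c (t + m)) (Y (t + m)) (Y (Suc (t + m)))"
proof (induction m arbitrary: t)
  case 0
  then show ?case by (simp add: matrix_vector_mul_lid)
next
  case (Suc m)
  have c2: "c (Suc (Suc t)) = c t" using card2_cases[OF card c[of t, symmetric] c] .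
  have "refl_prod (Suc m) \<rho> C (b t) (c t) (c (Suc t)) *v rank2_vec (c t) (Y t) (Y (Suc t)) =
      refl_prod m \<rho> C (b (Suc t)) (c (Suc t)) (c (Suc (Suc t))) *v
        rank2_vec (c (Suc t)) (Y (Suc t)) (Y (Suc (Suc t)))"
    using sigma_rank2_vec[of "c t" "c (Suc t)" C "b t", OF card c[of t, symmetric] diag]
    by (simp add: b c2 Y flip: matrix_vector_mul_assoc)
  then show ?case using Suc[of "Suc t"] by simp
qed

lemma tau_power_rank2_vec:
  assumes card: "CARD('i::finite) = 2" and c: "\<And>s. c (Suc s) \<noteq> (c s :: 'i)"
  shows "tau_power m *v rank2_vec (c t) y y' = rank2_vec (c (t + m)) y (y' :: 'r::comm_ring_1)"
proof (induction m)
  case 0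
  then show ?case by (simp add: tau_power_def matrix_vector_mul_lid)
next
  case (Suc m)
  have "(tau *v rank2_vec i y y') $ k = rank2_vec j y y' $ k" if "i \<noteq> j" for i j k :: 'i
    using card2_cases[OF card, of j i k] that
    by (cases "k = i") (auto simp: matrix_vector_mult_def rank2_vec_def tau_def sum_card2[OF card that])
  then have "tau *v rank2_vec (c (t + m)) y y' = rank2_vec (c (Suc (t + m))) y y'"
    using c[of "t + m"] by (metis vec_eq_iff)
  then show ?case using Suc by (simp add: tau_power_Suc flip: matrix_vector_mul_assoc)
qed

text \<open>The bridge to antiperiodicity. The power of \<open>tau\<close> only moves a window to
  the index at which the product of reflections places it, so the sum of the two matrices measures
  how far Y (t + m) = - Y t fails.\<close>

lemma refl_prod_plus_tau_power:
  fixes C :: "'a \<Rightarrow> 'r::comm_ring_1 ^ 'i::finite ^ 'i"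
  assumes card: "CARD('i) = 2"
    and diag: "\<And>a i. C a $ i $ i = 2"
    and b: "\<And>s. b (Suc s) = \<rho> (c s) (b s)" and c: "\<And>s. c (Suc s) \<noteq> c s"
    and Y: "\<And>s. Y (Suc (Suc s)) = - C (b s) $ c s $ c (Suc s) * Y (Suc s) - Y s"
  shows "(refl_prod m \<rho> C (b t) (c t) (c (Suc t)) + tau_power m) *v rank2_vec (c t) (Y t) (Y (Suc t)) =
    rank2_vec (c (t + m)) (Y (t + m) + Y t) (Y (Suc (t + m)) + Y (Suc t))"
  using refl_prod_rank2_vec[of C b \<rho> c Y m t] tau_power_rank2_vec[of c m t "Y t" "Y (Suc t)"] assms
  by (simp add: matrix_vector_mult_add_rdistrib vec_eq_iff rank2_vec_def)

text \<open>The starting values make the first window of Y the unit vector at l, so the identity for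
  windows reads off column l.\<close>

lemma refl_prod_plus_tau_power_entry:
  fixes C :: "'a \<Rightarrow> 'r::comm_ring_1 ^ 'i::finite ^ 'i"
  assumes card: "CARD('i) = 2"
    and diag: "\<And>a i. C a $ i $ i = 2"
    and b: "\<And>s. b (Suc s) = \<rho> (c s) (b s)" and c: "\<And>s. c (Suc s) \<noteq> c s"
    and Y: "\<And>s. Y (Suc (Suc s)) = - C (b s) $ c s $ c (Suc s) * Y (Suc s) - Y s"
    and Y0: "Y 0 = (if l = c 0 then 1 else 0)" "Y (Suc 0) = (if l = c 0 then 0 else 1)"
  shows "(refl_prod m \<rho> C (b 0) (c 0) (c (Suc 0)) + tau_power m) $ k $ l =
    (if k = c m then Y m + Y 0 else Y (Suc m) + Y (Suc 0))"
proof -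
  have "rank2_vec (c 0) (Y 0) (Y (Suc 0)) = axis l 1"
    using card2_cases[OF card, of "c (Suc 0)" "c 0"] c[of 0] Y0
    by (cases "l = c 0") (auto simp: vec_eq_iff rank2_vec_def axis_def)
  then have "(refl_prod m \<rho> C (b 0) (c 0) (c (Suc 0)) + tau_power m) $ k $ l =
      ((refl_prod m \<rho> C (b 0) (c 0) (c (Suc 0)) + tau_power m) *v rank2_vec (c 0) (Y 0) (Y (Suc 0))) $ k"
    by (simp add: matrix_vector_mult_def axis_def if_distrib cong: if_cong)
  then show ?thesis
    using refl_prod_plus_tau_power[of C b \<rho> c Y m 0] assms by (simp add: rank2_vec_def)
qed

section \<open>Ideals of subrings\<close>

text \<open>Two situations are covered: the ideal of the equations, with A the whole polynomial
  ring, and the specialization ideal, with A the cluster algebra inside the rational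
  functions.\<close>

locale subring_ideal =
  fixes A J :: "'r::comm_ring_1 set"
  assumes one_closed: "1 \<in> A" and add_closed: "a \<in> A \<Longrightarrow> b \<in> A \<Longrightarrow> a + b \<in> A"
    and uminus_closed: "a \<in> A \<Longrightarrow> - a \<in> A" and mult_closed: "a \<in> A \<Longrightarrow> b \<in> A \<Longrightarrow> a * b \<in> A"
    and J_subset: "J \<subseteq> A" and J_zero: "0 \<in> J" and J_add: "a \<in> J \<Longrightarrow> b \<in> J \<Longrightarrow> a + b \<in> J"
    and J_mult: "a \<in> A \<Longrightarrow> b \<in> J \<Longrightarrow> a * b \<in> J"
begin

lemma J_uminus: "a \<in> J \<Longrightarrow> - a \<in> J"
  using J_mult[OF uminus_closed[OF one_closed]] by simp

lemma J_diff: "a \<in> J \<Longrightarrow> b \<in> J \<Longrightarrow> a - b \<in> J"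
  using J_add[OF _ J_uminus] by fastforce

lemma J_sum: "(\<And>x. x \<in> B \<Longrightarrow> f x \<in> J) \<Longrightarrow> sum f B \<in> J"
  by (induction B rule: infinite_finite_induct) (simp_all add: J_zero J_add)

lemma zero_closed: "0 \<in> A"
  using J_zero J_subset by blast

lemma two_closed: "2 \<in> A"
  using add_closed[OF one_closed one_closed] by simp

lemma lin_rec_cong:
  assumes "\<And>s. e s \<in> A"
    and "Y 0 - a \<in> J" "Y (Suc 0) - b \<in> J"
    and "\<And>s. Y (Suc (Suc s)) - (e s * Y (Suc s) - Y s) \<in> J"
  shows "Y s - lin_rec e a b s \<in> J"
  using assms
proof (induction e a b s rule: lin_rec.induct)
  case (3 e a b s)
  have "(Y (Suc (Suc s)) - (e s * Y (Suc s) - Y s)) +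
      e s * (Y (Suc s) - lin_rec e a b (Suc s)) - (Y s - lin_rec e a b s) \<in> J"
    by (intro J_diff J_add[OF "3.prems"(4)] J_mult "3.prems"(1) "3.IH" "3.prems")
  then show ?case by (simp add: algebra_simps)
qed simp_all

end

section \<open>The cycle of objects\<close>

text \<open>The cycle is unrolled to the integers, so that no edge plays a special part. Edge t
  joins \<open>obj t\<close> to \<open>obj (t + 1)\<close> and has the label
  \<open>lab t\<close>.\<close>

locale object_cycle =
  fixes \<rho> :: "'i::finite \<Rightarrow> 'a \<Rightarrow> 'a" and n :: nat and obj :: "int \<Rightarrow> 'a" and lab :: "int \<Rightarrow> 'i"
  assumes card: "CARD('i) = 2" and n: "3 \<le> n" and card_obj: "CARD('a) = 2 * n"
    and step: "\<rho> (lab t) (obj t) = obj (t + 1)" and step_back: "\<rho> (lab t) (obj (t + 1)) = obj t"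
    and lab_alternates: "lab (t + 1) \<noteq> lab t"
    and obj_periodic: "obj (t + 2 * int n) = obj t"
    and obj_surj: "\<exists>t. 0 \<le> t \<and> t < 2 * int n \<and> obj t = a"
    and obj_inj: "0 \<le> s \<Longrightarrow> s < 2 * int n \<Longrightarrow> 0 \<le> t \<Longrightarrow> t < 2 * int n \<Longrightarrow> obj s = obj t \<Longrightarrow> s = t"

lemma object_cycle_exists:
  fixes \<rho> :: "'i::finite \<Rightarrow> 'a \<Rightarrow> 'a"
  assumes n: "3 \<le> n" and fin: "finite_reflection_groupoid \<rho> C" and card: "CARD('a) = 2 * n"
  obtains obj lab where "object_cycle \<rho> n obj lab"
proof -
  have sch: "cartan_scheme \<rho> C" and cyc: "is_cycle (object_change_diagram \<rho>)"
    using fin by (auto simp: finite_reflection_groupoid_def)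
  have inv: "\<rho> i (\<rho> i a) = a" and card2: "CARD('i) = 2" for i a
    using sch by (auto simp: cartan_scheme_def)
  obtain m v e where v: "bij_betw v {..<m} (UNIV :: 'a set)"
    and e: "bij_betw e {..<m} {(i, {a, \<rho> i a}) | i a. \<rho> i a \<noteq> a}"
    and ve: "\<And>k. k < m \<Longrightarrow> snd (e k) = {v k, v (Suc k mod m)}"
    using cyc by (auto simp: is_cycle_def object_change_diagram_def)
  have m: "m = 2 * n" using bij_betw_same_card[OF v] card by simp
  have edge: "\<rho> (fst (e k)) (v k) = v (Suc k mod m) \<and> \<rho> (fst (e k)) (v (Suc k mod m)) = v k"
    if k: "k < m" for k
  proof -
    have "e k \<in> {(i, {a, \<rho> i a}) | i a. \<rho> i a \<noteq> a}" using bij_betwE[OF e] k by blast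
    then obtain i a where "e k = (i, {a, \<rho> i a})" by blast
    then show ?thesis using ve[OF k] inv[of i] by (auto simp: doubleton_eq_iff) metis+
  qed
  define obj where "obj t = v (nat (t mod int m))" for t
  define lab where "lab t = fst (e (nat (t mod int m)))" for t
  have mpos: "0 < int m" using m n by simp
  have nat_lt: "nat (t mod int m) < m" for t using mpos by (simp add: nat_less_iff)
  have nat_Suc: "nat ((t + 1) mod int m) = Suc (nat (t mod int m)) mod m" for t
  proof -
    have "(t + 1) mod int m = int (Suc (nat (t mod int m)) mod m)"
      using mpos by (simp add: zmod_int mod_add_right_eq add.commute)
    then show ?thesis by simp
  qed
  have step: "\<rho> (lab t) (obj t) = obj (t + 1)" and ret: "\<rho> (lab t) (obj (t + 1)) = obj t" for t
    using edge[OF nat_lt[of t]] by (simp_all add: obj_def lab_def nat_Suc)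
  have inj: "s = t" if "0 \<le> s" "s < 2 * int n" "0 \<le> t" "t < 2 * int n" "obj s = obj t" for s t
  proof -
    have "nat s < m" "nat t < m" "v (nat s) = v (nat t)" using that m by (simp_all add: obj_def)
    then have "nat s = nat t" using bij_betw_imp_inj_on[OF v] by (auto simp: inj_on_def)
    then show ?thesis using that by simp
  qed
  have periodic: "obj (t + 2 * int n) = obj t" for t by (simp add: obj_def m)
  have objmod: "obj t = obj (t mod (2 * int n))" for t by (simp add: obj_def m)
  have "object_cycle \<rho> n obj lab"
  proof
    fix t show "lab (t + 1) \<noteq> lab t"
    proof
      \<comment> \<open>Two equal labels in a row lead back to the same object because \<rho> acts
        by involutions, but objects two steps apart on a cycle of length 2 n >= 6 are
        distinct.\<close>
      assume "lab (t + 1) = lab t"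
      then have "obj (t + 2) = obj t" using step[of "t + 1"] ret[of t] by (simp add: add.assoc)
      then have "obj ((t + 2) mod (2 * int n)) = obj (t mod (2 * int n))"
        using objmod[of "t + 2"] objmod[of t] by simp
      then have "(t + 2) mod (2 * int n) = t mod (2 * int n)" using inj n by simp
      then have "2 * int n dvd 2" using mod_eq_dvd_iff[of "t + 2" "2 * int n" t] by simp
      then show False using n zdvd_imp_le[of "2 * int n" 2] by simp
    qed
  next
    fix a
    obtain k where k: "k < m" "v k = a" using bij_betw_imp_surj_on[OF v] by (metis UNIV_I imageE lessThan_iff)
    then show "\<exists>t. 0 \<le> t \<and> t < 2 * int n \<and> obj t = a"
      by (intro exI[of _ "int k"]) (auto simp: obj_def m)
  qed (use n card card2 step ret periodic inj in auto)
  then show ?thesis by (rule that)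
qed

context object_cycle
begin

lemma lab_plus_two: "lab (t + 2) = lab t"
proof -
  have "lab (t + 1 + 1) \<noteq> lab (t + 1)" "lab (t + 1) \<noteq> lab t" by (rule lab_alternates)+
  then show ?thesis using card2_cases[OF card, of "lab t" "lab (t + 1)" "lab (t + 1 + 1)"]
    by (simp add: add.assoc)
qed

lemma periodic_mult:
  fixes e :: "int \<Rightarrow> 'x"
  assumes "\<And>t. e (t + p) = e t"
  shows "e (t + p * k) = e t"
proof -
  have nn: "e (t + p * int j) = e t" for t j
  proof (induction j)
    case (Suc j)
    then show ?case using assms[of "t + p * int j"] by (simp add: algebra_simps)
  qed simp
  show ?thesis
  proof (cases "0 \<le> k")
    case True
    then show ?thesis using nn[of t "nat k"] by simp
  next
    case False
    then show ?thesis using nn[of "t + p * k" "nat (- k)"] by simp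
  qed
qed

lemma periodic_mod:
  fixes e :: "int \<Rightarrow> 'x"
  assumes "\<And>t. e (t + p) = e t"
  shows "e (t mod p + c) = e (t + c)"
proof -
  have "e (t mod p + c + p * (t div p)) = e (t mod p + c)" by (rule periodic_mult[of e p]) (rule assms)
  moreover have "t mod p + c + p * (t div p) = t + c" using mult_div_mod_eq[of p t] by linarith
  ultimately show ?thesis by metis
qed

lemma lab_mod: "lab (t mod (2 * int n) + c) = lab (t + c)"
proof -
  have "lab (t + 2 * int n) = lab t" for t
    using periodic_mult[of lab 2 t "int n"] lab_plus_two by simp
  from periodic_mod[of lab, OF this] show ?thesis .
qed

definition pos :: "'a \<Rightarrow> int" where
  "pos a = (THE t. 0 \<le> t \<and> t < 2 * int n \<and> obj t = a)"

lemma pos_obj: "pos (obj t) = t mod (2 * int n)"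
  unfolding pos_def
proof (rule the_equality)
  show *: "0 \<le> t mod (2 * int n) \<and> t mod (2 * int n) < 2 * int n \<and> obj (t mod (2 * int n)) = obj t"
    using periodic_mod[of obj "2 * int n" t 0] obj_periodic n by simp
  fix s assume "0 \<le> s \<and> s < 2 * int n \<and> obj s = obj t"
  then show "s = t mod (2 * int n)" using obj_inj * by metis
qed

text \<open>The number of the edge at a with label i: it leads either to the next object or to the
  preceding one. At position 0 the value - 1 occurs, which is one reason why sequences indexed by
  edges have to be periodic below.\<close>

definition edge_pos :: "'a \<Rightarrow> 'i \<Rightarrow> int" where
  "edge_pos a i = (if lab (pos a) = i then pos a else pos a - 1)"

text \<open>There is one parameter per edge. Both end points of an edge use it, as the compatibility
  of the matrices with \<rho> demands.\<close>

definition cycle_matrices :: "(int \<Rightarrow> 'r::comm_ring_1) \<Rightarrow> 'a \<Rightarrow> 'r ^ 'i ^ 'i" where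
  "cycle_matrices e a = (\<chi> i j. if i = j then 2 else - e (edge_pos a i))"

text \<open>The two orders of the labels at an object are the two directions of travel: starting
  with i, the walk goes forwards in the first case and backwards in the second.\<close>

lemma walk_cases:
  assumes "i \<noteq> j"
  obtains t where "a = obj t" "i = lab t" "j = lab (t + 1)"
  | t where "a = obj t" "i = lab (t - 1)" "j = lab t"
proof -
  obtain t where t: "a = obj t" using obj_surj by metis
  have l: "lab (t + 1) \<noteq> lab t" "lab (t - 1) \<noteq> lab t"
    using lab_alternates[of t] lab_alternates[of "t - 1"] by auto
  show ?thesis
  proof (cases "i = lab t")
    case True
    then show ?thesis using that(1) t card2_cases[OF card, of "lab (t + 1)" "lab t" j] l assms by metis
  next
    case False
    then show ?thesis using that(2) t card2_cases[OF card] l assms by metis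
  qed
qed

context
  fixes e :: "int \<Rightarrow> 'r::comm_ring_1"
  assumes e_periodic: "\<And>t. e (t + 2 * int n) = e t"
begin

lemma cycle_matrices_forward:
  "cycle_matrices e (obj t) $ lab t $ lab (t + 1) = - e t"
  using lab_mod[of t 0] lab_alternates[of t] periodic_mod[of e "2 * int n" t 0, OF e_periodic]
  by (auto simp: cycle_matrices_def edge_pos_def pos_obj)

lemma cycle_matrices_backward:
  "cycle_matrices e (obj t) $ lab (t - 1) $ lab t = - e (t - 1)"
  using lab_mod[of t 0] lab_alternates[of "t - 1"] periodic_mod[of e "2 * int n" t "- 1", OF e_periodic]
  by (auto simp: cycle_matrices_def edge_pos_def pos_obj)

lemma cycle_matrices_diag: "cycle_matrices e a $ i $ i = 2"
  by (simp add: cycle_matrices_def)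

lemma cycle_matrices_step: "cycle_matrices e (\<rho> i a) $ i $ j = cycle_matrices e a $ i $ j"
proof (cases "i = j")
  case False
  then show ?thesis
  proof (cases rule: walk_cases[of i j a])
    case (1 t)
    then show ?thesis
      using cycle_matrices_forward[of t] cycle_matrices_backward[of "t + 1"] step[of t] by simp
  next
    case (2 t)
    have "lab (t - 2) = lab t" using lab_plus_two[of "t - 2"] by simp
    then show ?thesis
      using 2 cycle_matrices_backward[of t] cycle_matrices_forward[of "t - 1"] step_back[of "t - 1"] by simp
  qed
qed (simp add: cycle_matrices_diag)

text \<open>From equations to solutions: the matrix has all its entries in J, hence so does its
  product with a window, and one coordinate of this product is Y (s + n) + Y s.\<close>

lemma solution_antiperiodic:
  assumes J: "subring_ideal UNIV J"
    and rel: "\<And>a i j k l. i \<noteq> j \<Longrightarrow> (refl_prod n \<rho> (cycle_matrices e) a i j + tau_power n) $ k $ l \<in> J"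
    and Y: "\<And>s. Y (Suc (Suc s)) = e (int s) * Y (Suc s) - Y s"
  shows "Y (s + n) + Y s \<in> J"
proof -
  interpret subring_ideal UNIV J by (rule J)
  let ?M = "refl_prod n \<rho> (cycle_matrices e) (obj (int s)) (lab (int s)) (lab (int s + 1)) + tau_power n"
  let ?v = "rank2_vec (lab (int s)) (Y s) (Y (Suc s))"
  have "?M *v ?v = rank2_vec (lab (int s + int n)) (Y (s + n) + Y s) (Y (Suc (s + n)) + Y (Suc s))"
    using refl_prod_plus_tau_power[of "cycle_matrices e" "\<lambda>s. obj (int s)" \<rho> "\<lambda>s. lab (int s)" Y n s, OF card cycle_matrices_diag]
      step lab_alternates cycle_matrices_forward Y
    by (simp add: add.commute[of 1])
  then have "Y (s + n) + Y s = (?M *v ?v) $ lab (int s + int n)"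
    by (simp add: rank2_vec_def)
  also have "\<dots> \<in> J" unfolding matrix_vector_mult_def vec_lambda_beta
    using rel[of "lab (int s)" "lab (int s + 1)"] lab_alternates[of "int s"]
    by (intro J_sum) (metis J_mult UNIV_I mult.commute)
  finally show ?thesis .
qed

end

text \<open>From solutions back to equations. Y and Z are exactly antiperiodic but satisfy the
  recurrence only modulo J, whereas the matrices act on exact solutions. The exact ones are supplied
  by \<open>lin_rec\<close> and agree with Y and Z modulo J. The starting values 1, 0 of Z and 0, 1
  of Y account for the two columns.\<close>

lemma walk_relation:
  fixes C :: "'a \<Rightarrow> 'r::comm_ring_1 ^ 'i ^ 'i"
  assumes J: "subring_ideal A J" and diag: "\<And>a i. C a $ i $ i = 2"
    and b: "\<And>s. b (Suc s) = \<rho> (c s) (b s)" and c: "\<And>s. c (Suc s) \<noteq> c s"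
    and e: "\<And>s. - C (b s) $ c s $ c (Suc s) = e s" "\<And>s. e s \<in> A"
    and Y: "\<And>s. Y (Suc (Suc s)) - (e s * Y (Suc s) - Y s) \<in> J" "Y 0 \<in> J" "Y (Suc 0) - 1 \<in> J" "\<And>s. Y (s + n) = - Y s"
    and Z: "\<And>s. Z (Suc (Suc s)) - (e s * Z (Suc s) - Z s) \<in> J" "Z 0 - 1 \<in> J" "Z (Suc 0) \<in> J" "\<And>s. Z (s + n) = - Z s"
  shows "(refl_prod n \<rho> C (b 0) (c 0) (c (Suc 0)) + tau_power n) $ k $ l \<in> J"
proof -
  interpret subring_ideal A J by (rule J)
  have anti: "V (s + n) + V s \<in> J" if "\<And>s. W s - V s \<in> J" "\<And>s. W (s + n) = - W s" for W V s
    using J_uminus[OF J_add[OF that(1)[of "s + n"] that(1)[of s]]] that(2)[of s] by (simp add: algebra_simps)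
  have rec: "lin_rec e u v (Suc (Suc s)) = - C (b s) $ c s $ c (Suc s) * lin_rec e u v (Suc s) - lin_rec e u v s" for u v s
    by (simp add: e)
  show ?thesis
  proof (cases "l = c 0")
    case True
    have *: "lin_rec e 1 0 (s + n) + lin_rec e 1 0 s \<in> J" for s
      using anti[of Z "lin_rec e 1 0"] lin_rec_cong[of e Z 1 0] e(2) Z by simp
    then show ?thesis
      using refl_prod_plus_tau_power_entry[of C b \<rho> c "lin_rec e 1 0" l n k, OF card diag b c rec] True *[of 0] *[of "Suc 0"]
      by simp
  next
    case False
    have *: "lin_rec e 0 1 (s + n) + lin_rec e 0 1 s \<in> J" for s
      using anti[of Y "lin_rec e 0 1"] lin_rec_cong[of e Y 0 1] e(2) Y by simp
    then show ?thesis
      using refl_prod_plus_tau_power_entry[of C b \<rho> c "lin_rec e 0 1" l n k, OF card diag b c rec] False *[of 0] *[of "Suc 0"]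
      by simp
  qed
qed

text \<open>Each row of D solves, modulo J, the recurrence with coefficients D j (j + 2). Since D i
  j and D i (j + 2) enter it symmetrically, a row can be read in either direction, which handles
  both kinds of walks.\<close>

lemma frieze_relation:
  fixes D :: "int \<Rightarrow> int \<Rightarrow> 'r::comm_ring_1"
  assumes J: "subring_ideal A J"
    and closed: "\<And>i j. D i j \<in> A"
    and self: "\<And>i. D i i = 0" and swap: "\<And>i j. D j i = - D i j"
    and succ: "\<And>i. D i (i + 1) - 1 \<in> J"
    and rec: "\<And>i j. D i (j + 2) - (D j (j + 2) * D i (j + 1) - D i j) \<in> J"
    and antiperiodic: "\<And>i j. D i (j + int n) = - D i j"
    and "i \<noteq> j"
  shows "(refl_prod n \<rho> (cycle_matrices (\<lambda>t. D t (t + 2))) a i j + tau_power n) $ k $ l \<in> J"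
proof -
  interpret subring_ideal A J by (rule J)
  have anti': "D (i + int n) j = - D i j" for i j using antiperiodic swap by (metis minus_minus)
  have "D (t + 2 * int n) (t + 2 * int n + 2) = D t (t + 2)" for t
    using antiperiodic[of "t + 2 * int n" "t + 2 + int n"] antiperiodic[of "t + 2 * int n" "t + 2"]
      anti'[of "t + int n" "t + 2"] anti'[of t "t + 2"] by (simp add: algebra_simps)
  note mats = cycle_matrices_forward[of "\<lambda>t. D t (t + 2)", OF this]
    cycle_matrices_backward[of "\<lambda>t. D t (t + 2)", OF this] cycle_matrices_diag[of "\<lambda>t. D t (t + 2)", OF this]
  have anti'': "D i (j - int n) = - D i j" for i j using antiperiodic[of i "j - int n"] by simp
  from \<open>i \<noteq> j\<close> show ?thesis
  proof (cases rule: walk_cases[of i j a])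
    case (1 t)
    \<comment> \<open>Read forwards from column t, row t starts with 0, 1 and the negative of row t
      + 1 with 1, 0, modulo J.\<close>
    have "(refl_prod n \<rho> (cycle_matrices (\<lambda>t. D t (t + 2))) (obj (t + int 0)) (lab (t + int 0)) (lab (t + int (Suc 0))) + tau_power n) $ k $ l \<in> J"
    proof (rule walk_relation[OF J, where e = "\<lambda>s. D (t + int s) (t + int s + 2)"
          and Y = "\<lambda>s. D t (t + int s)" and Z = "\<lambda>s. - D (t + 1) (t + int s)"])
      fix s
      show "obj (t + int (Suc s)) = \<rho> (lab (t + int s)) (obj (t + int s))"
        using step[of "t + int s"] by (simp add: add_ac)
      show "lab (t + int (Suc s)) \<noteq> lab (t + int s)" using lab_alternates[of "t + int s"] by (simp add: add_ac)
      show "- cycle_matrices (\<lambda>t. D t (t + 2)) (obj (t + int s)) $ lab (t + int s) $ lab (t + int (Suc s)) =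
          D (t + int s) (t + int s + 2)"
        using mats(1)[of "t + int s"] by (simp add: add_ac)
      show "D t (t + int (Suc (Suc s))) -
          (D (t + int s) (t + int s + 2) * D t (t + int (Suc s)) - D t (t + int s)) \<in> J"
        using rec[of t "t + int s"] by (simp add: add_ac)
      show "- D (t + 1) (t + int (Suc (Suc s))) -
          (D (t + int s) (t + int s + 2) * (- D (t + 1) (t + int (Suc s))) - (- D (t + 1) (t + int s))) \<in> J"
        using J_uminus[OF rec[of "t + 1" "t + int s"]] by (simp add: add_ac algebra_simps)
      show "D t (t + int (s + n)) = - D t (t + int s)" using antiperiodic[of t "t + int s"] by (simp add: add_ac)
      show "- D (t + 1) (t + int (s + n)) = - (- D (t + 1) (t + int s))"
        using antiperiodic[of "t + 1" "t + int s"] by (simp add: add_ac)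
    qed (use mats(3) closed self J_zero succ[of t] swap[of "t + 1" t] in \<open>simp_all add: add_ac\<close>)
    then show ?thesis using 1 by simp
  next
    case (2 t)
    \<comment> \<open>Read backwards from column t + 1, row t starts with 1, 0 and the negative of
      row t + 1 with 0, 1, modulo J. The coefficients are now met in decreasing order, beginning
      with edge t - 1.\<close>
    have "(refl_prod n \<rho> (cycle_matrices (\<lambda>t. D t (t + 2))) (obj (t - int 0)) (lab (t - 1 - int 0)) (lab (t - 1 - int (Suc 0))) + tau_power n) $ k $ l \<in> J"
    proof (rule walk_relation[OF J, where e = "\<lambda>s. D (t - 1 - int s) (t - 1 - int s + 2)"
          and Y = "\<lambda>s. - D (t + 1) (t + 1 - int s)" and Z = "\<lambda>s. D t (t + 1 - int s)"])
      fix s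
      show "obj (t - int (Suc s)) = \<rho> (lab (t - 1 - int s)) (obj (t - int s))"
        using step_back[of "t - 1 - int s"] by (simp add: algebra_simps)
      show "lab (t - 1 - int (Suc s)) \<noteq> lab (t - 1 - int s)"
        using lab_alternates[of "t - 1 - int (Suc s)"] by (simp add: algebra_simps)
      have "lab (t - 1 - int (Suc s)) = lab (t - int s)"
        using lab_plus_two[of "t - 2 - int s"] by (simp add: algebra_simps)
      then show "- cycle_matrices (\<lambda>t. D t (t + 2)) (obj (t - int s)) $ lab (t - 1 - int s) $ lab (t - 1 - int (Suc s)) =
          D (t - 1 - int s) (t - 1 - int s + 2)"
        using mats(2)[of "t - int s"] by (simp add: algebra_simps)
      show "D t (t + 1 - int (Suc (Suc s))) -
          (D (t - 1 - int s) (t - 1 - int s + 2) * D t (t + 1 - int (Suc s)) - D t (t + 1 - int s)) \<in> J"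
        using rec[of t "t - 1 - int s"] by (simp add: algebra_simps)
      show "- D (t + 1) (t + 1 - int (Suc (Suc s))) -
          (D (t - 1 - int s) (t - 1 - int s + 2) * (- D (t + 1) (t + 1 - int (Suc s))) - (- D (t + 1) (t + 1 - int s))) \<in> J"
        using J_uminus[OF rec[of "t + 1" "t - 1 - int s"]] by (simp add: algebra_simps)
      show "D t (t + 1 - int (s + n)) = - D t (t + 1 - int s)"
        using anti''[of t "t + 1 - int s"] by (simp add: algebra_simps)
      show "- D (t + 1) (t + 1 - int (s + n)) = - (- D (t + 1) (t + 1 - int s))"
        using anti''[of "t + 1" "t + 1 - int s"] by (simp add: algebra_simps)
    qed (use mats(3) closed self J_zero succ[of t] swap[of "t + 1" t] in \<open>simp_all add: add_ac\<close>)
    then show ?thesis using 2 lab_plus_two[of "t - 2"] by simp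
  qed
qed

end

section \<open>Labels as determinants\<close>

definition segment_det :: "(nat \<Rightarrow> 'r::comm_ring_1) \<Rightarrow> (nat \<Rightarrow> 'r) \<Rightarrow> nat set \<Rightarrow> 'r" where
  "segment_det u v e = det2 u v (Min e) (Max e)"

lemma segment_det_less: "i < j \<Longrightarrow> segment_det u v {i, j} = det2 u v i j"
  by (simp add: segment_det_def)

text \<open>This is the shape of a flip. If i is the largest vertex, the Pluecker relation is
  applied to j, k, l, i, and the two products on the right change places.\<close>

lemma segment_det_plucker:
  assumes "i < j \<and> j < k \<and> k < l \<or> j < k \<and> k < l \<and> l < i"
  shows "segment_det u v {i, k} * segment_det u v {j, l} =
    segment_det u v {i, j} * segment_det u v {k, l} + segment_det u v {j, k} * segment_det u v {l, i}"
  using assms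
proof
  assume "i < j \<and> j < k \<and> k < l"
  then show ?thesis
    using det2_plucker[of u v i k j l] by (simp add: segment_det_less insert_commute[of l i])
next
  assume a: "j < k \<and> k < l \<and> l < i"
  then have "{i, k} = {k, i}" "{i, j} = {j, i}" by auto
  then show ?thesis using a det2_plucker[of u v j l k i] by (simp add: segment_det_less algebra_simps)
qed

lemma labelled_determinants_forward:
  assumes "labelled n d x q T L"
    and init: "\<And>k. k < n - 3 \<Longrightarrow> x k = segment_det u v (d k)"
      "\<And>k. k < n \<Longrightarrow> q k = segment_det u v (polygon_edge n k)"
    and nonzero: "\<And>T L e. labelled n d x q T L \<Longrightarrow> e \<in> T \<union> polygon_edges n \<Longrightarrow> L e \<noteq> 0"
  shows "e \<in> T \<union> polygon_edges n \<Longrightarrow> L e = segment_det u v e"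
  using assms(1)
proof (induction arbitrary: e)
  case (initial L)
  then show ?case using init by (auto simp: polygon_edges_def)
next
  case (flip T L i j k l y)
  have "L {i, k} * y = segment_det u v {i, k} * segment_det u v {j, l}"
    using flip.hyps(4,5) flip.IH segment_det_plucker[of i j k l u v] flip.hyps(2) by auto
  moreover have "L {i, k} \<noteq> 0" by (rule nonzero[OF flip.hyps(1)]) (use flip.hyps(3) in blast)
  moreover have "L {i, k} = segment_det u v {i, k}" using flip.IH flip.hyps(3) by blast
  ultimately have "y = segment_det u v {j, l}" by simp
  then show ?case using flip.prems flip.IH by auto
qed

text \<open>Vectors read off a fan are carried back along the flips to the initial triangulation.
  Undoing a flip means dividing by the new label, which again has to be nonzero.\<close>

lemma labelled_determinants_backward:
  assumes "labelled n d x q T L" "inner_triangles n (d ` {..<n - 3})" "3 \<le> n"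
    and nonzero: "\<And>T L e. labelled n d x q T L \<Longrightarrow> e \<in> T \<union> polygon_edges n \<Longrightarrow> L e \<noteq> 0"
    and "\<And>e. e \<in> T \<union> polygon_edges n \<Longrightarrow> L e = segment_det u v e"
  shows "(\<forall>k < n - 3. x k = segment_det u v (d k)) \<and> (\<forall>k < n. q k = segment_det u v (polygon_edge n k))"
  using assms(1,5)
proof induction
  case (initial L)
  then have "L (d k) = segment_det u v (d k)" if "k < n - 3" for k using that by blast
  moreover have "L (polygon_edge n k) = segment_det u v (polygon_edge n k)" if "k < n" for k
    using initial that by (auto simp: polygon_edges_def)
  ultimately show ?case using initial by metis
next
  case (flip T L i j k l y)
  let ?L = "L({j, l} := y)" and ?T = "insert {j, l} (T - {{i, k}})"
  have tri: "T \<subseteq> diagonals n" "noncrossing T"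
    using labelled_inner_triangles[OF flip.hyps(1) assms(2,3)] by (auto simp: inner_triangles_def)
  \<comment> \<open>The new diagonal crosses {i, k}, which belongs to T. Hence the update of L at
    {j, l} overwrites no label of T or of an edge.\<close>
  have "{j, l} \<notin> T \<union> polygon_edges n"
    using segments_noncrossing[OF tri(2,1) assms(3), of i k j l]
      segments_noncrossing[OF tri(2,1) assms(3), of j l k i] flip.hyps(2,3)
    by (auto simp: insert_commute)
  then have old: "L e = segment_det u v e" if "e \<in> T \<union> polygon_edges n" "e \<noteq> {i, k}" for e
  proof -
    have "e \<noteq> {j, l}" "e \<in> ?T \<union> polygon_edges n" using that \<open>{j, l} \<notin> T \<union> polygon_edges n\<close> by blast+
    then show ?thesis using flip.prems[of e] by simp
  qed
  have "labelled n d x q ?T ?L" by (rule labelled.flip[OF flip.hyps])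
  then have "?L {j, l} \<noteq> 0" by (rule nonzero) simp
  then have "y \<noteq> 0" by simp
  have y: "y = segment_det u v {j, l}" using flip.prems[of "{j, l}"] by simp
  have "{i, j} \<noteq> {i, k}" "{j, k} \<noteq> {i, k}" "{k, l} \<noteq> {i, k}" "{l, i} \<noteq> {i, k}"
    using flip.hyps(2) by (auto simp: doubleton_eq_iff)
  then have "L {i, j} = segment_det u v {i, j}" "L {j, k} = segment_det u v {j, k}"
    "L {k, l} = segment_det u v {k, l}" "L {l, i} = segment_det u v {l, i}"
    using flip.hyps(4) by (intro old; simp)+
  moreover have "i < j \<and> j < k \<and> k < l \<or> j < k \<and> k < l \<and> l < i" using flip.hyps(2) by auto
  ultimately have "L {i, k} * y = segment_det u v {i, k} * segment_det u v {j, l}"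
    using flip.hyps(5) segment_det_plucker[of i j k l u v] by simp
  then have "L {i, k} = segment_det u v {i, k}" using y \<open>y \<noteq> 0\<close> by simp
  then have "L e = segment_det u v e" if "e \<in> T \<union> polygon_edges n" for e using old that by blast
  then show ?case using flip.IH by blast
qed

text \<open>With w_0 = (1, 0), the second coordinate of w_j is forced to be the label of {0, j}. The
  first coordinate of w_1 is chosen to be 0, and the later ones are solved from det (w_j, w_(j+1)),
  which has to be the label of {j, j + 1}.\<close>

lemma fan_determinants:
  fixes L :: "nat set \<Rightarrow> 'f::field"
  assumes tri: "inner_triangles n T" and n: "3 \<le> n"
    and fan: "\<And>j. 0 < j \<Longrightarrow> j < n \<Longrightarrow> {0, j} \<in> T \<union> polygon_edges n"
    and nonzero: "\<And>e. e \<in> T \<union> polygon_edges n \<Longrightarrow> L e \<noteq> 0"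
  shows "\<exists>u v. \<forall>e \<in> T \<union> polygon_edges n. L e = segment_det u v e"
proof -
  define u where "u = rec_nat (1 :: 'f) (\<lambda>j b. if j = 0 then 0
      else (b * L {0, Suc j} - L {j, Suc j}) / L {0, j})"
  have u: "u 0 = 1" "u (Suc 0) = 0"
    "\<And>j. 0 < j \<Longrightarrow> u (Suc j) = (u j * L {0, Suc j} - L {j, Suc j}) / L {0, j}"
    by (simp_all add: u_def)
  define v where "v j = (if j = 0 then 0 else L {0, j})" for j
  have T: "T \<subseteq> diagonals n" "noncrossing T" using tri by (auto simp: inner_triangles_def)
  have "L e = segment_det u v e" if e: "e \<in> T \<union> polygon_edges n" for e
  proof -
    obtain i j where ij: "e = {i, j}" "i < j" "j < n" using segmentE[OF e T(1) n] .
    show ?thesis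
    proof (cases "i = 0")
      case True
      then show ?thesis using ij u by (simp add: segment_det_less det2_def v_def)
    next
      case False
      \<comment> \<open>Otherwise the segment {0, i + 1} of the fan would cross {i, j}.\<close>
      have "j = Suc i"
        using segments_noncrossing[OF T(2,1) n fan[of "Suc i"], of i j] e ij False by auto
      then show ?thesis using ij False u(3)[of i] nonzero[OF fan[of i]]
        by (simp add: segment_det_less det2_def v_def field_simps)
    qed
  qed
  then show ?thesis by blast
qed

section \<open>Specialization of fractions\<close>

abbreviation fr :: "'p::idom \<Rightarrow> 'p fract" where
  "fr s \<equiv> Fract s 1"

lemma unital_hom_fr: "unital_hom fr"
  by unfold_locales (simp_all add: One_fract_def)

lemma fr_eq_iff: "fr a = fr b \<longleftrightarrow> a = b"
  by (simp add: eq_fract)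

text \<open>\<open>z\<close> lies in the localization at the kernel of \<open>\<psi>\<close>, and \<open>p\<close> is its image under
  the extension of \<open>\<psi>\<close> to that localization.\<close>

definition specializes :: "('p::idom \<Rightarrow> 'q::idom) \<Rightarrow> 'p fract \<Rightarrow> 'q \<Rightarrow> bool" where
  "specializes \<psi> z p \<longleftrightarrow> (\<exists>g s. \<psi> s \<noteq> 0 \<and> z * fr s = fr g \<and> p * \<psi> s = \<psi> g)"

context
  fixes \<psi> :: "'p::idom \<Rightarrow> 'q::idom"
  assumes \<psi>: "unital_hom \<psi>"
begin

interpretation \<psi>: unital_hom \<psi> by (rule \<psi>)
interpretation fr: unital_hom "fr :: 'p \<Rightarrow> 'p fract" by (rule unital_hom_fr)

lemma specializes_fr: "specializes \<psi> (fr g) (\<psi> g)"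
  unfolding specializes_def by (intro exI[of _ g] exI[of _ 1]) (simp add: \<psi>.hom_one)

lemma specializes_add:
  assumes "specializes \<psi> z p" "specializes \<psi> z' p'"
  shows "specializes \<psi> (z + z') (p + p')"
proof -
  obtain g s g' s' where *: "\<psi> s \<noteq> 0" "z * fr s = fr g" "p * \<psi> s = \<psi> g"
    "\<psi> s' \<noteq> 0" "z' * fr s' = fr g'" "p' * \<psi> s' = \<psi> g'"
    using assms by (auto simp: specializes_def)
  have "(z + z') * fr (s * s') = (z * fr s) * fr s' + (z' * fr s') * fr s"
    unfolding fr.hom_mult by (simp add: algebra_simps)
  also have "\<dots> = fr (g * s' + g' * s)" by (simp only: * fr.hom_mult fr.hom_add)
  finally have "(z + z') * fr (s * s') = fr (g * s' + g' * s)" .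
  moreover have "(p + p') * \<psi> (s * s') = (p * \<psi> s) * \<psi> s' + (p' * \<psi> s') * \<psi> s"
    by (simp add: \<psi>.homs algebra_simps)
  then have "(p + p') * \<psi> (s * s') = \<psi> (g * s' + g' * s)" by (simp only: * \<psi>.homs)
  ultimately show ?thesis unfolding specializes_def using *(1,4)
    by (intro exI[of _ "g * s' + g' * s"] exI[of _ "s * s'"]) (simp add: \<psi>.hom_mult)
qed

lemma specializes_mult:
  assumes "specializes \<psi> z p" "specializes \<psi> z' p'"
  shows "specializes \<psi> (z * z') (p * p')"
proof -
  obtain g s g' s' where *: "\<psi> s \<noteq> 0" "z * fr s = fr g" "p * \<psi> s = \<psi> g"
    "\<psi> s' \<noteq> 0" "z' * fr s' = fr g'" "p' * \<psi> s' = \<psi> g'"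
    using assms by (auto simp: specializes_def)
  have "z * z' * fr (s * s') = (z * fr s) * (z' * fr s')"
    unfolding fr.hom_mult by (simp add: algebra_simps)
  then have "z * z' * fr (s * s') = fr (g * g')" by (simp only: * fr.hom_mult)
  moreover have "p * p' * \<psi> (s * s') = (p * \<psi> s) * (p' * \<psi> s')"
    by (simp add: \<psi>.homs algebra_simps)
  then have "p * p' * \<psi> (s * s') = \<psi> (g * g')" by (simp only: * \<psi>.homs)
  ultimately show ?thesis unfolding specializes_def using *(1,4)
    by (intro exI[of _ "g * g'"] exI[of _ "s * s'"]) (simp add: \<psi>.hom_mult)
qed

lemma specializes_uminus: "specializes \<psi> z p \<Longrightarrow> specializes \<psi> (- z) (- p)"
proof -
  have "fr (- 1) = (- 1 :: 'p fract)" "\<psi> (- 1) = - 1"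
    by (simp_all only: fr.hom_uminus fr.hom_one \<psi>.hom_uminus \<psi>.hom_one)
  then show "specializes \<psi> z p \<Longrightarrow> specializes \<psi> (- z) (- p)"
    using specializes_mult[OF specializes_fr[of "- 1"], of z p] by (simp only: mult_minus1)
qed

text \<open>Cross multiplication, followed by cancellation in the target, which is a domain. This
  allows a relation to take the place of a homomorphism.\<close>

lemma specializes_unique:
  assumes "specializes \<psi> z p" "specializes \<psi> z p'"
  shows "p = p'"
proof -
  obtain g s g' s' where *: "\<psi> s \<noteq> 0" "z * fr s = fr g" "p * \<psi> s = \<psi> g"
    "\<psi> s' \<noteq> 0" "z * fr s' = fr g'" "p' * \<psi> s' = \<psi> g'"
    using assms by (auto simp: specializes_def)
  have "(z * fr s) * fr s' = (z * fr s') * fr s" by (simp only: mult_ac)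
  then have "fr (g * s') = fr (g' * s)" by (simp only: * fr.hom_mult)
  then have "\<psi> (g * s') = \<psi> (g' * s)" by (simp only: fr_eq_iff)
  then have "p * \<psi> s * \<psi> s' = p' * \<psi> s' * \<psi> s" by (simp only: * \<psi>.hom_mult)
  then have "p * (\<psi> s * \<psi> s') = p' * (\<psi> s * \<psi> s')" by (simp only: mult_ac)
  then show ?thesis using *(1,4) by simp
qed

lemma specializes_zero: "specializes \<psi> 0 p \<Longrightarrow> p = 0"
  using specializes_unique[of 0 p 0] specializes_fr[of 0] by (simp only: \<psi>.hom_zero fr.hom_zero)

text \<open>The step used for flips: the value p of z is nonzero, so \<psi> does not annihilate the
  numerator g of z, and g may become part of the denominator of y.\<close>

lemma specializes_divide:
  assumes "specializes \<psi> z p" "specializes \<psi> z' p'" "z * y = z'" "p * r = p'" "p \<noteq> 0"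
  shows "specializes \<psi> y r"
proof -
  obtain g s g' s' where *: "\<psi> s \<noteq> 0" "z * fr s = fr g" "p * \<psi> s = \<psi> g"
    "\<psi> s' \<noteq> 0" "z' * fr s' = fr g'" "p' * \<psi> s' = \<psi> g'"
    using assms by (auto simp: specializes_def)
  have "y * fr (g * s') = y * (z * fr s) * fr s'" by (simp only: * fr.hom_mult mult_ac)
  also have "\<dots> = z' * fr s' * fr s" by (simp only: mult_ac flip: assms(3))
  also have "\<dots> = fr (g' * s)" by (simp only: * fr.hom_mult)
  finally have "y * fr (g * s') = fr (g' * s)" .
  moreover have "r * \<psi> (g * s') = p * r * \<psi> s' * \<psi> s"
    unfolding \<psi>.hom_mult *(3)[symmetric] by (simp only: mult_ac)
  then have "r * \<psi> (g * s') = \<psi> (g' * s)" by (simp only: assms(4) * \<psi>.hom_mult)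
  moreover have "\<psi> (g * s') \<noteq> 0" unfolding \<psi>.hom_mult *(3)[symmetric] using *(1,4) assms(5) by simp
  ultimately show ?thesis unfolding specializes_def by blast
qed

end

section \<open>Continuants as values of labels\<close>

abbreviation segment_continuant :: "nat set \<Rightarrow> (nat, 'k::comm_ring_1) mpoly" where
  "segment_continuant \<equiv> segment_det (lin_rec mpoly_var 1 0) (lin_rec mpoly_var 0 1)"

lemma segment_continuant_less: "i < j \<Longrightarrow> segment_continuant {i, j} = continuant mpoly_var i j"
  by (simp add: segment_det_less continuant_def)

lemma continuant_nonzero:
  assumes "i < j"
  shows "(continuant mpoly_var i j :: (nat, 'k::idom) mpoly) \<noteq> 0"
proof -
  have id: "unital_hom (\<lambda>c. c :: 'k)" by unfold_locales simp_all
  interpret unital_hom "mpoly_hom (\<lambda>c. c :: 'k) (\<lambda>s. if s = i then 1 else 2)"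
    by (rule unital_hom_mpoly_hom[OF id])
  show ?thesis
    using hom_continuant[of mpoly_var i j] continuant_one_two[OF assms, where 'r='k] hom_zero
    by (auto simp: mpoly_hom_var[OF id])
qed

lemma segment_continuant_nonzero:
  assumes "i \<noteq> j"
  shows "(segment_continuant {i, j} :: (nat, 'k::idom) mpoly) \<noteq> 0"
  using assms
proof (cases i j rule: linorder_cases)
  case less
  then show ?thesis by (simp add: segment_continuant_less continuant_nonzero)
next
  case greater
  then show ?thesis by (simp add: insert_commute[of i] segment_continuant_less continuant_nonzero)
qed simp

text \<open>Variables with even and odd numbers are those of \<open>cluster_var\<close> and
  \<open>edge_var\<close>. The edges between k and k + 1 are sent to 1, but the closing edge is sent
  to the continuant from 0 to n - 1, which is corrected only modulo the groupoid equations.\<close>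

definition label_specialization :: "nat \<Rightarrow> (nat \<Rightarrow> nat set) \<Rightarrow> (nat, 'k::idom) mpoly \<Rightarrow> (nat, 'k) mpoly" where
  "label_specialization n d = mpoly_hom mpoly_const
     (\<lambda>m. segment_continuant (if even m then d (m div 2) else polygon_edge n (m div 2)))"

lemma unital_hom_label_specialization: "unital_hom (label_specialization n d)"
  unfolding label_specialization_def by (rule unital_hom_mpoly_hom[OF unital_hom_mpoly_const])

lemma label_specialization_var:
  "label_specialization n d (mpoly_var (2 * k)) = segment_continuant (d k)"
  "label_specialization n d (mpoly_var (2 * k + 1)) = segment_continuant (polygon_edge n k)"
  by (simp_all add: label_specialization_def mpoly_hom_var[OF unital_hom_mpoly_const])

lemma label_specialization_const: "label_specialization n d (mpoly_const c) = mpoly_const c"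
  by (simp add: label_specialization_def mpoly_hom_const[OF unital_hom_mpoly_const])

text \<open>Continuants obey the flip relation, and those of distinct vertices are nonzero, so every
  flip satisfies \<open>specializes_divide\<close>. Only the values need to be nonzero for this;
  that the labels are nonzero as well is a consequence.\<close>

lemma labelled_specializes:
  assumes "labelled n d cluster_var edge_var T L" "inner_triangles n (d ` {..<n - 3})" "3 \<le> n"
    "e \<in> T \<union> polygon_edges n"
  shows "specializes (label_specialization n d) (L e :: 'k::idom ratfun) (segment_continuant e)"
  using assms(1,4)
proof (induction arbitrary: e)
  case (initial L)
  note sp = specializes_fr[OF unital_hom_label_specialization, of n d]
  from initial(3) consider k where "k < n - 3" "e = d k" | k where "k < n" "e = polygon_edge n k"
    by (auto simp: polygon_edges_def)
  then show ?case
  proof cases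
    case (1 k)
    then show ?thesis
      using initial(1)[of k] sp[of "mpoly_var (2 * k)"] unfolding label_specialization_var cluster_var_def by simp
  next
    case (2 k)
    then show ?thesis
      using initial(2)[of k] sp[of "mpoly_var (2 * k + 1)"] unfolding label_specialization_var edge_var_def by simp
  qed
next
  case (flip T L i j k l y)
  note hom = unital_hom_label_specialization[of n d]
  have nz: "(segment_continuant {i, k} :: (nat, 'k) mpoly) \<noteq> 0"
    using flip.hyps(2) by (intro segment_continuant_nonzero) auto
  have y: "specializes (label_specialization n d) y (segment_continuant {j, l})"
  proof (rule specializes_divide[OF hom _ _ flip.hyps(5)])
    show "specializes (label_specialization n d) (L {i, k}) (segment_continuant {i, k})"
      using flip.IH flip.hyps(3) by blast
    show "specializes (label_specialization n d) (L {i, j} * L {k, l} + L {j, k} * L {l, i})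
      (segment_continuant {i, j} * segment_continuant {k, l} + segment_continuant {j, k} * segment_continuant {l, i})"
      using flip.hyps(4) flip.IH by (intro specializes_add[OF hom] specializes_mult[OF hom]) auto
    show "segment_continuant {i, k} * segment_continuant {j, l} =
      segment_continuant {i, j} * segment_continuant {k, l} + segment_continuant {j, k} * segment_continuant {l, i}"
      using flip.hyps(2) by (intro segment_det_plucker) auto
  qed (rule nz)
  show ?case
  proof (cases "e = {j, l}")
    case True
    then show ?thesis using y by simp
  next
    case False
    then show ?thesis using flip.prems flip.IH[of e] by auto
  qed
qed

text \<open>A vanishing label would force its value, a continuant, to vanish; so all flips can be
  carried out. Vectors are then read off a fan, shown to fit the initial labels by going backwards,
  and hence all labels by going forwards.\<close>

lemma labels_determinants:
  assumes tri: "inner_triangles n (d ` {..<n - 3})" and n: "3 \<le> n" and inj: "inj_on d {..<n - 3}"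
  obtains u v :: "nat \<Rightarrow> 'k::idom ratfun" where
    "labels n d cluster_var edge_var = {det2 u v i j | i j. i < j \<and> j < n}"
    "\<And>k. k < n \<Longrightarrow> edge_var k = segment_det u v (polygon_edge n k)"
    "\<And>i j. i < j \<Longrightarrow> j < n \<Longrightarrow> specializes (label_specialization n d) (det2 u v i j) (continuant mpoly_var i j)"
proof -
  let ?lab = "labelled n d cluster_var edge_var :: nat set set \<Rightarrow> (nat set \<Rightarrow> 'k ratfun) \<Rightarrow> bool"
  note hom = unital_hom_label_specialization[of n d]
  have nonzero: "L e \<noteq> 0" if L: "?lab T L" and e: "e \<in> T \<union> polygon_edges n" for T L e
  proof
    assume "L e = 0"
    then have 0: "(segment_continuant e :: (nat, 'k) mpoly) = 0"
      using specializes_zero[OF hom] labelled_specializes[OF L tri n e] by simp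
    have "T \<subseteq> diagonals n" using labelled_inner_triangles[OF L tri n] by (simp add: inner_triangles_def)
    then obtain i j where "e = {i, j}" "i < j" using segmentE[OF e _ n] by metis
    then show False using 0 segment_continuant_nonzero[of i j, where 'k='k] by simp
  qed
  have "\<exists>L. ?lab (d ` {..<n - 3}) L"
  proof
    \<comment> \<open>A single function can carry all initial labels because diagonals are not edges
      and both numberings are injective.\<close>
    let ?L = "\<lambda>e. if e \<in> polygon_edges n then edge_var (inv_into {..<n} (polygon_edge n) e)
      else cluster_var (inv_into {..<n - 3} d e) :: 'k ratfun"
    have "inj_on (polygon_edge n) {..<n}"
    proof (rule inj_onI)
      fix k l assume kl: "k \<in> {..<n}" "l \<in> {..<n}" "polygon_edge n k = polygon_edge n l"
      then show "k = l"
        using n by (cases "Suc k = n"; cases "Suc l = n") (auto simp: polygon_edge_def doubleton_eq_iff)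
    qed
    moreover have "d k \<notin> polygon_edges n" if "k < n - 3" for k
      using tri that by (auto simp: inner_triangles_def diagonals_def)
    ultimately show "?lab (d ` {..<n - 3}) ?L"
      using inj by (intro labelled.initial) (auto simp: polygon_edges_def)
  qed
  then obtain L0 where L0: "?lab (d ` {..<n - 3}) L0" by blast
  have "\<exists>T L. ?lab T L \<and> (\<forall>j. 0 < j \<and> j < n \<longrightarrow> {0, j} \<in> T \<union> polygon_edges n)"
    by (rule labelled_fan[OF n tri _ L0]) (rule nonzero)
  then obtain T L where L: "?lab T L" and fan: "\<And>j. 0 < j \<Longrightarrow> j < n \<Longrightarrow> {0, j} \<in> T \<union> polygon_edges n"
    by blast
  have "\<exists>u v. \<forall>e \<in> T \<union> polygon_edges n. L e = segment_det u v e"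
    by (rule fan_determinants[OF labelled_inner_triangles[OF L tri n] n fan nonzero[OF L]])
  then obtain u v where uv: "\<And>e. e \<in> T \<union> polygon_edges n \<Longrightarrow> L e = segment_det u v e" by blast
  have "(\<forall>k < n - 3. cluster_var k = segment_det u v (d k)) \<and>
      (\<forall>k < n. edge_var k = segment_det u v (polygon_edge n k))"
    by (rule labelled_determinants_backward[OF L tri n _ uv]) (rule nonzero)
  then have init: "\<And>k. k < n - 3 \<Longrightarrow> cluster_var k = segment_det u v (d k)"
    and edges: "\<And>k. k < n \<Longrightarrow> edge_var k = segment_det u v (polygon_edge n k)" by blast+
  have all: "L e = segment_det u v e" if "?lab T L" "e \<in> T \<union> polygon_edges n" for T L e
    by (rule labelled_determinants_forward[OF that(1) _ _ _ that(2)], erule init, erule edges) (rule nonzero)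
  have seg: "\<exists>T L. ?lab T L \<and> {i, j} \<in> T \<union> polygon_edges n \<and> L {i, j} = det2 u v i j"
    if ij: "i < j" "j < n" for i j
  proof -
    have "\<exists>T L. ?lab T L \<and> {i, j} \<in> T \<union> polygon_edges n"
      by (rule labelled_segment[OF n tri _ L0 ij]) (rule nonzero)
    then show ?thesis using all segment_det_less[OF ij(1)] by metis
  qed
  have lab: "labels n d cluster_var edge_var = {det2 u v i j | i j. i < j \<and> j < n}"
  proof (intro equalityI subsetI)
    fix z assume "z \<in> (labels n d cluster_var edge_var :: 'k ratfun set)"
    then obtain T L e where z: "?lab T L" "e \<in> T \<union> polygon_edges n" "z = L e"
      unfolding labels_def by blast
    have "T \<subseteq> diagonals n" using labelled_inner_triangles[OF z(1) tri n] by (simp add: inner_triangles_def)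
    then obtain i j where "e = {i, j}" "i < j" "j < n" using segmentE[OF z(2) _ n] by metis
    then have "z = det2 u v i j" "i < j" "j < n" using all[OF z(1,2)] z(3) by (simp_all add: segment_det_less)
    then show "z \<in> {det2 u v i j | i j. i < j \<and> j < n}" by blast
  next
    fix z assume "z \<in> {det2 u v i j | i j. i < j \<and> j < n}"
    then obtain i j where ij: "z = det2 u v i j" "i < j" "j < n" by blast
    obtain T L where "?lab T L" "{i, j} \<in> T \<union> polygon_edges n" "L {i, j} = det2 u v i j"
      using seg[OF ij(2,3)] by blast
    then show "z \<in> labels n d cluster_var edge_var"
      unfolding labels_def ij(1) by (metis (mono_tags, lifting) mem_Collect_eq)
  qed
  have sp: "specializes (label_specialization n d) (det2 u v i j) (continuant mpoly_var i j)"
    if ij: "i < j" "j < n" for i j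
  proof -
    obtain T L where "?lab T L" "{i, j} \<in> T \<union> polygon_edges n" "L {i, j} = det2 u v i j"
      using seg[OF ij] by blast
    then show ?thesis using labelled_specializes[of n d T L "{i, j}", OF _ tri n] by (simp add: segment_continuant_less[OF ij(1)])
  qed
  show ?thesis by (rule that[OF lab edges sp])
qed

section \<open>Subrings of a commutative ring given by a type\<close>

definition type_subring :: "'r::comm_ring_1 set \<Rightarrow> 'r ring" where
  "type_subring A = ring_of_type_algebra\<lparr>carrier := A\<rparr>"

lemma type_subring_simps:
  "carrier (type_subring A) = A" "x \<otimes>\<^bsub>type_subring A\<^esub> y = x * y" "x \<oplus>\<^bsub>type_subring A\<^esub> y = x + y"
  "\<one>\<^bsub>type_subring A\<^esub> = 1" "\<zero>\<^bsub>type_subring A\<^esub> = 0"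
  by (simp_all add: type_subring_def ring_of_type_algebra_def)

lemma type_subring_UNIV: "type_subring UNIV = ring_of_type_algebra"
  by (simp add: type_subring_def ring_of_type_algebra_def)

lemma type_subring_cring:
  assumes "1 \<in> A" "\<And>a. a \<in> A \<Longrightarrow> - a \<in> A" "\<And>a b. a \<in> A \<Longrightarrow> b \<in> A \<Longrightarrow> a + b \<in> A"
    "\<And>a b. a \<in> A \<Longrightarrow> b \<in> A \<Longrightarrow> a * b \<in> A"
  shows "cring (type_subring A)"
proof -
  have "0 \<in> A" using assms(3)[OF assms(1) assms(2)[OF assms(1)]] by simp
  then show ?thesis
    using assms
    by (intro cringI abelian_groupI comm_monoidI)
      (auto simp: type_subring_simps algebra_simps intro: bexI[of _ "- x" for x])
qed

lemma type_subring_uminus: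
  assumes "cring (type_subring A)" "a \<in> A"
  shows "\<ominus>\<^bsub>type_subring A\<^esub> a = - a" "- a \<in> A"
proof -
  interpret cring "type_subring A" by (rule assms)
  have "\<ominus>\<^bsub>type_subring A\<^esub> a + a = 0"
    using l_neg[of a] assms(2) by (simp add: type_subring_simps)
  then show *: "\<ominus>\<^bsub>type_subring A\<^esub> a = - a" by (simp add: eq_neg_iff_add_eq_0)
  then show "- a \<in> A" using a_inv_closed[of a] assms(2) by (simp add: type_subring_simps)
qed

lemma subring_ideal_iff:
  assumes "cring (type_subring A)"
  shows "ideal J (type_subring A) \<longleftrightarrow> subring_ideal A J"
proof
  interpret cring "type_subring A" by (rule assms)
  {
    assume "ideal J (type_subring A)"
    then interpret J: ideal J "type_subring A" .
    show "subring_ideal A J"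
      using one_closed m_closed a_closed type_subring_uminus[OF assms] J.a_subset J.zero_closed
        J.a_closed J.I_l_closed
      by unfold_locales (auto simp: type_subring_simps)
  next
    assume "subring_ideal A J"
    then interpret J: subring_ideal A J .
    show "ideal J (type_subring A)"
    proof (rule idealI)
      show "subgroup J (add_monoid (type_subring A))"
      proof (rule add.subgroupI)
        show "J \<subseteq> carrier (type_subring A)" using J.J_subset by (simp add: type_subring_simps)
        show "J \<noteq> {}" using J.J_zero by blast
        show "\<And>a. a \<in> J \<Longrightarrow> \<ominus>\<^bsub>type_subring A\<^esub> a \<in> J"
          using type_subring_uminus[OF assms] J.J_subset J.J_uminus by auto
        show "\<And>a b. a \<in> J \<Longrightarrow> b \<in> J \<Longrightarrow> a \<oplus>\<^bsub>type_subring A\<^esub> b \<in> J"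
          using J.J_add by (simp add: type_subring_simps)
      qed
      show "x \<otimes>\<^bsub>type_subring A\<^esub> a \<in> J" "a \<otimes>\<^bsub>type_subring A\<^esub> x \<in> J"
        if "a \<in> J" "x \<in> carrier (type_subring A)" for a x
        using J.J_mult[of x a] that by (simp_all add: type_subring_simps mult.commute)
    qed (rule ring_axioms)
  }
qed

lemma genideal_subring_ideal:
  assumes "cring (type_subring A)" "S \<subseteq> A"
  shows "subring_ideal A (genideal (type_subring A) S)" "S \<subseteq> genideal (type_subring A) S"
    and "subring_ideal A J \<Longrightarrow> S \<subseteq> J \<Longrightarrow> genideal (type_subring A) S \<subseteq> J"
proof -
  interpret cring "type_subring A" by (rule assms)
  have S: "S \<subseteq> carrier (type_subring A)" using assms(2) by (simp add: type_subring_simps)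
  show "subring_ideal A (genideal (type_subring A) S)" "S \<subseteq> genideal (type_subring A) S"
    using genideal_ideal[OF S] genideal_self[OF S] subring_ideal_iff[OF assms(1)] by auto
  show "subring_ideal A J \<Longrightarrow> S \<subseteq> J \<Longrightarrow> genideal (type_subring A) S \<subseteq> J"
    using genideal_minimal subring_ideal_iff[OF assms(1)] by blast
qed

lemma type_coset: "J +>\<^bsub>type_subring A\<^esub> x = (\<lambda>j. j + x) ` J"
  by (auto simp: a_r_coset_def' type_subring_simps)

lemma (in subring_ideal) coset_eq:
  assumes "x - y \<in> J"
  shows "J +>\<^bsub>type_subring A\<^esub> x = J +>\<^bsub>type_subring A\<^esub> y"
proof -
  have "(\<lambda>j. j + x) ` J \<subseteq> (\<lambda>j. j + y) ` J" if "x - y \<in> J" for x y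
  proof
    fix z assume "z \<in> (\<lambda>j. j + x) ` J"
    then obtain j where "j \<in> J" "z = j + x" by blast
    then have "j + (x - y) \<in> J" "z = (j + (x - y)) + y" using J_add[OF _ that] by simp_all
    then show "z \<in> (\<lambda>j. j + y) ` J" by blast
  qed
  then show ?thesis using assms J_uminus[OF assms] unfolding type_coset by (intro equalityI) auto
qed

text \<open>The first isomorphism theorem for \<alpha> followed by reduction modulo J. Both the
  image and the kernel of \<alpha> matter only modulo J.\<close>

lemma quotient_cring_iso:
  fixes \<alpha> :: "'r::comm_ring_1 \<Rightarrow> 's::comm_ring_1"
  assumes A: "cring (type_subring A)" and J: "subring_ideal A J" and I: "subring_ideal UNIV I"
    and \<alpha>: "unital_hom \<alpha>" "\<And>f. \<alpha> f \<in> A"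
    and ker: "\<And>f. \<alpha> f \<in> J \<longleftrightarrow> f \<in> I" and surj: "\<And>z. z \<in> A \<Longrightarrow> \<exists>f. z - \<alpha> f \<in> J"
  obtains f g where "cring_iso (type_subring UNIV Quot I) (type_subring A Quot J) f g"
    and "\<And>c. f (I +>\<^bsub>type_subring UNIV\<^esub> c) = J +>\<^bsub>type_subring A\<^esub> \<alpha> c"
proof -
  interpret unital_hom \<alpha> by (rule \<alpha>)
  have U: "cring (type_subring (UNIV :: 'r set))" by (rule type_subring_cring) simp_all
  interpret R: cring "type_subring (UNIV :: 'r set)" by (rule U)
  interpret A: cring "type_subring A" by (rule A)
  interpret J: ideal J "type_subring A" using J subring_ideal_iff[OF A] by simp
  interpret J': subring_ideal A J by (rule J)
  interpret I: ideal I "type_subring UNIV" using I subring_ideal_iff[OF U] by simp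
  let ?Q = "type_subring A Quot J"
  interpret Q: cring ?Q by (rule J.quotient_is_cring[OF A])
  define h where "h f = J +>\<^bsub>type_subring A\<^esub> \<alpha> f" for f
  have "\<alpha> \<in> ring_hom (type_subring UNIV) (type_subring A)"
    by (rule ring_hom_memI) (simp_all add: type_subring_simps \<alpha> homs)
  then have h: "h \<in> ring_hom (type_subring UNIV) ?Q"
    using ring_hom_trans[OF _ J.rcos_ring_hom] by (auto simp: h_def[abs_def] comp_def)
  interpret h: ring_hom_ring "type_subring UNIV" ?Q h
    by (rule ring_hom_ringI2) (rule R.ring_axioms, rule Q.ring_axioms, rule h)
  have zero: "h f = \<zero>\<^bsub>?Q\<^esub> \<longleftrightarrow> f \<in> I" for f
  proof -
    have "h f = J \<longleftrightarrow> \<alpha> f \<in> J"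
      using A.a_rcos_zero[OF J.ideal_axioms] J.rcos_const_imp_mem \<alpha>(2)[of f]
      by (auto simp: h_def type_subring_simps)
    then show ?thesis using ker by (simp add: FactRing_def)
  qed
  have kernel: "a_kernel (type_subring UNIV) ?Q h = I"
    unfolding a_kernel_def' type_subring_simps(1) zero by blast
  have "h ` carrier (type_subring UNIV) = carrier ?Q"
  proof
    show "h ` carrier (type_subring UNIV) \<subseteq> carrier ?Q" using h.hom_closed by blast
    show "carrier ?Q \<subseteq> h ` carrier (type_subring UNIV)"
    proof
      fix z assume "z \<in> carrier ?Q"
      then obtain x where x: "x \<in> A" "z = J +>\<^bsub>type_subring A\<^esub> x"
        by (auto simp: FactRing_def A_RCOSETS_def' type_subring_simps)
      obtain f where "x - \<alpha> f \<in> J" using surj[OF x(1)] by blast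
      then have "z = h f" unfolding h_def x(2) by (rule J'.coset_eq)
      then show "z \<in> h ` carrier (type_subring UNIV)" by (simp add: type_subring_simps)
    qed
  qed
  from h.FactRing_iso_set[OF this]
  have iso: "(\<lambda>Y. the_elem (h ` Y)) \<in> ring_iso (type_subring UNIV Quot I) ?Q" by (simp add: kernel)
  let ?f = "\<lambda>Y. the_elem (h ` Y)" and ?R = "type_subring UNIV Quot I"
  interpret RQ: cring ?R by (rule I.quotient_is_cring[OF U])
  have bij: "bij_betw ?f (carrier ?R) (carrier ?Q)" using iso by (simp add: ring_iso_def)
  have "cring_iso ?R ?Q ?f (inv_into (carrier ?R) ?f)"
  proof
    show "?f \<in> ring_hom ?R ?Q" using iso by (simp add: ring_iso_def)
    show "inv_into (carrier ?R) ?f \<in> ring_hom ?Q ?R"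
      using ring_iso_set_sym[OF RQ.ring_axioms iso] by (simp add: ring_iso_def)
  qed (rule bij_betw_inv_into_left[OF bij], assumption, rule bij_betw_inv_into_right[OF bij], assumption)
  moreover have "?f (I +>\<^bsub>type_subring UNIV\<^esub> c) = J +>\<^bsub>type_subring A\<^esub> \<alpha> c" for c
  proof -
    have "h (i + c) = h c" if "i \<in> I" for i
      unfolding h_def by (rule J'.coset_eq) (use that ker in \<open>simp add: homs\<close>)
    then have "h ` (I +>\<^bsub>type_subring UNIV\<^esub> c) = {h c}"
      unfolding type_coset using I.zero_closed by (auto simp: image_iff type_subring_simps)
    then show ?thesis by (simp add: h_def)
  qed
  ultimately show ?thesis by (rule that)
qed

section \<open>The coordinate ring and the specialized cluster algebra\<close>

lemma unital_hom_ratfun_const: "unital_hom ratfun_const"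
proof -
  interpret c: unital_hom "mpoly_const :: 'a \<Rightarrow> (nat, 'a) mpoly" by (rule unital_hom_mpoly_const)
  interpret fr: unital_hom "fr :: (nat, 'a) mpoly \<Rightarrow> _" by (rule unital_hom_fr)
  show ?thesis
    by unfold_locales (simp_all only: ratfun_const_def c.homs fr.homs)
qed

text \<open>Products of reflections are polynomial in the entries, so any evaluation of the generic
  relation is the relation for the evaluated matrices. It is applied to points, to \<alpha> and to
  \<theta>.\<close>

lemma mpoly_hom_relation:
  fixes C :: "'a \<Rightarrow> 'r::comm_ring_1 ^ 'i::finite ^ 'i"
  assumes \<kappa>: "unital_hom \<kappa>"
  shows "mpoly_hom \<kappa> (\<lambda>(a, j, k). C a $ j $ k) ((refl_prod m \<rho> generic_matrices a i j + tau_power m) $ k $ l) =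
    (refl_prod m \<rho> C a i j + tau_power m) $ k $ l"
proof -
  let ?x = "\<lambda>(a, j, k). C a $ j $ k"
  interpret unital_hom "mpoly_hom \<kappa> ?x" by (rule unital_hom_mpoly_hom[OF \<kappa>])
  have "(\<lambda>a. \<chi> j k. mpoly_hom \<kappa> ?x (generic_matrices a $ j $ k)) = C"
    by (simp add: fun_eq_iff vec_eq_iff generic_matrices_def mpoly_hom_var[OF \<kappa>])
  then show ?thesis
    using hom_refl_prod[of m \<rho> generic_matrices a i j k l] hom_tau_power[of m k l]
    by (simp add: hom_add)
qed

lemma subring_ideal_vimage:
  assumes "unital_hom h" "subring_ideal A J" "\<And>f. h f \<in> A"
  shows "subring_ideal UNIV {f. h f \<in> J}"
proof -
  interpret h: unital_hom h by (rule assms)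
  interpret J: subring_ideal A J by (rule assms)
  show ?thesis
    by unfold_locales (auto simp: h.homs J.J_zero J.J_add J.J_mult assms(3))
qed

text \<open>The three assumptions are what \<open>labels_determinants\<close> delivers. Flips and
  triangulations enter from here on only through them.\<close>

locale frieze_setup = object_cycle \<rho> n obj lab
  for \<rho> :: "'i::finite \<Rightarrow> 'a \<Rightarrow> 'a" and n obj lab +
  fixes d :: "nat \<Rightarrow> nat set" and u v :: "nat \<Rightarrow> 'k::idom ratfun"
  assumes labels: "labels n d cluster_var edge_var = {det2 u v i j | i j. i < j \<and> j < n}"
    and edges: "\<And>k. k < n \<Longrightarrow> edge_var k = segment_det u v (polygon_edge n k)"
    and specialization: "\<And>i j. i < j \<Longrightarrow> j < n \<Longrightarrow>
      specializes (label_specialization n d) (det2 u v i j) (continuant mpoly_var i j)"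
begin

definition A :: "'k ratfun set" where
  "A = generate_ring ring_of_type_algebra (range ratfun_const \<union> labels n d cluster_var edge_var)"

definition J :: "'k ratfun set" where
  "J = specialization_ideal n d"

definition I :: "('a \<times> 'i \<times> 'i, 'k) mpoly set" where
  "I = equation_ideal (groupoid_equations \<rho>)"

lemma A_closed:
  "1 \<in> A" "a \<in> A \<Longrightarrow> - a \<in> A" "a \<in> A \<Longrightarrow> b \<in> A \<Longrightarrow> a + b \<in> A" "a \<in> A \<Longrightarrow> b \<in> A \<Longrightarrow> a * b \<in> A"
  and A_const: "ratfun_const c \<in> A" and A_label: "i < j \<Longrightarrow> j < n \<Longrightarrow> det2 u v i j \<in> A"
proof -
  let ?H = "range ratfun_const \<union> labels n d cluster_var edge_var :: 'k ratfun set"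
  have A: "A = generate_ring (type_subring UNIV) ?H" by (simp add: A_def type_subring_UNIV)
  have U: "cring (type_subring (UNIV :: 'k ratfun set))" by (rule type_subring_cring) simp_all
  show "1 \<in> A" using generate_ring.one[of "type_subring UNIV" ?H] unfolding A by (simp add: type_subring_simps)
  show "- a \<in> A" if "a \<in> A" for a
    using generate_ring.a_inv[of a "type_subring UNIV" ?H] that type_subring_uminus[OF U] unfolding A by simp
  show "a + b \<in> A" if "a \<in> A" "b \<in> A" for a b
    using generate_ring.eng_add[of a "type_subring UNIV" ?H b] that unfolding A by (simp add: type_subring_simps)
  show "a * b \<in> A" if "a \<in> A" "b \<in> A" for a b
    using generate_ring.eng_mult[of a "type_subring UNIV" ?H b] that unfolding A by (simp add: type_subring_simps)
  show "ratfun_const c \<in> A" unfolding A by (rule generate_ring.incl) simp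
  show "det2 u v i j \<in> A" if "i < j" "j < n"
    unfolding A by (rule generate_ring.incl) (use that labels in blast)
qed

lemma A_induct [consumes 1, case_names const label uminus add mult]:
  assumes "z \<in> A" and const: "\<And>c. P (ratfun_const c)"
    and label: "\<And>i j. i < j \<Longrightarrow> j < n \<Longrightarrow> P (det2 u v i j)"
    and uminus: "\<And>z. z \<in> A \<Longrightarrow> P z \<Longrightarrow> P (- z)"
    and add: "\<And>z z'. z \<in> A \<Longrightarrow> z' \<in> A \<Longrightarrow> P z \<Longrightarrow> P z' \<Longrightarrow> P (z + z')"
    and mult: "\<And>z z'. z \<in> A \<Longrightarrow> z' \<in> A \<Longrightarrow> P z \<Longrightarrow> P z' \<Longrightarrow> P (z * z')"
  shows "P z"
proof -
  let ?H = "range ratfun_const \<union> labels n d cluster_var edge_var :: 'k ratfun set"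
  have A: "A = generate_ring (type_subring UNIV) ?H" by (simp add: A_def type_subring_UNIV)
  have U: "cring (type_subring (UNIV :: 'k ratfun set))" by (rule type_subring_cring) simp_all
  have "z \<in> generate_ring (type_subring UNIV) ?H" using assms(1) by (simp add: A)
  then show ?thesis
  proof induction
    case one
    then show ?case
      using const[of 1] by (metis type_subring_simps(4) unital_hom.hom_one[OF unital_hom_ratfun_const])
  next
    case (incl h)
    then consider c where "h = ratfun_const c" | i j where "h = det2 u v i j" "i < j" "j < n"
      unfolding labels by blast
    then show ?case using const label by cases simp_all
  next
    case (a_inv h)
    have "P (- h)" using uminus a_inv unfolding A by blast
    then show ?case using type_subring_uminus(1)[OF U] by simp
  next
    case (eng_add h1 h2)
    then show ?case unfolding type_subring_simps by (intro add) (simp_all only: A)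
  next
    case (eng_mult h1 h2)
    then show ?case unfolding type_subring_simps by (intro mult) (simp_all only: A)
  qed
qed

lemma A_cring: "cring (type_subring A)"
  by (rule type_subring_cring) (auto intro: A_closed)

lemma cluster_algebra_eq: "cluster_algebra n d = type_subring A"
  by (simp add: cluster_algebra_def type_subring_def A_def)

text \<open>For the closing edge the determinant is taken in the order 0, n - 1, against the
  direction of travel. The antiperiodic continuation absorbs this sign.\<close>

lemma edge_cases:
  assumes "k < n"
  obtains "Suc k < n" "edge_var k = det2 u v k (Suc k)" | "k = n - 1" "edge_var k = det2 u v 0 (n - 1)"
proof (cases "Suc k < n")
  case True
  then have "edge_var k = det2 u v k (Suc k)"
    using edges[OF assms] by (simp add: polygon_edge_def segment_det_less)
  then show ?thesis using that True by blast
next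
  case False
  then have k: "Suc k = n" using assms by simp
  then have "polygon_edge n k = {0, n - 1}" by (auto simp: polygon_edge_def)
  then have "edge_var k = det2 u v 0 (n - 1)" using edges[OF assms] n by (simp add: segment_det_less)
  then show ?thesis using that k by force
qed

lemma edge_closed: "{edge_var k - 1 | k. k < n} \<subseteq> A"
proof clarify
  fix k assume "k < n"
  then have "edge_var k \<in> A" by (cases rule: edge_cases) (use n in \<open>auto intro: A_label\<close>)
  then have "edge_var k + (- 1) \<in> A" by (intro A_closed)
  then show "edge_var k - 1 \<in> A" by simp
qed

lemma J_eq: "J = genideal (type_subring A) {edge_var k - 1 | k. k < n}"
  by (simp add: J_def specialization_ideal_def cluster_algebra_eq)

lemma J_ideal: "subring_ideal A J"
  using genideal_subring_ideal(1)[OF A_cring edge_closed] by (simp add: J_eq)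

lemma J_edge: "k < n \<Longrightarrow> edge_var k - 1 \<in> J"
  using genideal_subring_ideal(2)[OF A_cring edge_closed] by (auto simp: J_eq)

lemma I_ideal: "subring_ideal UNIV I"
  and I_equations: "groupoid_equations \<rho> \<subseteq> I"
  and I_minimal: "subring_ideal UNIV K \<Longrightarrow> groupoid_equations \<rho> \<subseteq> K \<Longrightarrow> I \<subseteq> K"
proof -
  have U: "cring (type_subring (UNIV :: ('a \<times> 'i \<times> 'i, 'k) mpoly set))" by (rule type_subring_cring) simp_all
  have I: "I = genideal (type_subring UNIV) (groupoid_equations \<rho>)"
    by (simp add: I_def equation_ideal_def type_subring_UNIV)
  show "subring_ideal UNIV I" "groupoid_equations \<rho> \<subseteq> I"
    "subring_ideal UNIV K \<Longrightarrow> groupoid_equations \<rho> \<subseteq> K \<Longrightarrow> I \<subseteq> K"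
    unfolding I by (rule genideal_subring_ideal[OF U subset_UNIV], assumption?)+
qed

interpretation J: subring_ideal A J by (rule J_ideal)
interpretation I: subring_ideal UNIV I by (rule I_ideal)

text \<open>The vectors \<open>(u k, v k)\<close> are continued to all integers by \<open>w\<^sub>k\<^sub>+\<^sub>n = - w\<^sub>k\<close>; this makes the
  edge from \<open>n - 1\<close> to \<open>0\<close> the determinant of two consecutive vectors, like the other edges.\<close>

definition antiperiodic :: "(nat \<Rightarrow> 'k ratfun) \<Rightarrow> int \<Rightarrow> 'k ratfun" where
  "antiperiodic w i = (if even (i div int n) then w (nat (i mod int n)) else - w (nat (i mod int n)))"

definition D :: "int \<Rightarrow> int \<Rightarrow> 'k ratfun" where
  "D = det2 (antiperiodic u) (antiperiodic v)"

lemma antiperiodic_add: "antiperiodic w (i + int n) = - antiperiodic w i"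
  using n by (simp add: antiperiodic_def div_add_self2)

lemma antiperiodic_nat: "k < n \<Longrightarrow> antiperiodic w (int k) = w k"
  by (simp add: antiperiodic_def)

lemma D_self: "D i i = 0"
  by (simp add: D_def det2_self)

lemma D_swap: "D j i = - D i j"
  unfolding D_def by (rule det2_swap)

lemma D_right: "D i (j + int n) = - D i j"
  by (simp add: D_def det2_def antiperiodic_add)

lemma D_left: "D (i + int n) j = - D i j"
  by (simp add: D_def det2_def antiperiodic_add)

lemma D_nat: "i < n \<Longrightarrow> j < n \<Longrightarrow> D (int i) (int j) = det2 u v i j"
  by (simp add: D_def det2_def antiperiodic_nat)

lemma D_both: "D (i + int n) (j + int n) = D i j"
  by (simp add: D_left D_right)

lemma D_closed: "D i j \<in> A"
proof -
  let ?r = "nat (i mod int n)" and ?s = "nat (j mod int n)"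
  have lt: "?r < n" "?s < n" using n by (simp_all add: nat_less_iff)
  have "det2 u v ?r ?s \<in> A"
  proof (cases ?r ?s rule: linorder_cases)
    case less
    then show ?thesis using A_label lt by blast
  next
    case equal
    then show ?thesis using J.zero_closed by (simp add: det2_self)
  next
    case greater
    then have "- det2 u v ?s ?r \<in> A" using A_label lt A_closed(2) by blast
    then show ?thesis using det2_swap[of u v ?r ?s] by simp
  qed
  moreover have "D i j = det2 u v ?r ?s \<or> D i j = - det2 u v ?r ?s"
    by (auto simp: D_def det2_def antiperiodic_def)
  ultimately show ?thesis using A_closed(2) by metis
qed

lemma D_mod: "D (i mod int n) (i mod int n + c) = D i (i + c)"
  using periodic_mod[of "\<lambda>i. D i (i + c)" "int n" i 0] D_both[of _ "_ + c"] by (simp add: add_ac)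

lemma D_succ: "D i (i + 1) - 1 \<in> J"
proof -
  define k where "k = nat (i mod int n)"
  have k: "k < n" "i mod int n = int k" using n by (simp_all add: k_def nat_less_iff)
  have "D (int k) (int k + 1) = edge_var k"
    using k(1)
  proof (cases rule: edge_cases)
    case 1
    then show ?thesis using D_nat[of k "Suc k"] k by (simp add: add.commute)
  next
    case 2
    then have "int k + 1 = int 0 + int n" using n by simp
    then have "D (int k) (int k + 1) = - D (int k) (int 0)" using D_right by metis
    then show ?thesis using D_nat[of k 0] k n 2 det2_swap[of u v k 0] by simp
  qed
  then show ?thesis using J_edge[OF k(1)] D_mod[of i 1] k(2) by simp
qed

text \<open>The Pluecker relation for i, j, j + 1, j + 2, in which the determinants of the two
  polygon edges are replaced by 1 modulo J.\<close>

lemma D_rec: "D i (j + 2) - (D j (j + 2) * D i (j + 1) - D i j) \<in> J"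
proof -
  have "D i (j + 1) * D j (j + 2) = D i j * D (j + 1) (j + 2) + D j (j + 1) * D i (j + 2)"
    unfolding D_def by (rule det2_plucker)
  then have "D i (j + 2) - (D j (j + 2) * D i (j + 1) - D i j) =
      - (D i (j + 2) * (D j (j + 1) - 1)) - D i j * (D (j + 1) (j + 1 + 1) - 1)"
    by (simp add: algebra_simps)
  also have "\<dots> \<in> J" by (intro J.J_diff J.J_uminus J.J_mult D_closed D_succ)
  finally show ?thesis .
qed

section \<open>The homomorphism from polynomials to the cluster algebra\<close>

definition \<alpha> :: "('a \<times> 'i \<times> 'i, 'k) mpoly \<Rightarrow> 'k ratfun" where
  "\<alpha> = mpoly_hom ratfun_const (\<lambda>(a, i, j). cycle_matrices (\<lambda>t. D t (t + 2)) a $ i $ j)"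

lemma \<alpha>_hom: "unital_hom \<alpha>"
  unfolding \<alpha>_def by (rule unital_hom_mpoly_hom[OF unital_hom_ratfun_const])

interpretation \<alpha>: unital_hom \<alpha> by (rule \<alpha>_hom)

lemma \<alpha>_const: "\<alpha> (mpoly_const c) = ratfun_const c"
  unfolding \<alpha>_def by (rule mpoly_hom_const[OF unital_hom_ratfun_const])

lemma \<alpha>_var: "\<alpha> (mpoly_var (a, i, j)) = cycle_matrices (\<lambda>t. D t (t + 2)) a $ i $ j"
  unfolding \<alpha>_def by (simp add: mpoly_hom_var[OF unital_hom_ratfun_const])

lemma \<alpha>_closed: "\<alpha> f \<in> A"
proof (induction f rule: mpoly_induct)
  case (var w)
  obtain a i j where "w = (a, i, j)" by (cases w)
  then show ?case using J.two_closed A_closed(2)[OF D_closed] by (auto simp: \<alpha>_var cycle_matrices_def)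
qed (simp_all add: \<alpha>_const A_const \<alpha>.homs A_closed)

lemma D_periodic: "D (t + 2 * int n) (t + 2 * int n + 2) = D t (t + 2)"
  using D_both[of "t + int n" "t + 2 + int n"] D_both[of t "t + 2"] by (simp add: algebra_simps)

lemma equations_subset: "groupoid_equations \<rho> \<subseteq> {f. \<alpha> f \<in> J}"
proof
  fix f :: "('a \<times> 'i \<times> 'i, 'k) mpoly" assume "f \<in> groupoid_equations \<rho>"
  then consider a i where "f = generic_matrices a $ i $ i - 2"
    | a i j where "f = generic_matrices a $ i $ j - generic_matrices (\<rho> i a) $ i $ j"
    | a i j k l where "i \<noteq> j" "f = (refl_prod n \<rho> generic_matrices a i j + tau_power n) $ k $ l"
    unfolding groupoid_equations_def using card_obj by auto
  then have "\<alpha> f \<in> J"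
  proof cases
    case (1 a i)
    then show ?thesis by (simp add: generic_matrices_def \<alpha>.homs \<alpha>_var cycle_matrices_def J.J_zero)
  next
    case (2 a i j)
    then show ?thesis
      using cycle_matrices_step[of "\<lambda>t. D t (t + 2)" i a j, OF D_periodic]
      by (simp add: generic_matrices_def \<alpha>.homs \<alpha>_var J.J_zero)
  next
    case (3 a i j k l)
    have "\<alpha> f = (refl_prod n \<rho> (cycle_matrices (\<lambda>t. D t (t + 2))) a i j + tau_power n) $ k $ l"
      unfolding 3(2) \<alpha>_def by (rule mpoly_hom_relation[OF unital_hom_ratfun_const])
    also have "\<dots> \<in> J"
      by (rule frieze_relation[OF J_ideal D_closed D_self D_swap D_succ D_rec D_right 3(1)])
    finally show ?thesis .
  qed
  then show "f \<in> {f. \<alpha> f \<in> J}" by simp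
qed

lemma I_subset: "f \<in> I \<Longrightarrow> \<alpha> f \<in> J"
  using I_minimal[OF subring_ideal_vimage[OF \<alpha>_hom J_ideal \<alpha>_closed] equations_subset] by blast

section \<open>The coordinate ring in terms of the edges of the cycle\<close>

definition E :: "int \<Rightarrow> ('a \<times> 'i \<times> 'i, 'k) mpoly" where
  "E t = - mpoly_var (obj t, lab t, lab (t + 1))"

lemma E_periodic: "E (t + 2 * int n) = E t"
  using periodic_mult[of lab 2 t "int n", OF lab_plus_two] periodic_mult[of lab 2 "t + 1" "int n", OF lab_plus_two]
  by (simp add: E_def obj_periodic add_ac)

lemma \<alpha>_E: "\<alpha> (E t) = D t (t + 2)"
  using cycle_matrices_forward[of "\<lambda>t. D t (t + 2)" t, OF D_periodic]
  by (simp add: E_def \<alpha>.hom_uminus \<alpha>_var)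

text \<open>Modulo the equations, every indeterminate is \<open>2\<close> or \<open>- E t\<close> for an edge \<open>t\<close> of the cycle.\<close>

definition \<theta> :: "('a \<times> 'i \<times> 'i, 'k) mpoly \<Rightarrow> ('a \<times> 'i \<times> 'i, 'k) mpoly" where
  "\<theta> = mpoly_hom mpoly_const (\<lambda>(a, i, j). cycle_matrices E a $ i $ j)"

text \<open>\<open>E\<close> uses the variable at the first end point of each edge. The variable at
  the other end point is linked to it by the equation comparing a with \<rho> i a, and diagonal
  variables are 2 modulo I.\<close>

lemma var_diff: "mpoly_var (a, i, j) - cycle_matrices E a $ i $ j \<in> I"
proof (cases "i = j")
  case True
  have "generic_matrices a $ i $ i - 2 \<in> groupoid_equations \<rho>"
    unfolding groupoid_equations_def by blast
  then show ?thesis using True I_equations by (auto simp: generic_matrices_def cycle_matrices_def)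
next
  case False
  then show ?thesis
  proof (cases rule: walk_cases[of i j a])
    case (1 t)
    then show ?thesis using cycle_matrices_forward[of E t, OF E_periodic] by (simp add: E_def I.J_zero)
  next
    case (2 t)
    have "generic_matrices a $ i $ j - generic_matrices (\<rho> i a) $ i $ j \<in> (groupoid_equations \<rho> :: (_, 'k) mpoly set)"
      unfolding groupoid_equations_def by blast
    then have "mpoly_var (a, i, j) - mpoly_var (\<rho> i a, i, j) \<in> I"
      using I_equations by (auto simp: generic_matrices_def)
    then show ?thesis
      using 2 cycle_matrices_backward[of E t, OF E_periodic] step_back[of "t - 1"] by (simp add: E_def)
  qed
qed

lemma \<theta>_diff: "f - \<theta> f \<in> I"
proof -
  interpret \<theta>: unital_hom \<theta> unfolding \<theta>_def by (rule unital_hom_mpoly_hom[OF unital_hom_mpoly_const])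
  show ?thesis
  proof (induction f rule: mpoly_induct)
    case (const c)
    then show ?case by (simp add: \<theta>_def mpoly_hom_const[OF unital_hom_mpoly_const] I.J_zero)
  next
    case (var w)
    obtain a i j where "w = (a, i, j)" by (cases w)
    then show ?case using var_diff by (simp add: \<theta>_def mpoly_hom_var[OF unital_hom_mpoly_const])
  next
    case (add p q)
    then show ?case using I.J_add by (fastforce simp: \<theta>.hom_add algebra_simps)
  next
    case (mult p q)
    then have "p * (q - \<theta> q) + \<theta> q * (p - \<theta> p) \<in> I" by (intro I.J_add I.J_mult) simp_all
    then show ?case by (simp add: \<theta>.hom_mult algebra_simps)
  qed
qed

text \<open>The generic relation lies in I and differs from its image under \<theta> by an element
  of I; this image is the relation for \<open>cycle_matrices E\<close>.\<close>

lemma cycle_relation: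
  assumes "i \<noteq> j"
  shows "(refl_prod n \<rho> (cycle_matrices E) a i j + tau_power n) $ k $ l \<in> I"
proof -
  let ?f = "(refl_prod n \<rho> generic_matrices a i j + tau_power n) $ k $ l :: ('a \<times> 'i \<times> 'i, 'k) mpoly"
  have n2: "CARD('a) div 2 = n" using card_obj by simp
  have "?f \<in> groupoid_equations \<rho>"
    unfolding groupoid_equations_def n2 using assms by blast
  then have "?f - (?f - \<theta> ?f) \<in> I" by (intro I.J_diff \<theta>_diff subsetD[OF I_equations])
  moreover have "\<theta> ?f = (refl_prod n \<rho> (cycle_matrices E) a i j + tau_power n) $ k $ l"
    unfolding \<theta>_def by (rule mpoly_hom_relation[OF unital_hom_mpoly_const])
  ultimately show ?thesis by (simp only: diff_diff_eq2 add_diff_cancel_left')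
qed

section \<open>From the cluster algebra back to the coordinate ring\<close>

definition c :: "nat \<Rightarrow> nat \<Rightarrow> ('a \<times> 'i \<times> 'i, 'k) mpoly" where
  "c = continuant (\<lambda>s. E (int s))"

lemma c_right: "c i (j + n) + c i j \<in> I"
  by (rule solution_antiperiodic[of E I "c i" j, OF E_periodic I_ideal cycle_relation])
    (simp_all add: c_def continuant_rec)

text \<open>The free variable number s is replaced by the variable of edge s. Taking the value of an
  element of A and applying \<gamma> inverts \<alpha> modulo I.\<close>

definition \<gamma> :: "(nat, 'k) mpoly \<Rightarrow> ('a \<times> 'i \<times> 'i, 'k) mpoly" where
  "\<gamma> = mpoly_hom mpoly_const (\<lambda>s. E (int s))"

lemma \<gamma>_hom: "unital_hom \<gamma>"
  unfolding \<gamma>_def by (rule unital_hom_mpoly_hom[OF unital_hom_mpoly_const])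

interpretation \<gamma>: unital_hom \<gamma> by (rule \<gamma>_hom)

lemma \<gamma>_const: "\<gamma> (mpoly_const x) = mpoly_const x"
  unfolding \<gamma>_def by (rule mpoly_hom_const[OF unital_hom_mpoly_const])

lemma \<gamma>_continuant: "\<gamma> (continuant mpoly_var i j) = c i j"
  unfolding \<gamma>.hom_continuant c_def by (simp add: \<gamma>_def mpoly_hom_var[OF unital_hom_mpoly_const])

abbreviation spz :: "'k ratfun \<Rightarrow> (nat, 'k) mpoly \<Rightarrow> bool" where
  "spz \<equiv> specializes (label_specialization n d)"

lemmas spz_ops = specializes_add[OF unital_hom_label_specialization]
  specializes_mult[OF unital_hom_label_specialization]
  specializes_uminus[OF unital_hom_label_specialization]

lemma spz_const: "spz (ratfun_const x) (mpoly_const x)"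
  using specializes_fr[OF unital_hom_label_specialization, of n d "mpoly_const x"]
  by (simp add: label_specialization_const ratfun_const_def)

lemma spz_int: "spz 0 0" "spz 1 1" "spz 2 2"
proof -
  interpret r: unital_hom "ratfun_const :: 'k \<Rightarrow> _" by (rule unital_hom_ratfun_const)
  interpret m: unital_hom "mpoly_const :: 'k \<Rightarrow> (nat, 'k) mpoly" by (rule unital_hom_mpoly_const)
  show "spz 0 0" "spz 1 1" "spz 2 2"
    using spz_const[of 0] spz_const[of 1] spz_const[of 2] by (simp_all only: r.homs m.homs)
qed

lemma spz_exists: "z \<in> A \<Longrightarrow> \<exists>p. spz z p"
proof (induction rule: A_induct)
  case (const x)
  show ?case using spz_const by blast
next
  case (label i j)
  then show ?case using specialization by blast
next
  case (uminus z)
  then show ?case using spz_ops(3) by blast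
next
  case (add z z')
  then show ?case using spz_ops(1) by blast
next
  case (mult z z')
  then show ?case using spz_ops(2) by blast
qed

text \<open>The elements of A that have a value sent into I by \<gamma> form an ideal of A, so only
  the generators \<open>edge_var k - 1\<close> have to be examined.\<close>

lemma J_spz:
  assumes "z \<in> J"
  shows "\<exists>p. spz z p \<and> \<gamma> p \<in> I"
proof -
  let ?K = "{z \<in> A. \<exists>p. spz z p \<and> \<gamma> p \<in> I}"
  have K: "subring_ideal A ?K"
  proof
    show "0 \<in> ?K" using spz_int(1) J.zero_closed by (auto intro!: exI[of _ 0] simp: \<gamma>.homs I.J_zero)
    show "a + b \<in> ?K" if "a \<in> ?K" "b \<in> ?K" for a b
    proof -
      obtain p q where "spz a p" "\<gamma> p \<in> I" "spz b q" "\<gamma> q \<in> I" using \<open>a \<in> ?K\<close> \<open>b \<in> ?K\<close> by blast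
      then have "spz (a + b) (p + q)" "\<gamma> (p + q) \<in> I" by (simp_all add: spz_ops \<gamma>.homs I.J_add)
      then show ?thesis using that A_closed by blast
    qed
    show "a * b \<in> ?K" if "a \<in> A" "b \<in> ?K" for a b
    proof -
      obtain p q where "spz a p" "spz b q" "\<gamma> q \<in> I" using spz_exists[OF \<open>a \<in> A\<close>] \<open>b \<in> ?K\<close> by blast
      then have "spz (a * b) (p * q)" "\<gamma> (p * q) \<in> I" by (simp_all add: spz_ops \<gamma>.homs I.J_mult)
      then show ?thesis using that A_closed by blast
    qed
  qed (auto intro: A_closed)
  have edge: "\<exists>p. spz (edge_var k - 1) p \<and> \<gamma> p \<in> I" if "k < n" for k
    using that
  proof (cases rule: edge_cases)
    case 1
    have "spz (edge_var k + (- 1)) (continuant mpoly_var k (Suc k) + (- 1))"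
      unfolding 1(2) by (intro spz_ops specialization spz_int) (use 1 in simp_all)
    then show ?thesis by (intro exI[of _ 0]) (simp add: continuant_Suc \<gamma>.homs I.J_zero)
  next
    case 2
    have "spz (edge_var k + (- 1)) (continuant mpoly_var 0 (n - 1) + (- 1))"
      unfolding 2(2) by (intro spz_ops specialization spz_int) (use n in simp_all)
    \<comment> \<open>Here the path closes up: by antiperiodicity c (n - 1) n and c (n - 1) 0 = - c
      0 (n - 1) add up to an element of I.\<close>
    moreover have "c (n - 1) n = 1" using continuant_Suc[of _ "n - 1"] n by (simp add: c_def)
    then have "1 - c 0 (n - 1) \<in> I"
      using c_right[of "n - 1" 0] continuant_swap[of "\<lambda>s. E (int s)" "n - 1" 0] by (simp add: c_def)
    then have "\<gamma> (continuant mpoly_var 0 (n - 1) + (- 1)) \<in> I"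
      using I.J_uminus by (fastforce simp: \<gamma>.homs \<gamma>_continuant)
    ultimately show ?thesis by auto
  qed
  then have "{edge_var k - 1 | k. k < n} \<subseteq> ?K" using edge_closed by blast
  then have "J \<subseteq> ?K" using genideal_subring_ideal(3)[OF A_cring edge_closed K] by (simp add: J_eq)
  then show ?thesis using assms by blast
qed

text \<open>Objects recur only after 2 n steps, but modulo I the entries already recur after n:
  shifting both arguments of c (r, r + 2) by n changes the sign twice.\<close>

lemma E_shift: "E (int (r + n)) - E (int r) \<in> I"
proof -
  have "c (r + n) (r + n + 2) = E (int (r + n))" "c r (r + 2) = E (int r)"
    using continuant_Suc_Suc[of "\<lambda>s. E (int s)"] by (simp_all add: c_def)
  moreover have "c (r + n) (r + 2 + n) + c (r + n) (r + 2) \<in> I" by (rule c_right)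
  moreover have "- c (r + 2) (r + n) - c (r + 2) r \<in> I"
    using I.J_uminus[OF c_right[of "r + 2" r]] by simp
  then have "c (r + n) (r + 2) + c r (r + 2) \<in> I"
    using continuant_swap[of "\<lambda>s. E (int s)" "r + 2"] by (simp add: c_def)
  ultimately show ?thesis using I.J_diff by (fastforce simp: add_ac)
qed

text \<open>For r + 2 < n the determinant is itself a label. Otherwise r + 2 wraps around to s = r +
  2 - n, and the label of {s, r} has the value c s r under \<gamma>, which agrees with
  \<open>E r\<close> modulo I by antiperiodicity.\<close>

lemma E_spz_nat:
  assumes "r < n"
  shows "\<exists>p. spz (D (int r) (int r + 2)) p \<and> E (int r) - \<gamma> p \<in> I"
proof (cases "r + 2 < n")
  case True
  then have "D (int r) (int r + 2) = det2 u v r (r + 2)"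
    using D_nat[of r "r + 2"] by (simp add: add.commute)
  moreover have "\<gamma> (continuant mpoly_var r (r + 2)) = E (int r)"
    using continuant_Suc_Suc[of "\<lambda>s. E (int s)" r] by (simp add: \<gamma>_continuant c_def)
  ultimately show ?thesis using specialization[of r "r + 2"] True I.J_zero by auto
next
  case False
  define s where "s = r + 2 - n"
  have s: "r + 2 = s + n" "s < r" "s < n" using False assms n by (auto simp: s_def)
  have "int r + 2 = int s + int n" using s by simp
  then have "D (int r) (int r + 2) = - D (int r) (int s)" using D_right by metis
  then have "D (int r) (int r + 2) = det2 u v s r"
    using D_nat[of r s] s assms det2_swap[of u v r s] by simp
  moreover have "E (int r) - c s r \<in> I"
    using c_right[of r s] continuant_Suc_Suc[of "\<lambda>s. E (int s)" r] continuant_swap[of "\<lambda>s. E (int s)" r s] s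
    by (simp add: c_def flip: s(1))
  ultimately show ?thesis using specialization[of s r] s assms by (auto simp: \<gamma>_continuant)
qed

lemma E_spz: "\<exists>p. spz (D t (t + 2)) p \<and> E t - \<gamma> p \<in> I"
proof -
  define r where "r = nat (t mod (2 * int n))"
  have r: "int r = t mod (2 * int n)" "r < 2 * n" using n by (simp_all add: r_def nat_less_iff)
  have t: "D t (t + 2) = D (int r) (int r + 2)" "E t = E (int r)"
    using periodic_mod[of "\<lambda>t. D t (t + 2)" "2 * int n" t 0, OF D_periodic]
      periodic_mod[of E "2 * int n" t 0, OF E_periodic] by (simp_all add: r(1))
  show ?thesis
  proof (cases "r < n")
    case True
    then show ?thesis using E_spz_nat t by simp
  next
    case False
    define s where "s = r - n"
    have s: "r = s + n" "s < n" using False r(2) by (simp_all add: s_def)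
    obtain p where p: "spz (D (int s) (int s + 2)) p" "E (int s) - \<gamma> p \<in> I" using E_spz_nat[OF s(2)] by blast
    have "D (int r) (int r + 2) = D (int s) (int s + 2)"
      using D_both[of "int s" "int s + 2"] by (simp add: s(1) add_ac)
    moreover have "E (int r) - \<gamma> p \<in> I" using I.J_add[OF E_shift[of s] p(2)] by (simp add: s(1))
    ultimately show ?thesis using p(1) t by auto
  qed
qed

text \<open>This is one half of the inversion: \<alpha>, then the value in continuants, then
  \<gamma> returns f modulo I. It is verified on constants and variables and passes to sums and
  products.\<close>

lemma \<alpha>_spz: "\<exists>p. spz (\<alpha> f) p \<and> f - \<gamma> p \<in> I"
proof (induction f rule: mpoly_induct)
  case (const x)
  then show ?case
    by (intro exI[of _ "mpoly_const x"]) (simp add: \<alpha>_const \<gamma>_const spz_const I.J_zero)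
next
  case (var w)
  obtain a i j where w: "w = (a, i, j)" by (cases w)
  show ?case
  proof (cases "i = j")
    case True
    then have "\<alpha> (mpoly_var w) = 2" by (simp add: w \<alpha>_var cycle_matrices_def)
    moreover have "mpoly_var w - 2 \<in> I" using var_diff[of a i j] True by (simp add: w cycle_matrices_def)
    ultimately show ?thesis using spz_int(3) by (intro exI[of _ 2]) (simp add: \<gamma>.homs)
  next
    case False
    obtain p where p: "spz (D (edge_pos a i) (edge_pos a i + 2)) p" "E (edge_pos a i) - \<gamma> p \<in> I"
      using E_spz by blast
    have "\<alpha> (mpoly_var w) = - D (edge_pos a i) (edge_pos a i + 2)"
      using False by (simp add: w \<alpha>_var cycle_matrices_def)
    moreover have "mpoly_var w - (- E (edge_pos a i)) \<in> I"
      using var_diff[of a i j] False by (simp add: w cycle_matrices_def)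
    then have "mpoly_var w - \<gamma> (- p) \<in> I"
      using I.J_diff[OF _ p(2)] by (fastforce simp: \<gamma>.homs)
    ultimately show ?thesis using spz_ops(3)[OF p(1)] by auto
  qed
next
  case (add f g)
  then obtain p q where pq: "spz (\<alpha> f) p" "f - \<gamma> p \<in> I" "spz (\<alpha> g) q" "g - \<gamma> q \<in> I" by blast
  have "(f + g) - \<gamma> (p + q) = (f - \<gamma> p) + (g - \<gamma> q)" by (simp add: \<gamma>.hom_add)
  also have "\<dots> \<in> I" by (intro I.J_add pq)
  finally have "(f + g) - \<gamma> (p + q) \<in> I" .
  then show ?case using spz_ops(1)[OF pq(1,3)] by (auto simp: \<alpha>.homs)
next
  case (mult f g)
  then obtain p q where pq: "spz (\<alpha> f) p" "f - \<gamma> p \<in> I" "spz (\<alpha> g) q" "g - \<gamma> q \<in> I" by blast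
  have "f * g - \<gamma> (p * q) = f * (g - \<gamma> q) + \<gamma> q * (f - \<gamma> p)" by (simp add: \<gamma>.homs algebra_simps)
  also have "\<dots> \<in> I" by (intro I.J_add I.J_mult pq UNIV_I)
  finally have "f * g - \<gamma> (p * q) \<in> I" .
  then show ?case using spz_ops(2)[OF pq(1,3)] by (auto simp: \<alpha>.homs)
qed

text \<open>If \<alpha> f lies in J, it has a value sent into I by \<gamma>, and also a value sent
  to f modulo I. Values are unique, hence f lies in I.\<close>

lemma \<alpha>_kernel: "\<alpha> f \<in> J \<longleftrightarrow> f \<in> I"
proof
  assume "\<alpha> f \<in> J"
  then obtain p where p: "spz (\<alpha> f) p" "\<gamma> p \<in> I" using J_spz by blast
  obtain p' where p': "spz (\<alpha> f) p'" "f - \<gamma> p' \<in> I" using \<alpha>_spz by blast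
  have "p = p'" by (rule specializes_unique[OF unital_hom_label_specialization p(1) p'(1)])
  then show "f \<in> I" using I.J_add[OF p'(2) p(2)] by simp
qed (rule I_subset)

text \<open>For fixed i the determinants with w_j follow, modulo J, a recurrence whose coefficients
  D t (t + 2) are images under \<alpha>. So each label is congruent to the image of a polynomial in
  the \<open>E t\<close>.\<close>

lemma \<alpha>_surj: "z \<in> A \<Longrightarrow> \<exists>f. z - \<alpha> f \<in> J"
proof (induction rule: A_induct)
  case (const x)
  then show ?case by (intro exI[of _ "mpoly_const x"]) (simp add: \<alpha>_const J.J_zero)
next
  case (label i j)
  let ?e = "\<lambda>s. D (int i + int s) (int i + int s + 2)"
  have "D (int i) (int i + int (j - i)) - lin_rec ?e 0 1 (j - i) \<in> J"
  proof (rule J.lin_rec_cong)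
    fix s
    show "D (int i) (int i + int (Suc (Suc s))) -
        (?e s * D (int i) (int i + int (Suc s)) - D (int i) (int i + int s)) \<in> J"
      using D_rec[of "int i" "int i + int s"] by (simp add: add_ac)
  qed (use D_succ[of "int i"] in \<open>simp_all add: D_closed D_self J.J_zero\<close>)
  moreover have "lin_rec ?e 0 1 (j - i) = \<alpha> (lin_rec (\<lambda>s. E (int i + int s)) 0 1 (j - i))"
    by (simp add: \<alpha>.hom_lin_rec \<alpha>_E \<alpha>.homs)
  moreover have "D (int i) (int i + int (j - i)) = det2 u v i j"
    using D_nat[of i j] label by simp
  ultimately show ?case by metis
next
  case (uminus z)
  then obtain f where "z - \<alpha> f \<in> J" by blast
  then have "- z - \<alpha> (- f) \<in> J" using J.J_uminus by (fastforce simp: \<alpha>.homs)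
  then show ?case by blast
next
  case (add z z')
  then obtain f f' where "z - \<alpha> f \<in> J" "z' - \<alpha> f' \<in> J" by blast
  then have "(z - \<alpha> f) + (z' - \<alpha> f') \<in> J" by (rule J.J_add)
  then have "z + z' - \<alpha> (f + f') \<in> J" by (simp add: \<alpha>.homs algebra_simps)
  then show ?case by blast
next
  case (mult z z')
  then obtain f f' where "z - \<alpha> f \<in> J" "z' - \<alpha> f' \<in> J" by blast
  then have "z * (z' - \<alpha> f') + \<alpha> f' * (z - \<alpha> f) \<in> J" using mult \<alpha>_closed by (intro J.J_add J.J_mult)
  then have "z * z' - \<alpha> (f * f') \<in> J" by (simp add: \<alpha>.homs algebra_simps)
  then show ?case by blast
qed

lemma spectra_isomorphic:
  "spec_isomorphic_over
     (coordinate_ring_const (groupoid_equations \<rho>) :: 'k \<Rightarrow> _)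
     (coordinate_ring (groupoid_equations \<rho>))
     (specialized_cluster_algebra_const n d)
     (specialized_cluster_algebra n d)"
proof -
  obtain f g where iso: "cring_iso (type_subring UNIV Quot I) (type_subring A Quot J) f g"
    and f: "\<And>x. f (I +>\<^bsub>type_subring UNIV\<^esub> x) = J +>\<^bsub>type_subring A\<^esub> \<alpha> x"
    using quotient_cring_iso[OF A_cring J_ideal I_ideal \<alpha>_hom \<alpha>_closed \<alpha>_kernel \<alpha>_surj] by metis
  interpret cring_iso "type_subring UNIV Quot I" "type_subring A Quot J" f g by (rule iso)
  interpret inv: cring_iso "type_subring A Quot J" "type_subring UNIV Quot I" g f by (rule inverse)
  have closed: "I +>\<^bsub>type_subring UNIV\<^esub> x \<in> carrier (type_subring UNIV Quot I)" for x
    by (auto simp: FactRing_def A_RCOSETS_def' type_subring_simps)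
  have const: "f (coordinate_ring_const (groupoid_equations \<rho>) x) = specialized_cluster_algebra_const n d x"
    "coordinate_ring_const (groupoid_equations \<rho>) x \<in> carrier (type_subring UNIV Quot I)" for x
    using f[of "mpoly_const x"] closed[of "mpoly_const x"]
    by (simp_all add: coordinate_ring_const_def specialized_cluster_algebra_const_def \<alpha>_const
        cluster_algebra_eq J_def I_def type_subring_UNIV)
  have "spec_isomorphic_over
     (coordinate_ring_const (groupoid_equations \<rho>)) (type_subring UNIV Quot I)
     (specialized_cluster_algebra_const n d) (type_subring A Quot J)"
  proof (rule inv.spec_isomorphic)
    fix x
    show "specialized_cluster_algebra_const n d x \<in> carrier (type_subring A Quot J)"
      using const[of x] hom.hom_closed by metis
    show "g (specialized_cluster_algebra_const n d x) = coordinate_ring_const (groupoid_equations \<rho>) x"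
      using const[of x] gf by metis
  qed
  then show ?thesis
    by (simp add: coordinate_ring_def specialized_cluster_algebra_def cluster_algebra_eq J_def I_def type_subring_UNIV)
qed

end

section \<open>Groupoids with a given diagram as a zero locus\<close>

text \<open>Since each label acts as an involution, at most one edge with that label meets an
  object, and its other end is the image; an object that no such edge meets is fixed.\<close>

lemma object_change_diagram_eq:
  fixes \<rho> \<rho>' :: "'i \<Rightarrow> 'a \<Rightarrow> 'a"
  assumes "\<And>i a. \<rho> i (\<rho> i a) = a" "\<And>i a. \<rho>' i (\<rho>' i a) = a"
    and "object_change_diagram \<rho>' = object_change_diagram \<rho>"
  shows "\<rho>' = \<rho>"
proof -
  have *: "\<rho>2 i a = \<rho>1 i a"
    if "\<rho>1 i a \<noteq> a" "object_change_diagram \<rho>1 = object_change_diagram \<rho>2" "\<And>i a. \<rho>2 i (\<rho>2 i a) = a"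
    for \<rho>1 \<rho>2 :: "'i \<Rightarrow> 'a \<Rightarrow> 'a" and i a
  proof -
    have "(i, {a, \<rho>1 i a}) \<in> snd (object_change_diagram \<rho>1)"
      using that(1) by (auto simp: object_change_diagram_def)
    then have "(i, {a, \<rho>1 i a}) \<in> snd (object_change_diagram \<rho>2)" using that(2) by simp
    then obtain b where "{a, \<rho>1 i a} = {b, \<rho>2 i b}" by (auto simp: object_change_diagram_def)
    then show ?thesis using that(3)[of i b] by (auto simp: doubleton_eq_iff)
  qed
  show ?thesis
  proof (intro ext)
    fix i a
    show "\<rho>' i a = \<rho> i a"
      using *[of \<rho>' i a \<rho>] *[of \<rho> i a \<rho>'] assms by metis
  qed
qed

text \<open>Whether a morphism from a to b exists depends only on the existence of a sequence of
  labels leading from a to b, whatever the matrices are.\<close>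

lemma connected_groupoid_cong:
  fixes C :: "'a \<Rightarrow> 'k::comm_ring_1 ^ 'i::finite ^ 'i"
  shows "connected_groupoid \<rho> C \<Longrightarrow> connected_groupoid \<rho> (C' :: 'a \<Rightarrow> 'k ^ 'i ^ 'i)"
proof -
  have "\<exists>M'. (a, M', b) \<in> weyl_groupoid \<rho> C'" if "(a, M, b) \<in> weyl_groupoid \<rho> C" for a M b
    using that by induction (blast intro: weyl_groupoid.intros)+
  then show "connected_groupoid \<rho> C \<Longrightarrow> connected_groupoid \<rho> C'"
    unfolding connected_groupoid_def by meson
qed

lemma zero_locus_iff:
  fixes C :: "'a \<Rightarrow> 'k::comm_ring_1 ^ 'i::finite ^ 'i"
  shows "C \<in> zero_locus (groupoid_equations \<rho>) \<longleftrightarrow>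
    (\<forall>a i. C a $ i $ i = 2) \<and> (\<forall>a i j. C a $ i $ j = C (\<rho> i a) $ i $ j) \<and>
    (\<forall>a i j. i \<noteq> j \<longrightarrow> refl_prod (CARD('a) div 2) \<rho> C a i j = - tau_power (CARD('a) div 2))"
proof -
  have id: "unital_hom (\<lambda>x. x :: 'k)" by unfold_locales simp_all
  let ?h = "mpoly_eval (\<lambda>(a, j, k). C a $ j $ k)"
  interpret unital_hom ?h unfolding mpoly_eval_hom by (rule unital_hom_mpoly_hom[OF id])
  have var: "?h (generic_matrices a $ i $ j) = C a $ i $ j" for a i j
    by (simp add: generic_matrices_def mpoly_eval_hom mpoly_hom_var[OF id])
  have rel: "?h ((refl_prod m \<rho> generic_matrices a i j + tau_power m) $ k $ l) =
      (refl_prod m \<rho> C a i j + tau_power m) $ k $ l" for m a i j k l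
    unfolding mpoly_eval_hom by (rule mpoly_hom_relation[OF id])
  have neg: "M = - N \<longleftrightarrow> (\<forall>k l. (M + N) $ k $ l = 0)" for M N :: "'k ^ 'i ^ 'i"
    by (simp add: vec_eq_iff eq_neg_iff_add_eq_0)
  have Ball: "(\<forall>f\<in>{F a i | a i. True}. P f) \<longleftrightarrow> (\<forall>a i. P (F a i))"
    "(\<forall>f\<in>{G a i j | a i j. True}. P f) \<longleftrightarrow> (\<forall>a i j. P (G a i j))"
    "(\<forall>f\<in>{H a i j k l | a i j k l. i \<noteq> j}. P f) \<longleftrightarrow> (\<forall>a i j. i \<noteq> j \<longrightarrow> (\<forall>k l. P (H a i j k l)))"
    for P :: "('a \<times> 'i \<times> 'i, 'k) mpoly \<Rightarrow> bool"
      and F :: "'a \<Rightarrow> 'i \<Rightarrow> _" and G :: "'a \<Rightarrow> 'i \<Rightarrow> 'i \<Rightarrow> _" and H :: "'a \<Rightarrow> 'i \<Rightarrow> 'i \<Rightarrow> 'i \<Rightarrow> 'i \<Rightarrow> _"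
    by blast+
  show ?thesis
    unfolding zero_locus_def groupoid_equations_def mem_Collect_eq ball_Un Ball rel neg
    by (simp add: homs var conj_assoc)
qed

theorem theorem1p2:
  fixes n :: nat
    and \<rho> :: "'i::finite \<Rightarrow> 'a \<Rightarrow> 'a"
    and C :: "'a \<Rightarrow> 'k::idom ^ 'i ^ 'i"
    and d :: "nat \<Rightarrow> nat set"
  assumes "3 \<le> n"
    and "finite_reflection_groupoid \<rho> C"
    and "connected_groupoid \<rho> C"
    and "CARD('a) = 2 * n"
    and "triangulation n (d ` {..<n - 3})"
    and "inj_on d {..<n - 3}"
  shows "{(\<rho>', C' :: 'a \<Rightarrow> 'k ^ 'i ^ 'i).
            finite_reflection_groupoid \<rho>' C' \<and> connected_groupoid \<rho>' C' \<and>
            object_change_diagram \<rho>' = object_change_diagram \<rho>}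
           = {\<rho>} \<times> zero_locus (groupoid_equations \<rho>) \<and>
         spec_isomorphic_over
           (coordinate_ring_const (groupoid_equations \<rho>) :: 'k \<Rightarrow> _)
           (coordinate_ring (groupoid_equations \<rho>))
           (specialized_cluster_algebra_const n d)
           (specialized_cluster_algebra n d)"
proof
  have \<rho>: "CARD('i) = 2" "\<And>i a. \<rho> i (\<rho> i a) = a" "is_cycle (object_change_diagram \<rho>)"
    using assms(2) by (auto simp: finite_reflection_groupoid_def cartan_scheme_def)
  have fin: "finite_reflection_groupoid \<rho> C' \<longleftrightarrow> C' \<in> zero_locus (groupoid_equations \<rho>)"
    for C' :: "'a \<Rightarrow> 'k ^ 'i ^ 'i"
    by (simp only: zero_locus_iff finite_reflection_groupoid_def cartan_scheme_def \<rho> simp_thms conj_assoc)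
  have unique: "\<rho>' = \<rho>"
    if "finite_reflection_groupoid \<rho>' C'" "object_change_diagram \<rho>' = object_change_diagram \<rho>"
    for \<rho>' and C' :: "'a \<Rightarrow> 'k ^ 'i ^ 'i"
  proof (rule object_change_diagram_eq[OF \<rho>(2) _ that(2)])
    show "\<rho>' i (\<rho>' i a) = a" for i a
      using that(1) unfolding finite_reflection_groupoid_def cartan_scheme_def by blast
  qed
  show "{(\<rho>', C' :: 'a \<Rightarrow> 'k ^ 'i ^ 'i).
            finite_reflection_groupoid \<rho>' C' \<and> connected_groupoid \<rho>' C' \<and>
            object_change_diagram \<rho>' = object_change_diagram \<rho>}
           = {\<rho>} \<times> zero_locus (groupoid_equations \<rho>)"
    using fin unique connected_groupoid_cong[OF assms(3)] by blast
next
  obtain obj lab where "object_cycle \<rho> n obj lab"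
    using object_cycle_exists[OF assms(1,2,4)] .
  then interpret object_cycle \<rho> n obj lab .
  show "spec_isomorphic_over
           (coordinate_ring_const (groupoid_equations \<rho>) :: 'k \<Rightarrow> _)
           (coordinate_ring (groupoid_equations \<rho>))
           (specialized_cluster_algebra_const n d)
           (specialized_cluster_algebra n d)"
  proof (rule labels_determinants[where 'k = 'k, OF triangulation_inner_triangles[OF assms(5,1)] assms(1,6)])
    fix u v :: "nat \<Rightarrow> 'k ratfun"
    assume "labels n d cluster_var edge_var = {det2 u v i j | i j. i < j \<and> j < n}"
      and "\<And>k. k < n \<Longrightarrow> edge_var k = segment_det u v (polygon_edge n k)"
      and "\<And>i j. i < j \<Longrightarrow> j < n \<Longrightarrow>
        specializes (label_specialization n d) (det2 u v i j) (continuant mpoly_var i j)"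
    then interpret frieze_setup \<rho> n obj lab d u v by unfold_locales
    show ?thesis by (rule spectra_isomorphic)
  qed
qed

end
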